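(* Let $R$ be a commutative ring, let $H$ be a bialgebra over $R$, and let $A$ be a right $H$-comodule algebra with subalgebra of coinvariants $B=A^{co\,H}$. Assume that $A$ and $H$ are flat Mittag--Leffler $R$-modules. Then the map $$\phi:\mathrm{Quot}_{gen}(H)\to \mathrm{Sub}_{Alg}(A/B),\qquad \phi(Q)=A^{co\,Q},$$ together with the map $\psi:\mathrm{Sub}_{Alg}(A/B)\to\mathrm{Quot}_{gen}(H)$ given by $$\psi(S)=\bigvee\{Q\in\mathrm{Quot}_{gen}(H): S\subseteq A^{co\,Q}\}\qquad (S\in \mathrm{Sub}_{Alg}(A/B))$$ is a Galois connection between the posets $\mathrm{Sub}_{Alg}(A/B)$ and $\mathrm{Quot}_{gen}(H)$.
   Context: Algebras are associative and unital; $\otimes$ is over $R$. A right $H$-comodule algebra is an $R$-algebra $A$ with a counital coassociative coaction $\delta_A:A\to A\otimes H$, $\delta_A(a)=a_{(0)}\otimes a_{(1)}$, that is an algebra homomorphism; $A^{co\,H}=\{a\in A:\delta_A(a)=a\otimes 1_H\}$. An $R$-module $M$ is Mittag--Leffler if for every family $(M_\lambda)_{\lambda\in\Lambda}$ of $R$-modules the canonical map $M\otimes\prod_\lambda M_\lambda\to\prod_\lambda (M\otimes M_\lambda)$ is injective. $\mathrm{Sub}_{Alg}(A/B)$ is the poset (under inclusion) of subalgebras $S$ with $B\subseteq S\subseteq A$. A generalised quotient of $H$ is a quotient $Q=H/I$ by a right ideal coideal $I$ (a coideal is a submodule such that $H/I$ is a coalgebra and $H\to H/I$ is a coalgebra map).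 $\mathrm{Quot}_{gen}(H)$ is the set of generalised quotients ordered by $H/I\succcurlyeq H/J\Leftrightarrow I\subseteq J$; it is a complete lattice and $\bigvee$ is its supremum. For $Q\in\mathrm{Quot}_{gen}(H)$ with projection $\pi:H\to Q$, $A^{co\,Q}=\{a\in A: a_{(0)}\otimes\pi(a_{(1)})=a\otimes\pi(1_H)\}$. A Galois connection between posets $P$ and $P'$ is a pair of order-reversing maps $f:P\to P'$, $g:P'\to P$ with $p\le g(f(p))$ and $p'\le f(g(p'))$ for all $p\in P$, $p'\in P'$. *)

theory Defs
  imports "HOL-Algebra.Module" "HOL-Algebra.Subrings" "HOL-Algebra.QuotRing"
    "HOL-Algebra.Complete_Lattice"
begin

section \<open>Modules\<close>

definition mod_hom ::
    "('r, 'z) ring_scheme \<Rightarrow> ('r, 'm, 'x) module_scheme \<Rightarrow> ('r, 'n, 'y) module_scheme \<Rightarrow> ('m \<Rightarrow> 'n) set"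
  where "mod_hom R M N =
    {f \<in> carrier M \<rightarrow> carrier N.
       (\<forall>x\<in>carrier M. \<forall>y\<in>carrier M. f (x \<oplus>\<^bsub>M\<^esub> y) = f x \<oplus>\<^bsub>N\<^esub> f y) \<and>
       (\<forall>r\<in>carrier R. \<forall>x\<in>carrier M. f (r \<odot>\<^bsub>M\<^esub> x) = r \<odot>\<^bsub>N\<^esub> f x)}"

definition self_module :: "('r, 'z) ring_scheme \<Rightarrow> ('r, 'r) module"
  where "self_module R =
    \<lparr>carrier = carrier R, mult = mult R, one = one R, zero = zero R, add = add R, smult = mult R\<rparr>"

text \<open>The record type of modules extends that of rings; in constructions that only yield a module,
  the fields \<open>mult\<close> and \<open>one\<close> carry no information.\<close>

definition quot_module :: "('r, 'm, 'x) module_scheme \<Rightarrow> 'm set \<Rightarrow> ('r, 'm set) module"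
  where "quot_module M K =
    \<lparr>carrier = a_rcosets\<^bsub>M\<^esub> K, mult = undefined, one = undefined, zero = K, add = set_add M,
     smult = (\<lambda>r X. \<Union>x\<in>X. K +>\<^bsub>M\<^esub> (r \<odot>\<^bsub>M\<^esub> x))\<rparr>"

definition prod_module :: "'i set \<Rightarrow> ('i \<Rightarrow> ('r, 'm, 'x) module_scheme) \<Rightarrow> ('r, 'i \<Rightarrow> 'm) module"
  where "prod_module L N =
    \<lparr>carrier = (\<Pi>\<^sub>E l\<in>L. carrier (N l)), mult = undefined, one = undefined,
     zero = (\<lambda>l\<in>L. \<zero>\<^bsub>N l\<^esub>), add = (\<lambda>f g. \<lambda>l\<in>L. f l \<oplus>\<^bsub>N l\<^esub> g l),
     smult = (\<lambda>r f. \<lambda>l\<in>L. r \<odot>\<^bsub>N l\<^esub> f l)\<rparr>"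

definition free_module :: "('r, 'z) ring_scheme \<Rightarrow> 's set \<Rightarrow> ('r, 's \<Rightarrow> 'r) module"
  where "free_module R S =
    \<lparr>carrier = {f. (\<forall>s\<in>S. f s \<in> carrier R) \<and> (\<forall>s. s \<notin> S \<longrightarrow> f s = \<zero>\<^bsub>R\<^esub>) \<and> finite {s. f s \<noteq> \<zero>\<^bsub>R\<^esub>}},
     mult = undefined, one = undefined, zero = (\<lambda>s. \<zero>\<^bsub>R\<^esub>),
     add = (\<lambda>f g s. f s \<oplus>\<^bsub>R\<^esub> g s), smult = (\<lambda>r f s. r \<otimes>\<^bsub>R\<^esub> f s)\<rparr>"

definition free_basis :: "('r, 'z) ring_scheme \<Rightarrow> 's \<Rightarrow> 's \<Rightarrow> 'r"
  where "free_basis R s = (\<lambda>t. if t = s then \<one>\<^bsub>R\<^esub> else \<zero>\<^bsub>R\<^esub>)"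

definition mod_span :: "('r, 'z) ring_scheme \<Rightarrow> ('r, 'm, 'x) module_scheme \<Rightarrow> 'm set \<Rightarrow> 'm set"
  where "mod_span R M X = \<Inter>{N. submodule N R M \<and> X \<subseteq> N}"


section \<open>Tensor products\<close>

definition tensor_rels ::
    "('r, 'z) ring_scheme \<Rightarrow> ('r, 'm, 'x) module_scheme \<Rightarrow> ('r, 'n, 'y) module_scheme \<Rightarrow> ('m \<times> 'n \<Rightarrow> 'r) set"
  where "tensor_rels R M N =
    (let F = free_module R (carrier M \<times> carrier N); e = (\<lambda>m n. free_basis R (m, n)) in
       {e (m \<oplus>\<^bsub>M\<^esub> m') n \<ominus>\<^bsub>F\<^esub> (e m n \<oplus>\<^bsub>F\<^esub> e m' n) | m m' n.
          m \<in> carrier M \<and> m' \<in> carrier M \<and> n \<in> carrier N} \<union>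
       {e m (n \<oplus>\<^bsub>N\<^esub> n') \<ominus>\<^bsub>F\<^esub> (e m n \<oplus>\<^bsub>F\<^esub> e m n') | m n n'.
          m \<in> carrier M \<and> n \<in> carrier N \<and> n' \<in> carrier N} \<union>
       {e (r \<odot>\<^bsub>M\<^esub> m) n \<ominus>\<^bsub>F\<^esub> (r \<odot>\<^bsub>F\<^esub> e m n) | r m n.
          r \<in> carrier R \<and> m \<in> carrier M \<and> n \<in> carrier N} \<union>
       {e m (r \<odot>\<^bsub>N\<^esub> n) \<ominus>\<^bsub>F\<^esub> (r \<odot>\<^bsub>F\<^esub> e m n) | r m n.
          r \<in> carrier R \<and> m \<in> carrier M \<and> n \<in> carrier N})"

definition tensor_ker ::
    "('r, 'z) ring_scheme \<Rightarrow> ('r, 'm, 'x) module_scheme \<Rightarrow> ('r, 'n, 'y) module_scheme \<Rightarrow> ('m \<times> 'n \<Rightarrow> 'r) set"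
  where "tensor_ker R M N = mod_span R (free_module R (carrier M \<times> carrier N)) (tensor_rels R M N)"

definition tensor ::
    "('r, 'z) ring_scheme \<Rightarrow> ('r, 'm, 'x) module_scheme \<Rightarrow> ('r, 'n, 'y) module_scheme \<Rightarrow>
     ('r, ('m \<times> 'n \<Rightarrow> 'r) set) module"
  where "tensor R M N = quot_module (free_module R (carrier M \<times> carrier N)) (tensor_ker R M N)"

definition tens ::
    "('r, 'z) ring_scheme \<Rightarrow> ('r, 'm, 'x) module_scheme \<Rightarrow> ('r, 'n, 'y) module_scheme \<Rightarrow>
     'm \<Rightarrow> 'n \<Rightarrow> ('m \<times> 'n \<Rightarrow> 'r) set"
  where "tens R M N m n =
    tensor_ker R M N +>\<^bsub>free_module R (carrier M \<times> carrier N)\<^esub> free_basis R (m, n)"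

text \<open>The linear map from a tensor product to \<open>P\<close> with \<open>m \<otimes> n \<mapsto> b (m, n)\<close>, for bilinear \<open>b\<close>;
  bilinearity makes the value independent of the representative chosen in the class \<open>X\<close>.\<close>

definition tensor_lift ::
    "('r, 'z) ring_scheme \<Rightarrow> ('r, 'p, 'x) module_scheme \<Rightarrow> ('m \<times> 'n \<Rightarrow> 'p) \<Rightarrow> ('m \<times> 'n \<Rightarrow> 'r) set \<Rightarrow> 'p"
  where "tensor_lift R P b X =
    (let u = (SOME u. u \<in> X) in \<Oplus>\<^bsub>P\<^esub>q\<in>{q. u q \<noteq> \<zero>\<^bsub>R\<^esub>}. u q \<odot>\<^bsub>P\<^esub> b q)"

text \<open>\<open>f \<otimes> g\<close>, where \<open>M\<close> and \<open>N\<close> are the codomains of \<open>f\<close> and \<open>g\<close>\<close>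

definition tensor_map ::
    "('r, 'z) ring_scheme \<Rightarrow> ('r, 'm, 'x) module_scheme \<Rightarrow> ('r, 'n, 'y) module_scheme \<Rightarrow>
     ('k \<Rightarrow> 'm) \<Rightarrow> ('l \<Rightarrow> 'n) \<Rightarrow> ('k \<times> 'l \<Rightarrow> 'r) set \<Rightarrow> ('m \<times> 'n \<Rightarrow> 'r) set"
  where "tensor_map R M N f g = tensor_lift R (tensor R M N) (\<lambda>(k, l). tens R M N (f k) (g l))"

text \<open>The associativity isomorphism from \<open>(L \<otimes> M) \<otimes> N\<close> to \<open>L \<otimes> (M \<otimes> N)\<close>\<close>

definition tensor_assoc ::
    "('r, 'z) ring_scheme \<Rightarrow> ('r, 'l, 'w) module_scheme \<Rightarrow> ('r, 'm, 'x) module_scheme \<Rightarrow>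
     ('r, 'n, 'y) module_scheme \<Rightarrow>
     (('l \<times> 'm \<Rightarrow> 'r) set \<times> 'n \<Rightarrow> 'r) set \<Rightarrow> ('l \<times> ('m \<times> 'n \<Rightarrow> 'r) set \<Rightarrow> 'r) set"
  where "tensor_assoc R L M N =
    (let T = tensor R L (tensor R M N) in
       tensor_lift R T (\<lambda>(X, n).
         tensor_lift R T (\<lambda>(l, m). tens R L (tensor R M N) l (tens R M N m n)) X))"

text \<open>The multiplication is \<open>(a \<otimes> b)(a' \<otimes> b') = aa' \<otimes> bb'\<close>.\<close>

definition tensor_alg ::
    "('r, 'z) ring_scheme \<Rightarrow> ('r, 'a, 'x) module_scheme \<Rightarrow> ('r, 'b, 'y) module_scheme \<Rightarrow>
     ('r, ('a \<times> 'b \<Rightarrow> 'r) set) module"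
  where "tensor_alg R A B = (tensor R A B)
    \<lparr>mult := (\<lambda>X Y. tensor_lift R (tensor R A B) (\<lambda>(a, b).
               tensor_lift R (tensor R A B) (\<lambda>(a', b').
                 tens R A B (a \<otimes>\<^bsub>A\<^esub> a') (b \<otimes>\<^bsub>B\<^esub> b')) Y) X),
     one := tens R A B \<one>\<^bsub>A\<^esub> \<one>\<^bsub>B\<^esub>\<rparr>"


section \<open>Flat and Mittag-Leffler modules\<close>

text \<open>HOL cannot quantify over modules of every type inside a formula, so the test modules below live
  in the fixed type \<^typ>\<open>(nat \<Rightarrow> 'r) set\<close>, which is also the index type of the families. It
  contains the quotients of the free module of countable rank, hence a copy of every finitely generated
  module, and the families can be indexed by all submodules of that free module.

  This implies the property for test modules of any type: an equation \<open>\<Sum>\<^sub>i m\<^sub>i \<otimes> n\<^sub>i = 0\<close> in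
  \<open>M \<otimes> N\<close> uses finitely many relations, so it already holds in \<open>M \<otimes> N\<^sub>0\<close> for a finitely generated
  \<open>N\<^sub>0 \<subseteq> N\<close>. For flatness, replace an injection \<open>N \<rightarrow> N'\<close> by its restriction to suitable finitely
  generated submodules. For the Mittag-Leffler property, let \<open>\<Sum>\<^sub>i m\<^sub>i \<otimes> f\<^sub>i\<close> (with \<open>i < n\<close>) be
  in the kernel for a family \<open>(N\<^sub>\<lambda>)\<close>. For every \<open>\<lambda>\<close> there is \<open>K\<^sub>\<lambda>\<close> and an embedding of
  \<open>R\<^sup>(\<^sup>\<nat>\<^sup>)/K\<^sub>\<lambda>\<close> into \<open>N\<^sub>\<lambda>\<close>, with finitely generated image, that maps the class of the
  \<open>i\<close>-th basis vector to \<open>f\<^sub>i(\<lambda>)\<close> and such that the sum vanishes already in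
  \<open>M \<otimes> R\<^sup>(\<^sup>\<nat>\<^sup>)/K\<^sub>\<lambda>\<close>. The element is then the image of an element for the family of the
  modules \<open>R\<^sup>(\<^sup>\<nat>\<^sup>)/K\<close>, \<open>K\<close> ranging over the set of all \<open>K\<^sub>\<lambda>\<close>, and this one is also in the
  kernel.\<close>

definition flat_module :: "('r, 'z) ring_scheme \<Rightarrow> ('r, 'm, 'x) module_scheme \<Rightarrow> bool"
  where "flat_module R M \<longleftrightarrow>
    (\<forall>(N :: ('r, (nat \<Rightarrow> 'r) set) module) (N' :: ('r, (nat \<Rightarrow> 'r) set) module) f.
       module R N \<and> module R N' \<and> f \<in> mod_hom R N N' \<and> inj_on f (carrier N) \<longrightarrow>
       inj_on (tensor_map R M N' (\<lambda>m. m) f) (carrier (tensor R M N)))"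

definition mittag_leffler :: "('r, 'z) ring_scheme \<Rightarrow> ('r, 'm, 'x) module_scheme \<Rightarrow> bool"
  where "mittag_leffler R M \<longleftrightarrow>
    (\<forall>(L :: (nat \<Rightarrow> 'r) set set) (N :: (nat \<Rightarrow> 'r) set \<Rightarrow> ('r, (nat \<Rightarrow> 'r) set) module).
       (\<forall>l\<in>L. module R (N l)) \<longrightarrow>
       inj_on (\<lambda>X. \<lambda>l\<in>L. tensor_map R M (N l) (\<lambda>m. m) (\<lambda>f. f l) X)
         (carrier (tensor R M (prod_module L N))))"


section \<open>Bialgebras and comodule algebras\<close>

text \<open>The locale \<^locale>\<open>algebra\<close> of the library is restricted to commutative algebras.\<close>

locale assoc_algebra = module R A + ring A for R (structure) and A (structure) +
  assumes smult_mult_left: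
      "\<lbrakk>r \<in> carrier R; x \<in> carrier A; y \<in> carrier A\<rbrakk> \<Longrightarrow>
       (r \<odot>\<^bsub>A\<^esub> x) \<otimes>\<^bsub>A\<^esub> y = r \<odot>\<^bsub>A\<^esub> (x \<otimes>\<^bsub>A\<^esub> y)"
    and smult_mult_right:
      "\<lbrakk>r \<in> carrier R; x \<in> carrier A; y \<in> carrier A\<rbrakk> \<Longrightarrow>
       x \<otimes>\<^bsub>A\<^esub> (r \<odot>\<^bsub>A\<^esub> y) = r \<odot>\<^bsub>A\<^esub> (x \<otimes>\<^bsub>A\<^esub> y)"

definition alg_hom ::
    "('r, 'z) ring_scheme \<Rightarrow> ('r, 'a, 'x) module_scheme \<Rightarrow> ('r, 'b, 'y) module_scheme \<Rightarrow> ('a \<Rightarrow> 'b) set"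
  where "alg_hom R A B = mod_hom R A B \<inter> ring_hom A B"

locale coalgebra = module R C for R (structure) and C (structure) +
  fixes \<Delta> and \<epsilon>
  assumes comult_hom: "\<Delta> \<in> mod_hom R C (tensor R C C)"
    and counit_hom: "\<epsilon> \<in> mod_hom R C (self_module R)"
    and coassoc: "c \<in> carrier C \<Longrightarrow>
      tensor_assoc R C C C (tensor_map R (tensor R C C) C \<Delta> (\<lambda>x. x) (\<Delta> c)) =
      tensor_map R C (tensor R C C) (\<lambda>x. x) \<Delta> (\<Delta> c)"
    and counit_left: "c \<in> carrier C \<Longrightarrow> tensor_lift R C (\<lambda>(x, y). \<epsilon> x \<odot>\<^bsub>C\<^esub> y) (\<Delta> c) = c"
    and counit_right: "c \<in> carrier C \<Longrightarrow> tensor_lift R C (\<lambda>(x, y). \<epsilon> y \<odot>\<^bsub>C\<^esub> x) (\<Delta> c) = c"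

definition coalg_hom ::
    "('r, 'z) ring_scheme \<Rightarrow> ('r, 'c, 'x) module_scheme \<Rightarrow> ('c \<Rightarrow> ('c \<times> 'c \<Rightarrow> 'r) set) \<Rightarrow> ('c \<Rightarrow> 'r) \<Rightarrow>
     ('r, 'd, 'y) module_scheme \<Rightarrow> ('d \<Rightarrow> ('d \<times> 'd \<Rightarrow> 'r) set) \<Rightarrow> ('d \<Rightarrow> 'r) \<Rightarrow> ('c \<Rightarrow> 'd) set"
  where "coalg_hom R C \<Delta> \<epsilon> D \<Delta>' \<epsilon>' =
    {f \<in> mod_hom R C D. \<forall>c\<in>carrier C. \<Delta>' (f c) = tensor_map R D D f f (\<Delta> c) \<and> \<epsilon>' (f c) = \<epsilon> c}"

locale bialgebra = assoc_algebra R H + coalgebra R H \<Delta> \<epsilon>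
  for R (structure) and H (structure) and \<Delta> and \<epsilon> +
  assumes comult_alg_hom: "\<Delta> \<in> alg_hom R H (tensor_alg R H H)"
    and counit_alg_hom: "\<epsilon> \<in> alg_hom R H (self_module R)"

locale comodule_algebra =
  H: bialgebra R H \<Delta> \<epsilon> + A: assoc_algebra R A
  for R (structure) and H (structure) and \<Delta> and \<epsilon> and A (structure) +
  fixes \<delta>
  assumes coact_alg_hom: "\<delta> \<in> alg_hom R A (tensor_alg R A H)"
    and coact_coassoc: "a \<in> carrier A \<Longrightarrow>
      tensor_assoc R A H H (tensor_map R (tensor R A H) H \<delta> (\<lambda>h. h) (\<delta> a)) =
      tensor_map R A (tensor R H H) (\<lambda>x. x) \<Delta> (\<delta> a)"
    and coact_counit: "a \<in> carrier A \<Longrightarrow> tensor_lift R A (\<lambda>(x, h). \<epsilon> h \<odot>\<^bsub>A\<^esub> x) (\<delta> a) = a"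

definition coinvariants ::
    "('r, 'z) ring_scheme \<Rightarrow> ('r, 'h, 'x) module_scheme \<Rightarrow> ('r, 'a, 'y) module_scheme \<Rightarrow>
     ('a \<Rightarrow> ('a \<times> 'h \<Rightarrow> 'r) set) \<Rightarrow> 'a set"
  where "coinvariants R H A \<delta> = {a \<in> carrier A. \<delta> a = tens R A H a \<one>\<^bsub>H\<^esub>}"


section \<open>Generalised quotients and subalgebras\<close>

definition coideal ::
    "('r, 'z) ring_scheme \<Rightarrow> ('r, 'h, 'x) module_scheme \<Rightarrow> ('h \<Rightarrow> ('h \<times> 'h \<Rightarrow> 'r) set) \<Rightarrow> ('h \<Rightarrow> 'r) \<Rightarrow>
     'h set \<Rightarrow> bool"
  where "coideal R H \<Delta> \<epsilon> I \<longleftrightarrow>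
    submodule I R H \<and>
    (\<exists>\<Delta>' \<epsilon>'. coalgebra R (quot_module H I) \<Delta>' \<epsilon>' \<and>
       (\<lambda>h. I +>\<^bsub>H\<^esub> h) \<in> coalg_hom R H \<Delta> \<epsilon> (quot_module H I) \<Delta>' \<epsilon>')"

definition right_ideal_coideal ::
    "('r, 'z) ring_scheme \<Rightarrow> ('r, 'h, 'x) module_scheme \<Rightarrow> ('h \<Rightarrow> ('h \<times> 'h \<Rightarrow> 'r) set) \<Rightarrow> ('h \<Rightarrow> 'r) \<Rightarrow>
     'h set \<Rightarrow> bool"
  where "right_ideal_coideal R H \<Delta> \<epsilon> I \<longleftrightarrow>
    coideal R H \<Delta> \<epsilon> I \<and> (\<forall>i\<in>I. \<forall>h\<in>carrier H. i \<otimes>\<^bsub>H\<^esub> h \<in> I)"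

text \<open>\<open>H/J \<le> H/I\<close> if and only if \<open>I \<subseteq> J\<close>. The coalgebra structure of \<open>H/I\<close> need not be recorded:
  it is determined by the surjection from \<open>H\<close>.\<close>

definition Quot_gen ::
    "('r, 'z) ring_scheme \<Rightarrow> ('r, 'h, 'x) module_scheme \<Rightarrow> ('h \<Rightarrow> ('h \<times> 'h \<Rightarrow> 'r) set) \<Rightarrow> ('h \<Rightarrow> 'r) \<Rightarrow>
     ('r, 'h set) module gorder"
  where "Quot_gen R H \<Delta> \<epsilon> =
    \<lparr>carrier = {quot_module H I | I. right_ideal_coideal R H \<Delta> \<epsilon> I}, eq = (=),
     le = (\<lambda>Q' Q. \<exists>I J. right_ideal_coideal R H \<Delta> \<epsilon> I \<and> right_ideal_coideal R H \<Delta> \<epsilon> J \<and>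
                    Q = quot_module H I \<and> Q' = quot_module H J \<and> I \<subseteq> J)\<rparr>"

text \<open>The projection \<open>H \<rightarrow> Q\<close>: the zero element of \<open>Q = H/I\<close> is the coset \<open>I\<close> itself.\<close>

definition quot_proj :: "('r, 'h, 'x) module_scheme \<Rightarrow> ('r, 'h set) module \<Rightarrow> 'h \<Rightarrow> 'h set"
  where "quot_proj H Q h = \<zero>\<^bsub>Q\<^esub> +>\<^bsub>H\<^esub> h"

definition quot_coinvariants ::
    "('r, 'z) ring_scheme \<Rightarrow> ('r, 'h, 'x) module_scheme \<Rightarrow> ('r, 'a, 'y) module_scheme \<Rightarrow>
     ('a \<Rightarrow> ('a \<times> 'h \<Rightarrow> 'r) set) \<Rightarrow> ('r, 'h set) module \<Rightarrow> 'a set"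
  where "quot_coinvariants R H A \<delta> Q =
    {a \<in> carrier A.
       tensor_map R A Q (\<lambda>x. x) (quot_proj H Q) (\<delta> a) = tens R A Q a (quot_proj H Q \<one>\<^bsub>H\<^esub>)}"

definition Sub_Alg ::
    "('r, 'z) ring_scheme \<Rightarrow> ('r, 'a, 'y) module_scheme \<Rightarrow> 'a set \<Rightarrow> 'a set gorder"
  where "Sub_Alg R A B =
    \<lparr>carrier = {S. subring S A \<and> submodule S R A \<and> B \<subseteq> S}, eq = (=), le = (\<subseteq>)\<rparr>"


section \<open>Galois connections\<close>

text \<open>The library's Galois connections are order-preserving; these are order-reversing.\<close>

definition antitone_galois_connection ::
    "('p, 'x) gorder_scheme \<Rightarrow> ('q, 'y) gorder_scheme \<Rightarrow> ('p \<Rightarrow> 'q) \<Rightarrow> ('q \<Rightarrow> 'p) \<Rightarrow> bool"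
  where "antitone_galois_connection P P' f g \<longleftrightarrow>
    partial_order P \<and> partial_order P' \<and>
    f \<in> carrier P \<rightarrow> carrier P' \<and> g \<in> carrier P' \<rightarrow> carrier P \<and>
    (\<forall>p\<in>carrier P. \<forall>q\<in>carrier P. p \<sqsubseteq>\<^bsub>P\<^esub> q \<longrightarrow> f q \<sqsubseteq>\<^bsub>P'\<^esub> f p) \<and>
    (\<forall>p\<in>carrier P'. \<forall>q\<in>carrier P'. p \<sqsubseteq>\<^bsub>P'\<^esub> q \<longrightarrow> g q \<sqsubseteq>\<^bsub>P\<^esub> g p) \<and>
    (\<forall>p\<in>carrier P. p \<sqsubseteq>\<^bsub>P\<^esub> g (f p)) \<and>
    (\<forall>p\<in>carrier P'. p \<sqsubseteq>\<^bsub>P'\<^esub> f (g p))"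

end

theory Submission
  imports Defs
begin

text \<open>
  Antitonicity of \<open>\<phi>\<close> is immediate, and \<open>A\<^bsup>co Q\<^esup>\<close> is a subalgebra because \<open>Q = H/I\<close> for a right ideal
  \<open>I\<close> (\<open>quot_coinvariants_subalgebra\<close>). The substance lies in one further claim: for a set
  \<open>S \<subseteq> A\<close>, the supremum of all generalised quotients \<open>Q\<close> with \<open>S \<subseteq> A\<^bsup>co Q\<^esup>\<close> has this property again.
  The proof shows more: among these \<open>Q\<close> there is a greatest one (\<open>largest_generalised_quotient\<close>). So the suprema that define \<open>\<psi>\<close> exist
  because they are maxima, and both inequalities of the Galois connection can be read off.

  To find the greatest \<open>Q\<close>, drop the coideal condition and let \<open>D\<close> be the intersection of all right
  ideals \<open>I\<close> of \<open>H\<close> such that \<open>S\<close> is coinvariant modulo \<open>I\<close>, that is, such that \<open>\<delta> a - a \<otimes> 1\<close>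
  vanishes in \<open>A \<otimes> H/I\<close> for all \<open>a \<in> S\<close>. As \<open>A\<close> is flat and Mittag-Leffler, \<open>A \<otimes> _\<close> commutes with
  intersections (\<open>flat_mittag_leffler_Inter\<close>), so \<open>S\<close> is coinvariant modulo \<open>D\<close>. Now \<open>D\<close> is a coideal
  by minimality. Let \<open>p : H \<rightarrow> H/D\<close> be the projection. With flatness (\<open>flat_kernel\<close>), counitality of
  \<open>\<delta>\<close> shows that \<open>S\<close> is coinvariant modulo the right ideal \<open>ker \<epsilon>\<close>, and coassociativity
  (\<open>coinvariant_comult\<close>) shows that it is coinvariant modulo the right ideal of all \<open>h\<close> with
  \<open>(p \<otimes> p)(\<Delta> h) = 0\<close>. Hence \<open>D\<close> is contained in both, which is the criterion for \<open>H/D\<close> to be a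
  quotient coalgebra (\<open>coideal_criterion\<close>).

  The definitions of flatness and of the Mittag-Leffler property quantify over modules of one fixed type,
  large enough for the quotients of the free module \<open>F\<close> on \<open>\<nat>\<close>. They are applied to modules of other
  types, such as \<open>H/D \<otimes> H/D\<close> or a product of quotients. The transfer rests on two finiteness
  properties of tensors: every element of \<open>A \<otimes> N\<close> comes from \<open>A \<otimes> F\<close> along some map \<open>F \<rightarrow> N\<close>
  (\<open>tensor_from_free_nat\<close>), and an element of \<open>A \<otimes> M\<close> that vanishes does so because of relations between
  finitely many elements of \<open>M\<close> (\<open>tensor_zero_local\<close>).
\<close>

section \<open>Linear maps and submodules\<close>

lemma mod_homI:
  assumes "\<And>x. x \<in> carrier M \<Longrightarrow> f x \<in> carrier N"
    and "\<And>x y. \<lbrakk>x \<in> carrier M; y \<in> carrier M\<rbrakk> \<Longrightarrow> f (x \<oplus>\<^bsub>M\<^esub> y) = f x \<oplus>\<^bsub>N\<^esub> f y"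
    and "\<And>r x. \<lbrakk>r \<in> carrier R; x \<in> carrier M\<rbrakk> \<Longrightarrow> f (r \<odot>\<^bsub>M\<^esub> x) = r \<odot>\<^bsub>N\<^esub> f x"
  shows "f \<in> mod_hom R M N"
  using assms by (auto simp: mod_hom_def)

lemma mod_homD:
  assumes "f \<in> mod_hom R M N"
  shows mod_hom_closed: "x \<in> carrier M \<Longrightarrow> f x \<in> carrier N"
    and mod_hom_add: "\<lbrakk>x \<in> carrier M; y \<in> carrier M\<rbrakk> \<Longrightarrow> f (x \<oplus>\<^bsub>M\<^esub> y) = f x \<oplus>\<^bsub>N\<^esub> f y"
    and mod_hom_smult: "\<lbrakk>r \<in> carrier R; x \<in> carrier M\<rbrakk> \<Longrightarrow> f (r \<odot>\<^bsub>M\<^esub> x) = r \<odot>\<^bsub>N\<^esub> f x"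
  using assms by (auto simp: mod_hom_def)

lemma mod_hom_id: "(\<lambda>x. x) \<in> mod_hom R M M"
  by (simp add: mod_hom_def)

lemma mod_hom_comp:
  assumes "f \<in> mod_hom R M N" "g \<in> mod_hom R N P"
  shows "(\<lambda>x. g (f x)) \<in> mod_hom R M P"
  by (rule mod_homI) (simp_all add: mod_homD[OF assms(1)] mod_homD[OF assms(2)])

lemma module_cring: "module R M \<Longrightarrow> cring R"
  by (simp add: module_def)

lemma mod_hom_zero:
  assumes "module R M" "module R N" "f \<in> mod_hom R M N"
  shows "f \<zero>\<^bsub>M\<^esub> = \<zero>\<^bsub>N\<^esub>"
proof -
  interpret M: module R M by fact
  interpret N: module R N by fact
  have "f (\<zero>\<^bsub>R\<^esub> \<odot>\<^bsub>M\<^esub> \<zero>\<^bsub>M\<^esub>) = \<zero>\<^bsub>R\<^esub> \<odot>\<^bsub>N\<^esub> f \<zero>\<^bsub>M\<^esub>"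
    by (intro mod_hom_smult[OF assms(3)]) simp_all
  then show ?thesis
    using mod_hom_closed[OF assms(3)] by simp
qed

lemma mod_hom_inv:
  assumes "module R M" "module R N" "f \<in> mod_hom R M N" "x \<in> carrier M"
  shows "f (\<ominus>\<^bsub>M\<^esub> x) = \<ominus>\<^bsub>N\<^esub> f x"
proof -
  interpret M: module R M by fact
  interpret N: module R N by fact
  have "f (\<ominus>\<^bsub>M\<^esub> x) \<oplus>\<^bsub>N\<^esub> f x = f (\<ominus>\<^bsub>M\<^esub> x \<oplus>\<^bsub>M\<^esub> x)"
    by (rule mod_hom_add[OF assms(3), symmetric]) (use assms in auto)
  also have "\<dots> = \<zero>\<^bsub>N\<^esub>"
    using assms mod_hom_zero[OF assms(1-3)] by (simp add: M.l_neg)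
  finally show ?thesis
    using mod_hom_closed[OF assms(3)] assms(4)
    by (metis M.a_inv_closed N.minus_equality)
qed

lemma mod_hom_minus:
  assumes "module R M" "module R N" "f \<in> mod_hom R M N" "x \<in> carrier M" "y \<in> carrier M"
  shows "f (x \<ominus>\<^bsub>M\<^esub> y) = f x \<ominus>\<^bsub>N\<^esub> f y"
proof -
  interpret M: module R M by fact
  show ?thesis
    using assms by (simp add: a_minus_def mod_hom_add[OF assms(3)] mod_hom_inv[OF assms(1-3)])
qed

lemma (in abelian_group) minus_eq_zero_iff:
  assumes "x \<in> carrier G" "y \<in> carrier G"
  shows "x \<ominus> y = \<zero> \<longleftrightarrow> x = y"
proof
  assume "x \<ominus> y = \<zero>"
  then have "\<ominus> (\<ominus> y) = x"
    using assms by (intro minus_equality) (simp_all add: a_minus_def)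
  then show "x = y" using assms by simp
next
  assume "x = y"
  then show "x \<ominus> y = \<zero>" using assms by (simp add: a_minus_def r_neg)
qed

lemma mod_hom_eq_iff_minus:
  assumes "module R M" "module R N" "f \<in> mod_hom R M N" "x \<in> carrier M" "y \<in> carrier M"
  shows "f x = f y \<longleftrightarrow> f (x \<ominus>\<^bsub>M\<^esub> y) = \<zero>\<^bsub>N\<^esub>"
proof -
  interpret N: module R N by fact
  have "f x \<in> carrier N" "f y \<in> carrier N"
    using mod_hom_closed[OF assms(3)] assms by auto
  then show ?thesis
    unfolding mod_hom_minus[OF assms] by (simp add: N.M.minus_eq_zero_iff)
qed

lemma mod_hom_injI:
  assumes "module R M" "module R N" "f \<in> mod_hom R M N"
    and "\<And>x. \<lbrakk>x \<in> carrier M; f x = \<zero>\<^bsub>N\<^esub>\<rbrakk> \<Longrightarrow> x = \<zero>\<^bsub>M\<^esub>"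
  shows "inj_on f (carrier M)"
proof (rule inj_onI)
  interpret M: module R M by fact
  fix x y assume xy: "x \<in> carrier M" "y \<in> carrier M" "f x = f y"
  then have "f (x \<ominus>\<^bsub>M\<^esub> y) = \<zero>\<^bsub>N\<^esub>"
    using mod_hom_eq_iff_minus[OF assms(1-3)] by simp
  then show "x = y"
    using xy assms(4)[of "x \<ominus>\<^bsub>M\<^esub> y"] by (simp add: M.M.minus_eq_zero_iff)
qed

lemma submoduleI':
  assumes "module R M" "K \<subseteq> carrier M" "\<zero>\<^bsub>M\<^esub> \<in> K"
    and "\<And>x y. \<lbrakk>x \<in> K; y \<in> K\<rbrakk> \<Longrightarrow> x \<oplus>\<^bsub>M\<^esub> y \<in> K"
    and "\<And>r x. \<lbrakk>r \<in> carrier R; x \<in> K\<rbrakk> \<Longrightarrow> r \<odot>\<^bsub>M\<^esub> x \<in> K"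
  shows "submodule K R M"
proof -
  interpret M: module R M by fact
  show ?thesis
  proof (rule M.submoduleI)
    fix x assume x: "x \<in> K"
    then have "\<ominus>\<^bsub>M\<^esub> x = (\<ominus>\<^bsub>R\<^esub> \<one>\<^bsub>R\<^esub>) \<odot>\<^bsub>M\<^esub> x"
      using assms(2) by (simp add: subset_iff M.smult_l_minus)
    then show "\<ominus>\<^bsub>M\<^esub> x \<in> K" using x assms(5) by simp
  qed (use assms in auto)
qed

lemma submodule_zero:
  assumes "module R M" "submodule K R M"
  shows "\<zero>\<^bsub>M\<^esub> \<in> K"
  using subgroup.one_closed[OF submodule.axioms(1)[OF assms(2)]] by simp

text \<open>Identities between linear maps are proved on generators: the arguments on which two linear maps agree
form a submodule.\<close>

lemma equalizer_submodule:
  assumes "module R M" "module R N" "f \<in> mod_hom R M N" "g \<in> mod_hom R M N"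
  shows "submodule {x \<in> carrier M. f x = g x} R M"
proof -
  interpret M: module R M by fact
  show ?thesis
    by (rule submoduleI'[OF assms(1)])
      (auto simp: mod_homD[OF assms(3)] mod_homD[OF assms(4)] mod_hom_zero[OF assms(1,2)] assms)
qed

lemma mod_hom_const_zero:
  assumes "module R N"
  shows "(\<lambda>x. \<zero>\<^bsub>N\<^esub>) \<in> mod_hom R M N"
proof -
  interpret N: module R N by fact
  show ?thesis by (rule mod_homI) simp_all
qed

lemma kernel_submodule:
  assumes "module R M" "module R N" "f \<in> mod_hom R M N"
  shows "submodule {x \<in> carrier M. f x = \<zero>\<^bsub>N\<^esub>} R M"
  by (rule equalizer_submodule[OF assms mod_hom_const_zero[OF assms(2)]])

lemma image_submodule:
  assumes "module R M" "module R N" "f \<in> mod_hom R M N"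
  shows "submodule (f ` carrier M) R N"
proof (rule submoduleI'[OF assms(2)])
  interpret M: module R M by fact
  show "f ` carrier M \<subseteq> carrier N" using mod_hom_closed[OF assms(3)] by auto
  show "\<zero>\<^bsub>N\<^esub> \<in> f ` carrier M" by (metis M.zero_closed imageI mod_hom_zero[OF assms])
  show "x \<oplus>\<^bsub>N\<^esub> y \<in> f ` carrier M" if "x \<in> f ` carrier M" "y \<in> f ` carrier M" for x y
    using that by (auto simp: mod_hom_add[OF assms(3), symmetric])
  show "r \<odot>\<^bsub>N\<^esub> x \<in> f ` carrier M" if "r \<in> carrier R" "x \<in> f ` carrier M" for r x
    using that by (auto simp: mod_hom_smult[OF assms(3), symmetric])
qed

lemma preimage_submodule:
  assumes "module R M" "module R N" "f \<in> mod_hom R M N" "submodule K R N"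
  shows "submodule {x \<in> carrier M. f x \<in> K} R M"
proof -
  interpret M: module R M by fact
  show ?thesis
    using module.submoduleE[OF assms(2,4)] submodule_zero[OF assms(2,4)]
    by (intro submoduleI'[OF assms(1)])
      (auto simp: mod_homD[OF assms(3)] mod_hom_zero[OF assms(1-3)])
qed

section \<open>Quotient modules\<close>

lemma submodule_abelian_subgroup:
  assumes "module R M" "submodule K R M"
  shows "abelian_subgroup K M"
  using assms by (intro abelian_subgroupI3)
    (simp_all add: additive_subgroup_def submodule_def module_def)

lemma coset_add:
  assumes "module R M" "submodule K R M" "x \<in> carrier M" "y \<in> carrier M"
  shows "(K +>\<^bsub>M\<^esub> x) <+>\<^bsub>M\<^esub> (K +>\<^bsub>M\<^esub> y) = K +>\<^bsub>M\<^esub> (x \<oplus>\<^bsub>M\<^esub> y)"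
  using abelian_subgroup.a_rcos_sum[OF submodule_abelian_subgroup[OF assms(1,2)] assms(3,4)] .

lemma coset_eq_iff:
  assumes "module R M" "submodule K R M" "x \<in> carrier M" "y \<in> carrier M"
  shows "K +>\<^bsub>M\<^esub> x = K +>\<^bsub>M\<^esub> y \<longleftrightarrow> x \<ominus>\<^bsub>M\<^esub> y \<in> K"
proof -
  interpret M: module R M by fact
  interpret K: abelian_subgroup K M by (rule submodule_abelian_subgroup[OF assms(1,2)])
  have "K +>\<^bsub>M\<^esub> x = K +>\<^bsub>M\<^esub> y \<longleftrightarrow> x \<in> K +>\<^bsub>M\<^esub> y"
    using K.a_rcos_self[OF assms(3)] K.a_repr_independence'[of x y] assms(4) by auto
  also have "\<dots> \<longleftrightarrow> x \<ominus>\<^bsub>M\<^esub> y \<in> K"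
    using K.a_rcos_module[OF assms(4,3)] by (simp add: a_minus_def)
  finally show ?thesis .
qed

lemma coset_zero:
  assumes "module R M" "submodule K R M"
  shows "K +>\<^bsub>M\<^esub> \<zero>\<^bsub>M\<^esub> = K"
proof -
  interpret M: module R M by fact
  show ?thesis using module.submoduleE(1)[OF assms] by simp
qed

lemma carrier_quot_module:
  "carrier (quot_module M K) = (\<lambda>x. K +>\<^bsub>M\<^esub> x) ` carrier M"
  by (auto simp: quot_module_def A_RCOSETS_def' a_r_coset_def')

lemma coset_smult:
  assumes "module R M" "submodule K R M" "r \<in> carrier R" "x \<in> carrier M"
  shows "r \<odot>\<^bsub>quot_module M K\<^esub> (K +>\<^bsub>M\<^esub> x) = K +>\<^bsub>M\<^esub> (r \<odot>\<^bsub>M\<^esub> x)"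
proof -
  interpret M: module R M by fact
  interpret K: abelian_subgroup K M by (rule submodule_abelian_subgroup[OF assms(1,2)])
  have const: "K +>\<^bsub>M\<^esub> (r \<odot>\<^bsub>M\<^esub> y) = K +>\<^bsub>M\<^esub> (r \<odot>\<^bsub>M\<^esub> x)" if y: "y \<in> K +>\<^bsub>M\<^esub> x" for y
  proof -
    have yc: "y \<in> carrier M" using K.a_elemrcos_carrier[OF assms(4) y] .
    have "y \<oplus>\<^bsub>M\<^esub> \<ominus>\<^bsub>M\<^esub> x \<in> K" using K.a_rcos_module_imp[OF assms(4) y] .
    then have "r \<odot>\<^bsub>M\<^esub> (y \<oplus>\<^bsub>M\<^esub> \<ominus>\<^bsub>M\<^esub> x) \<in> K" using module.submoduleE(4)[OF assms(1,2)] assms(3) by blast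
    then have "r \<odot>\<^bsub>M\<^esub> y \<ominus>\<^bsub>M\<^esub> r \<odot>\<^bsub>M\<^esub> x \<in> K"
      using assms yc by (simp add: M.smult_r_distr M.smult_r_minus a_minus_def)
    then show ?thesis
      using coset_eq_iff[OF assms(1,2)] assms(3,4) yc by simp
  qed
  have "r \<odot>\<^bsub>quot_module M K\<^esub> (K +>\<^bsub>M\<^esub> x) = (\<Union>y\<in>K +>\<^bsub>M\<^esub> x. K +>\<^bsub>M\<^esub> (r \<odot>\<^bsub>M\<^esub> y))"
    by (simp add: quot_module_def)
  also have "\<dots> = (\<Union>y\<in>K +>\<^bsub>M\<^esub> x. K +>\<^bsub>M\<^esub> (r \<odot>\<^bsub>M\<^esub> x))"
    using const by (intro SUP_cong) auto
  also have "\<dots> = K +>\<^bsub>M\<^esub> (r \<odot>\<^bsub>M\<^esub> x)"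
    using K.a_rcos_self[OF assms(4)] by auto
  finally show ?thesis .
qed

lemma coset_hom:
  assumes "module R M" "submodule K R M"
  shows "(\<lambda>x. K +>\<^bsub>M\<^esub> x) \<in> mod_hom R M (quot_module M K)"
proof (rule mod_homI)
  show "K +>\<^bsub>M\<^esub> x \<in> carrier (quot_module M K)" if "x \<in> carrier M" for x
    using that by (simp add: carrier_quot_module)
  show "K +>\<^bsub>M\<^esub> (x \<oplus>\<^bsub>M\<^esub> y) = (K +>\<^bsub>M\<^esub> x) \<oplus>\<^bsub>quot_module M K\<^esub> (K +>\<^bsub>M\<^esub> y)"
    if "x \<in> carrier M" "y \<in> carrier M" for x y
    using coset_add[OF assms that] by (simp add: quot_module_def)
qed (simp add: coset_smult[OF assms])

lemma module_quot_module:
  assumes "module R M" "submodule K R M"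
  shows "module R (quot_module M K)"
proof -
  interpret M: module R M by fact
  let ?Q = "quot_module M K"
  note hom = coset_hom[OF assms]
  have zero: "\<zero>\<^bsub>?Q\<^esub> = K +>\<^bsub>M\<^esub> \<zero>\<^bsub>M\<^esub>"
    by (simp add: coset_zero[OF assms]) (simp add: quot_module_def)
  note simps = mod_homD(2,3)[OF hom, symmetric] zero
  show ?thesis
  proof (rule moduleI)
    show "cring R" by (rule module_cring[OF assms(1)])
    show "abelian_group ?Q"
    proof (rule abelian_groupI)
      fix X assume "X \<in> carrier ?Q"
      then obtain x where x: "x \<in> carrier M" "X = K +>\<^bsub>M\<^esub> x" by (auto simp: carrier_quot_module)
      show "\<exists>Y\<in>carrier ?Q. Y \<oplus>\<^bsub>?Q\<^esub> X = \<zero>\<^bsub>?Q\<^esub>"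
        using x by (intro bexI[of _ "K +>\<^bsub>M\<^esub> (\<ominus>\<^bsub>M\<^esub> x)"])
          (auto simp: simps M.l_neg carrier_quot_module simp del: M.M.a_coset_add_zero)
    qed (auto simp: carrier_quot_module simps M.a_assoc M.a_comm M.a_lcomm simp del: M.M.a_coset_add_zero)
  qed (auto simp: carrier_quot_module simps M.smult_l_distr M.smult_r_distr M.smult_assoc1)
qed

lemma coset_eq_zero_iff:
  assumes "module R M" "submodule K R M" "x \<in> carrier M"
  shows "K +>\<^bsub>M\<^esub> x = \<zero>\<^bsub>quot_module M K\<^esub> \<longleftrightarrow> x \<in> K"
proof -
  interpret M: module R M by fact
  have "\<zero>\<^bsub>quot_module M K\<^esub> = K +>\<^bsub>M\<^esub> \<zero>\<^bsub>M\<^esub>"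
    by (simp add: coset_zero[OF assms(1,2)]) (simp add: quot_module_def)
  then show ?thesis
    using coset_eq_iff[OF assms(1,2,3) M.zero_closed] assms(3)
      M.M.minus_equality[of "\<zero>\<^bsub>M\<^esub>" "\<zero>\<^bsub>M\<^esub>"]
    by (simp add: a_minus_def)
qed

text \<open>Stated for an arbitrary surjection and not only for the projection to a quotient, because it also
inverts the isomorphism from \<open>F/ker q\<close> to the image of \<open>q\<close>.\<close>

lemma surjection_factor:
  assumes "module R M" "module R N" "module R P" "q \<in> mod_hom R M N" "f \<in> mod_hom R M P"
    and "q ` carrier M = carrier N"
    and "\<And>x. \<lbrakk>x \<in> carrier M; q x = \<zero>\<^bsub>N\<^esub>\<rbrakk> \<Longrightarrow> f x = \<zero>\<^bsub>P\<^esub>"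
  obtains g where "g \<in> mod_hom R N P" "\<And>x. x \<in> carrier M \<Longrightarrow> g (q x) = f x"
proof -
  interpret M: module R M by fact
  define g where "g y = f (SOME x. x \<in> carrier M \<and> y = q x)" for y
  have g: "g (q x) = f x" if x: "x \<in> carrier M" for x
  proof -
    define y where "y = (SOME y. y \<in> carrier M \<and> q x = q y)"
    have y: "y \<in> carrier M \<and> q x = q y"
      unfolding y_def by (rule someI[of _ x]) (use x in simp)
    then have "f (y \<ominus>\<^bsub>M\<^esub> x) = \<zero>\<^bsub>P\<^esub>"
      using x mod_hom_eq_iff_minus[OF assms(1,2,4), of y x] by (intro assms(7)) simp_all
    then have "f y = f x"
      using mod_hom_eq_iff_minus[OF assms(1,3,5)] x y by blast
    then show ?thesis
      by (simp only: g_def y_def)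
  qed
  show thesis
  proof (rule that)
    show "g \<in> mod_hom R N P"
      by (rule mod_homI)
        (auto simp: assms(6)[symmetric] g mod_homD[OF assms(5)] mod_homD(2,3)[OF assms(4), symmetric])
  qed (rule g)
qed

lemma quot_module_factor:
  assumes "module R M" "submodule K R M" "module R P" "f \<in> mod_hom R M P"
    and "\<And>x. x \<in> K \<Longrightarrow> f x = \<zero>\<^bsub>P\<^esub>"
  obtains g where "g \<in> mod_hom R (quot_module M K) P" "\<And>x. x \<in> carrier M \<Longrightarrow> g (K +>\<^bsub>M\<^esub> x) = f x"
  using surjection_factor[OF assms(1) module_quot_module[OF assms(1,2)] assms(3) coset_hom[OF assms(1,2)] assms(4)]
    assms(5) coset_eq_zero_iff[OF assms(1,2)] carrier_quot_module by metis

section \<open>Free modules and products\<close>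

lemma module_free_module:
  fixes R :: "('r, 'z) ring_scheme" and S :: "'s set"
  assumes "cring R"
  shows "module R (free_module R S)"
proof -
  interpret R: cring R by fact
  have fin_add: "finite {s. f s \<oplus>\<^bsub>R\<^esub> g s \<noteq> \<zero>\<^bsub>R\<^esub>}"
    if "finite {s. f s \<noteq> \<zero>\<^bsub>R\<^esub>}" "finite {s. g s \<noteq> \<zero>\<^bsub>R\<^esub>}" for f g :: "'s \<Rightarrow> 'r"
    by (rule finite_subset[OF _ finite_UnI[OF that]]) auto
  have fin_smult: "finite {s. r \<otimes>\<^bsub>R\<^esub> f s \<noteq> \<zero>\<^bsub>R\<^esub>}"
    if "finite {s. f s \<noteq> \<zero>\<^bsub>R\<^esub>}" "r \<in> carrier R" for f :: "'s \<Rightarrow> 'r" and r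
    by (rule finite_subset[OF _ that(1)]) (use that(2) in auto)
  have fin_neg: "finite {s. \<ominus>\<^bsub>R\<^esub> f s \<noteq> \<zero>\<^bsub>R\<^esub>}"
    if "finite {s. f s \<noteq> \<zero>\<^bsub>R\<^esub>}" for f :: "'s \<Rightarrow> 'r"
    by (rule finite_subset[OF _ that]) auto
  have mem: "f s \<in> carrier R" if "\<forall>s\<in>S. f s \<in> carrier R" "\<forall>s. s \<notin> S \<longrightarrow> f s = \<zero>\<^bsub>R\<^esub>" for f :: "'s \<Rightarrow> 'r" and s
    using that by (cases "s \<in> S") auto
  show ?thesis
  proof (rule moduleI[OF assms])
    show "abelian_group (free_module R S)"
    proof (rule abelian_groupI)
      fix f assume "f \<in> carrier (free_module R S)"
      then show "\<exists>g\<in>carrier (free_module R S). g \<oplus>\<^bsub>free_module R S\<^esub> f = \<zero>\<^bsub>free_module R S\<^esub>"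
        by (intro bexI[of _ "\<lambda>s. \<ominus>\<^bsub>R\<^esub> f s"])
          (auto simp: free_module_def fin_neg mem R.l_neg)
    qed (auto simp: free_module_def fin_add fin_smult mem R.a_assoc R.a_comm R.a_lcomm fun_eq_iff)
  qed (auto simp: free_module_def fin_add fin_smult mem fun_eq_iff R.l_distr R.r_distr R.m_assoc)
qed

lemma free_module_mem:
  assumes "cring R" "u \<in> carrier (free_module R S)"
  shows "u s \<in> carrier R"
proof -
  interpret R: cring R by fact
  show ?thesis using assms(2) by (cases "s \<in> S") (auto simp: free_module_def)
qed

lemma free_basis_closed:
  assumes "cring R" "s \<in> S"
  shows "free_basis R s \<in> carrier (free_module R S)"
proof -
  interpret R: cring R by fact
  show ?thesis
    using assms(2) by (auto simp: free_module_def free_basis_def intro: finite_subset[of _ "{s}"])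
qed

lemma free_module_mono:
  assumes "cring R" "S \<subseteq> S'"
  shows "(\<lambda>u. u) \<in> mod_hom R (free_module R S) (free_module R S')"
proof -
  interpret R: cring R by fact
  show ?thesis
  proof (rule mod_homI)
    fix u assume u: "u \<in> carrier (free_module R S)"
    then show "u \<in> carrier (free_module R S')"
      using assms free_module_mem[OF assms(1) u] by (auto simp: free_module_def)
  qed (simp_all add: free_module_def)
qed

lemma free_module_spanned:
  assumes "cring R" "submodule N R (free_module R S)" "\<And>s. s \<in> S \<Longrightarrow> free_basis R s \<in> N"
    and "u \<in> carrier (free_module R S)"
  shows "u \<in> N"
proof -
  interpret R: cring R by fact
  let ?F = "free_module R S"
  note mod = module_free_module[OF assms(1), of S]
  have "u \<in> N" if "finite T" "\<And>s. s \<notin> T \<Longrightarrow> u s = \<zero>\<^bsub>R\<^esub>" "u \<in> carrier ?F" for T u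
    using that
  proof (induction T arbitrary: u rule: finite_induct)
    case empty
    then have "u = \<zero>\<^bsub>?F\<^esub>" by (auto simp: free_module_def)
    then show ?case using submodule_zero[OF mod assms(2)] by simp
  next
    case (insert t T)
    note us = free_module_mem[OF assms(1) insert.prems(2)]
    let ?v = "u(t := \<zero>\<^bsub>R\<^esub>)"
    have v: "?v \<in> carrier ?F"
    proof -
      have "finite {s. ?v s \<noteq> \<zero>\<^bsub>R\<^esub>}"
        by (rule finite_subset[of _ "{s. u s \<noteq> \<zero>\<^bsub>R\<^esub>}"]) (use insert.prems(2) in \<open>auto simp: free_module_def\<close>)
      then show ?thesis using insert.prems(2) by (auto simp: free_module_def)
    qed
    then have vN: "?v \<in> N" 
    proof (rule insert.IH[rotated])
      show "?v s = \<zero>\<^bsub>R\<^esub>" if "s \<notin> T" for s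
        using insert.prems(1)[of s] that by auto
    qed
    show ?case
    proof (cases "t \<in> S")
      case True
      have "u = ?v \<oplus>\<^bsub>?F\<^esub> u t \<odot>\<^bsub>?F\<^esub> free_basis R t"
        using us by (auto simp: free_module_def free_basis_def)
      then show ?thesis
        using vN module.submoduleE(4,5)[OF mod assms(2)] assms(3)[OF True] us[of t] by metis
    next
      case False
      then have "u = ?v" using insert.prems(2) by (auto simp: free_module_def)
      then show ?thesis using vN by simp
    qed
  qed
  then show ?thesis using assms(4) by (auto simp: free_module_def)
qed

text \<open>The linear extension of \<open>b\<close> to the free module. The formula is the one in \<^const>\<open>tensor_lift\<close>,
applied to a function instead of to the chosen representative of a coset.\<close>

definition free_lift ::
    "('r, 'z) ring_scheme \<Rightarrow> ('r, 'p, 'x) module_scheme \<Rightarrow> ('s \<Rightarrow> 'p) \<Rightarrow> ('s \<Rightarrow> 'r) \<Rightarrow> 'p"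
  where "free_lift R P b u = (\<Oplus>\<^bsub>P\<^esub>s\<in>{s. u s \<noteq> \<zero>\<^bsub>R\<^esub>}. u s \<odot>\<^bsub>P\<^esub> b s)"

text \<open>The support in the definition varies with \<open>u\<close>. Linearity needs a common finite set of summation.\<close>

lemma free_lift_eq_finsum:
  assumes "module R P" "b \<in> S \<rightarrow> carrier P" "u \<in> carrier (free_module R S)"
    and "finite T" "{s. u s \<noteq> \<zero>\<^bsub>R\<^esub>} \<subseteq> T" "T \<subseteq> S"
  shows "free_lift R P b u = (\<Oplus>\<^bsub>P\<^esub>s\<in>T. u s \<odot>\<^bsub>P\<^esub> b s)"
proof -
  interpret P: module R P by fact
  have "(\<lambda>s. u s \<odot>\<^bsub>P\<^esub> b s) \<in> T \<rightarrow> carrier P"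
    using assms(2,6) free_module_mem[OF module_cring[OF assms(1)] assms(3)]
    by (auto simp: Pi_iff subset_iff)
  then show ?thesis
    unfolding free_lift_def using assms(2,4-6)
    by (intro P.add.finprod_mono_neutral_cong_left) (auto simp: Pi_iff subset_iff)
qed

lemma free_support:
  assumes "u \<in> carrier (free_module R S)"
  shows "finite {s. u s \<noteq> \<zero>\<^bsub>R\<^esub>}" "{s. u s \<noteq> \<zero>\<^bsub>R\<^esub>} \<subseteq> S"
  using assms by (auto simp: free_module_def)

lemma free_lift_hom:
  assumes "module R P" "b \<in> S \<rightarrow> carrier P"
  shows "free_lift R P b \<in> mod_hom R (free_module R S) P"
proof -
  interpret P: module R P by fact
  note R = module_cring[OF assms(1)]
  interpret F: module R "free_module R S" by (rule module_free_module[OF R])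
  note lift = free_lift_eq_finsum[OF assms]
  note mem = free_module_mem[OF R]
  show ?thesis
  proof (rule mod_homI)
    fix u assume u: "u \<in> carrier (free_module R S)"
    show "free_lift R P b u \<in> carrier P"
      unfolding free_lift_def using free_support[OF u] mem[OF u] assms(2)
      by (intro P.finsum_closed) (auto simp: Pi_iff subset_iff)
  next
    fix u v assume u: "u \<in> carrier (free_module R S)" and v: "v \<in> carrier (free_module R S)"
    let ?w = "u \<oplus>\<^bsub>free_module R S\<^esub> v"
    let ?T = "{s. u s \<noteq> \<zero>\<^bsub>R\<^esub>} \<union> {s. v s \<noteq> \<zero>\<^bsub>R\<^esub>}"
    have w: "?w \<in> carrier (free_module R S)" using u v by simp
    have w_eq: "?w s = u s \<oplus>\<^bsub>R\<^esub> v s" for s by (simp add: free_module_def)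
    have T: "finite ?T" "?T \<subseteq> S" using free_support[OF u] free_support[OF v] by auto
    have closed: "(\<lambda>s. u s \<odot>\<^bsub>P\<^esub> b s) \<in> ?T \<rightarrow> carrier P" "(\<lambda>s. v s \<odot>\<^bsub>P\<^esub> b s) \<in> ?T \<rightarrow> carrier P"
      using T(2) assms(2) mem[OF u] mem[OF v] by (auto simp: Pi_iff subset_iff)
    have "free_lift R P b ?w = (\<Oplus>\<^bsub>P\<^esub>s\<in>?T. ?w s \<odot>\<^bsub>P\<^esub> b s)"
      by (rule lift[OF w T(1) _ T(2)]) (auto simp: w_eq)
    also have "\<dots> = (\<Oplus>\<^bsub>P\<^esub>s\<in>?T. u s \<odot>\<^bsub>P\<^esub> b s \<oplus>\<^bsub>P\<^esub> v s \<odot>\<^bsub>P\<^esub> b s)"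
      using T assms(2) mem[OF u] mem[OF v]
      by (intro P.finsum_cong') (auto simp: w_eq P.smult_l_distr Pi_iff subset_iff)
    also have "\<dots> = (\<Oplus>\<^bsub>P\<^esub>s\<in>?T. u s \<odot>\<^bsub>P\<^esub> b s) \<oplus>\<^bsub>P\<^esub> (\<Oplus>\<^bsub>P\<^esub>s\<in>?T. v s \<odot>\<^bsub>P\<^esub> b s)"
      by (rule P.finsum_addf[OF closed])
    also have "(\<Oplus>\<^bsub>P\<^esub>s\<in>?T. u s \<odot>\<^bsub>P\<^esub> b s) = free_lift R P b u"
      by (rule lift[OF u T(1) _ T(2), symmetric]) auto
    also have "(\<Oplus>\<^bsub>P\<^esub>s\<in>?T. v s \<odot>\<^bsub>P\<^esub> b s) = free_lift R P b v"
      by (rule lift[OF v T(1) _ T(2), symmetric]) auto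
    finally show "free_lift R P b ?w = free_lift R P b u \<oplus>\<^bsub>P\<^esub> free_lift R P b v" .
  next
    fix r u assume r: "r \<in> carrier R" and u: "u \<in> carrier (free_module R S)"
    let ?w = "r \<odot>\<^bsub>free_module R S\<^esub> u"
    let ?T = "{s. u s \<noteq> \<zero>\<^bsub>R\<^esub>}"
    have w: "?w \<in> carrier (free_module R S)" using r u by simp
    have w_eq: "?w s = r \<otimes>\<^bsub>R\<^esub> u s" for s by (simp add: free_module_def)
    note T = free_support[OF u]
    have closed: "(\<lambda>s. u s \<odot>\<^bsub>P\<^esub> b s) \<in> ?T \<rightarrow> carrier P"
      using T(2) assms(2) mem[OF u] by (auto simp: Pi_iff subset_iff)
    have "free_lift R P b ?w = (\<Oplus>\<^bsub>P\<^esub>s\<in>?T. ?w s \<odot>\<^bsub>P\<^esub> b s)"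
      by (rule lift[OF w T(1) _ T(2)]) (use r in \<open>auto simp: w_eq\<close>)
    also have "\<dots> = (\<Oplus>\<^bsub>P\<^esub>s\<in>?T. r \<odot>\<^bsub>P\<^esub> (u s \<odot>\<^bsub>P\<^esub> b s))"
      using T assms(2) mem[OF u] r
      by (intro P.finsum_cong') (auto simp: w_eq P.smult_assoc1 Pi_iff subset_iff)
    also have "\<dots> = r \<odot>\<^bsub>P\<^esub> free_lift R P b u"
      unfolding free_lift_def by (rule P.finsum_smult_ldistr[OF T(1) r closed, symmetric])
    finally show "free_lift R P b ?w = r \<odot>\<^bsub>P\<^esub> free_lift R P b u" .
  qed
qed

lemma free_lift_basis:
  assumes "module R P" "b \<in> S \<rightarrow> carrier P" "s \<in> S"
  shows "free_lift R P b (free_basis R s) = b s"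
proof -
  interpret P: module R P by fact
  have bs: "b s \<in> carrier P" using assms by auto
  have "free_lift R P b (free_basis R s) = (\<Oplus>\<^bsub>P\<^esub>t\<in>{s}. free_basis R s t \<odot>\<^bsub>P\<^esub> b t)"
    by (rule free_lift_eq_finsum[OF assms(1,2) free_basis_closed])
      (use assms(3) module_cring[OF assms(1)] in \<open>auto simp: free_basis_def\<close>)
  then show ?thesis using bs by (simp add: free_basis_def)
qed

lemma free_module_hom_eqI:
  assumes "module R P" "f \<in> mod_hom R (free_module R S) P" "g \<in> mod_hom R (free_module R S) P"
    and "\<And>s. s \<in> S \<Longrightarrow> f (free_basis R s) = g (free_basis R s)"
    and "u \<in> carrier (free_module R S)"
  shows "f u = g u"
proof -
  note R = module_cring[OF assms(1)]
  have "u \<in> {u \<in> carrier (free_module R S). f u = g u}"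
  proof (rule free_module_spanned[OF R equalizer_submodule[OF module_free_module[OF R] assms(1-3)] _ assms(5)])
    show "free_basis R s \<in> {u \<in> carrier (free_module R S). f u = g u}" if "s \<in> S" for s
      using that assms(4) free_basis_closed[OF R that] by simp
  qed
  then show ?thesis by simp
qed

lemma module_prod_module:
  assumes "cring R" "\<And>l. l \<in> L \<Longrightarrow> module R (N l)"
  shows "module R (prod_module L N)"
proof -
  have grp: "abelian_group (N l)" if "l \<in> L" for l
    using assms(2)[OF that] by (simp add: module_def)
  note ag = abelian_groupE[OF grp]
  note mods = module.smult_closed[OF assms(2)] module.smult_l_distr[OF assms(2)]
    module.smult_r_distr[OF assms(2)] module.smult_assoc1[OF assms(2)] module.smult_one[OF assms(2)]
  note pm = prod_module_def PiE_iff
  show ?thesis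
  proof (rule moduleI[OF assms(1)])
    show "abelian_group (prod_module L N)"
    proof (rule abelian_groupI)
      fix f assume f: "f \<in> carrier (prod_module L N)"
      then show "\<exists>g\<in>carrier (prod_module L N). g \<oplus>\<^bsub>prod_module L N\<^esub> f = \<zero>\<^bsub>prod_module L N\<^esub>"
        using abelian_group.a_inv_closed[OF grp] abelian_group.l_neg[OF grp]
        by (intro bexI[of _ "\<lambda>l\<in>L. \<ominus>\<^bsub>N l\<^esub> f l"]) (auto simp: pm)
    qed (auto simp: pm ag(1-3) ag(5) fun_eq_iff restrict_def extensional_def intro: ag(4))
  qed (auto simp: pm mods fun_eq_iff restrict_def extensional_def)
qed

section \<open>Tensor products\<close>

lemma mod_span_submodule:
  assumes "module R M" "X \<subseteq> carrier M"
  shows "submodule (mod_span R M X) R M"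
proof (rule submoduleI'[OF assms(1)])
  interpret M: module R M by fact
  show "mod_span R M X \<subseteq> carrier M"
    using M.carrier_is_submodule assms(2) by (auto simp: mod_span_def)
qed (auto simp: mod_span_def submodule_zero[OF assms(1)] module.submoduleE(4,5)[OF assms(1)])

lemma mod_span_superset: "X \<subseteq> mod_span R M X"
  by (auto simp: mod_span_def)

lemma mod_span_least: "\<lbrakk>submodule N R M; X \<subseteq> N\<rbrakk> \<Longrightarrow> mod_span R M X \<subseteq> N"
  by (auto simp: mod_span_def)

definition bilinear ::
    "('r, 'z) ring_scheme \<Rightarrow> ('r, 'm, 'x) module_scheme \<Rightarrow> ('r, 'n, 'y) module_scheme \<Rightarrow>
     ('r, 'p, 'w) module_scheme \<Rightarrow> ('m \<times> 'n \<Rightarrow> 'p) \<Rightarrow> bool"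
  where "bilinear R M N P b \<longleftrightarrow>
    (\<forall>m\<in>carrier M. (\<lambda>n. b (m, n)) \<in> mod_hom R N P) \<and>
    (\<forall>n\<in>carrier N. (\<lambda>m. b (m, n)) \<in> mod_hom R M P)"

lemma bilinearD:
  assumes "bilinear R M N P b"
  shows "m \<in> carrier M \<Longrightarrow> (\<lambda>n. b (m, n)) \<in> mod_hom R N P"
    and "n \<in> carrier N \<Longrightarrow> (\<lambda>m. b (m, n)) \<in> mod_hom R M P"
    and "b \<in> carrier M \<times> carrier N \<rightarrow> carrier P"
  using assms mod_hom_closed by (fastforce simp: bilinear_def)+

lemma tensor_rels_closed:
  assumes "module R M" "module R N"
  shows "tensor_rels R M N \<subseteq> carrier (free_module R (carrier M \<times> carrier N))"
proof -
  interpret M: module R M by fact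
  interpret N: module R N by fact
  interpret F: module R "free_module R (carrier M \<times> carrier N)"
    by (rule module_free_module[OF module_cring[OF assms(1)]])
  note b = free_basis_closed[OF module_cring[OF assms(1)], of _ "carrier M \<times> carrier N"]
  show ?thesis
    unfolding tensor_rels_def Let_def by (auto intro!: F.M.minus_closed F.M.a_closed F.smult_closed b)
qed

lemma tensor_ker_submodule:
  assumes "module R M" "module R N"
  shows "submodule (tensor_ker R M N) R (free_module R (carrier M \<times> carrier N))"
  unfolding tensor_ker_def
  by (rule mod_span_submodule[OF module_free_module[OF module_cring[OF assms(1)]] tensor_rels_closed[OF assms]])

lemma module_tensor:
  assumes "module R M" "module R N"
  shows "module R (tensor R M N)"
  unfolding tensor_def
  by (rule module_quot_module[OF module_free_module[OF module_cring[OF assms(1)]] tensor_ker_submodule[OF assms]])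

text \<open>Bilinearity says precisely that the linear extension of \<open>b\<close> vanishes on each of the four families of
relations.\<close>

lemma tensor_ker_killed:
  assumes "module R M" "module R N" "module R P" "bilinear R M N P b" "u \<in> tensor_ker R M N"
  shows "free_lift R P b u = \<zero>\<^bsub>P\<^esub>"
proof -
  interpret M: module R M by fact
  interpret N: module R N by fact
  let ?F = "free_module R (carrier M \<times> carrier N)"
  note R = module_cring[OF assms(1)]
  note F = module_free_module[OF R, of "carrier M \<times> carrier N"]
  interpret F: module R ?F by (rule F)
  note hom = free_lift_hom[OF assms(3) bilinearD(3)[OF assms(4)]]
  note basis = free_lift_basis[OF assms(3) bilinearD(3)[OF assms(4)]]
  note closed = free_basis_closed[OF R, of _ "carrier M \<times> carrier N"]
  have sub: "x \<ominus>\<^bsub>?F\<^esub> y \<in> {u \<in> carrier ?F. free_lift R P b u = \<zero>\<^bsub>P\<^esub>}"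
    if "x \<in> carrier ?F" "y \<in> carrier ?F" "free_lift R P b x = free_lift R P b y" for x y
    using that mod_hom_eq_iff_minus[OF F assms(3) hom that(1,2)] by simp
  note simps = basis mod_homD(2,3)[OF hom] closed
    mod_homD(2,3)[OF bilinearD(1)[OF assms(4)]] mod_homD(2,3)[OF bilinearD(2)[OF assms(4)]]
  have "tensor_rels R M N \<subseteq> {u \<in> carrier ?F. free_lift R P b u = \<zero>\<^bsub>P\<^esub>}"
    unfolding tensor_rels_def Let_def
    by (intro Un_least subsetI; elim CollectE exE conjE; hypsubst; intro sub)
      (simp_all add: simps)
  then have "tensor_ker R M N \<subseteq> {u \<in> carrier ?F. free_lift R P b u = \<zero>\<^bsub>P\<^esub>}"
    unfolding tensor_ker_def by (intro mod_span_least kernel_submodule[OF F assms(3) hom])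
  then show ?thesis using assms(5) by auto
qed

lemma carrier_tensor:
  "carrier (tensor R M N) =
    (\<lambda>u. tensor_ker R M N +>\<^bsub>free_module R (carrier M \<times> carrier N)\<^esub> u) `
      carrier (free_module R (carrier M \<times> carrier N))"
  by (simp add: tensor_def carrier_quot_module)

text \<open>The representative chosen in \<^const>\<open>tensor_lift\<close> differs from \<open>u\<close> by an element of the kernel, which
the linear extension does not see. This is the only place where that choice occurs; everything after it
uses the universal property.\<close>

lemma tensor_lift_coset:
  assumes "module R M" "module R N" "module R P" "bilinear R M N P b"
    and "u \<in> carrier (free_module R (carrier M \<times> carrier N))"
  shows "tensor_lift R P b (tensor_ker R M N +>\<^bsub>free_module R (carrier M \<times> carrier N)\<^esub> u) =
    free_lift R P b u"
proof -
  let ?F = "free_module R (carrier M \<times> carrier N)"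
  let ?K = "tensor_ker R M N"
  note F = module_free_module[OF module_cring[OF assms(1)], of "carrier M \<times> carrier N"]
  note K = tensor_ker_submodule[OF assms(1,2)]
  note hom = free_lift_hom[OF assms(3) bilinearD(3)[OF assms(4)]]
  interpret K: abelian_subgroup ?K ?F by (rule submodule_abelian_subgroup[OF F K])
  define v where "v = (SOME v. v \<in> ?K +>\<^bsub>?F\<^esub> u)"
  have v: "v \<in> ?K +>\<^bsub>?F\<^esub> u"
    unfolding v_def by (rule someI[of _ u]) (rule K.a_rcos_self[OF assms(5)])
  have vc: "v \<in> carrier ?F" using K.a_elemrcos_carrier[OF assms(5) v] .
  have "v \<ominus>\<^bsub>?F\<^esub> u \<in> ?K"
    using K.a_rcos_module_imp[OF assms(5) v] by (simp add: a_minus_def)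
  then have "free_lift R P b v = free_lift R P b u"
    using mod_hom_eq_iff_minus[OF F assms(3) hom vc assms(5)] tensor_ker_killed[OF assms(1-4)] by blast
  then show ?thesis
    by (simp add: tensor_lift_def free_lift_def v_def Let_def)
qed

lemma tensor_coset_hom:
  assumes "module R M" "module R N"
  shows "(\<lambda>u. tensor_ker R M N +>\<^bsub>free_module R (carrier M \<times> carrier N)\<^esub> u)
    \<in> mod_hom R (free_module R (carrier M \<times> carrier N)) (tensor R M N)"
  unfolding tensor_def
  by (rule coset_hom[OF module_free_module[OF module_cring[OF assms(1)]] tensor_ker_submodule[OF assms]])

lemma tensor_coset_eq_zero_iff:
  assumes "module R M" "module R N" "u \<in> carrier (free_module R (carrier M \<times> carrier N))"
  shows "tensor_ker R M N +>\<^bsub>free_module R (carrier M \<times> carrier N)\<^esub> u = \<zero>\<^bsub>tensor R M N\<^esub> \<longleftrightarrow>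
    u \<in> tensor_ker R M N"
  unfolding tensor_def
  by (rule coset_eq_zero_iff[OF module_free_module[OF module_cring[OF assms(1)]] tensor_ker_submodule[OF assms(1,2)] assms(3)])

lemma tensor_lift_hom:
  assumes "module R M" "module R N" "module R P" "bilinear R M N P b"
  shows "tensor_lift R P b \<in> mod_hom R (tensor R M N) P"
proof -
  interpret F: module R "free_module R (carrier M \<times> carrier N)"
    by (rule module_free_module[OF module_cring[OF assms(1)]])
  note hom = free_lift_hom[OF assms(3) bilinearD(3)[OF assms(4)]]
  show ?thesis
    by (rule mod_homI)
      (auto simp: carrier_tensor tensor_lift_coset[OF assms] mod_homD[OF hom]
        mod_homD(2,3)[OF tensor_coset_hom[OF assms(1,2)], symmetric])
qed

lemma tens_closed:
  assumes "module R M" "module R N" "m \<in> carrier M" "n \<in> carrier N"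
  shows "tens R M N m n \<in> carrier (tensor R M N)"
  using assms free_basis_closed[OF module_cring[OF assms(1)], of "(m, n)"]
  by (auto simp: tens_def carrier_tensor)

lemma tensor_lift_tens:
  assumes "module R M" "module R N" "module R P" "bilinear R M N P b"
    and "m \<in> carrier M" "n \<in> carrier N"
  shows "tensor_lift R P b (tens R M N m n) = b (m, n)"
proof -
  have mn: "(m, n) \<in> carrier M \<times> carrier N" using assms by simp
  show ?thesis
    unfolding tens_def tensor_lift_coset[OF assms(1-4) free_basis_closed[OF module_cring[OF assms(1)] mn]]
    by (rule free_lift_basis[OF assms(3) bilinearD(3)[OF assms(4)] mn])
qed

lemma tens_bilinear:
  assumes "module R M" "module R N"
  shows tens_hom_right: "m \<in> carrier M \<Longrightarrow> (\<lambda>n. tens R M N m n) \<in> mod_hom R N (tensor R M N)"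
    and tens_hom_left: "n \<in> carrier N \<Longrightarrow> (\<lambda>m. tens R M N m n) \<in> mod_hom R M (tensor R M N)"
proof -
  interpret M: module R M by fact
  interpret N: module R N by fact
  let ?F = "free_module R (carrier M \<times> carrier N)"
  let ?e = "\<lambda>m n. free_basis R (m, n)"
  note R = module_cring[OF assms(1)]
  note F = module_free_module[OF R, of "carrier M \<times> carrier N"]
  interpret F: module R ?F by (rule F)
  note closed = free_basis_closed[OF R, of _ "carrier M \<times> carrier N"]
  note K = tensor_ker_submodule[OF assms]
  note hom = tensor_coset_hom[OF assms]
  have eq: "tensor_ker R M N +>\<^bsub>?F\<^esub> x = tensor_ker R M N +>\<^bsub>?F\<^esub> y"
    if "x \<ominus>\<^bsub>?F\<^esub> y \<in> tensor_rels R M N" "x \<in> carrier ?F" "y \<in> carrier ?F" for x y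
    using that mod_span_superset[of "tensor_rels R M N" R ?F] coset_eq_iff[OF F K that(2,3)]
    by (auto simp: tensor_ker_def)
  show "(\<lambda>n. tens R M N m n) \<in> mod_hom R N (tensor R M N)" if m: "m \<in> carrier M"
  proof (rule mod_homI)
    fix n n' assume n: "n \<in> carrier N" "n' \<in> carrier N"
    have "?e m (n \<oplus>\<^bsub>N\<^esub> n') \<ominus>\<^bsub>?F\<^esub> (?e m n \<oplus>\<^bsub>?F\<^esub> ?e m n') \<in> tensor_rels R M N"
      unfolding tensor_rels_def Let_def using m n by blast
    then have "tensor_ker R M N +>\<^bsub>?F\<^esub> ?e m (n \<oplus>\<^bsub>N\<^esub> n') = tensor_ker R M N +>\<^bsub>?F\<^esub> (?e m n \<oplus>\<^bsub>?F\<^esub> ?e m n')"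
      using m n closed by (intro eq) simp_all
    then show "tens R M N m (n \<oplus>\<^bsub>N\<^esub> n') = tens R M N m n \<oplus>\<^bsub>tensor R M N\<^esub> tens R M N m n'"
      unfolding tens_def using m n closed by (simp add: mod_hom_add[OF hom])
  next
    fix r n assume n: "r \<in> carrier R" "n \<in> carrier N"
    have "?e m (r \<odot>\<^bsub>N\<^esub> n) \<ominus>\<^bsub>?F\<^esub> (r \<odot>\<^bsub>?F\<^esub> ?e m n) \<in> tensor_rels R M N"
      unfolding tensor_rels_def Let_def using m n by blast
    then have "tensor_ker R M N +>\<^bsub>?F\<^esub> ?e m (r \<odot>\<^bsub>N\<^esub> n) = tensor_ker R M N +>\<^bsub>?F\<^esub> (r \<odot>\<^bsub>?F\<^esub> ?e m n)"
      using m n closed by (intro eq) simp_all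
    then show "tens R M N m (r \<odot>\<^bsub>N\<^esub> n) = r \<odot>\<^bsub>tensor R M N\<^esub> tens R M N m n"
      unfolding tens_def using m n closed by (simp add: mod_hom_smult[OF hom])
  qed (simp add: tens_closed[OF assms m])
  show "(\<lambda>m. tens R M N m n) \<in> mod_hom R M (tensor R M N)" if n: "n \<in> carrier N"
  proof (rule mod_homI)
    fix m m' assume m: "m \<in> carrier M" "m' \<in> carrier M"
    have "?e (m \<oplus>\<^bsub>M\<^esub> m') n \<ominus>\<^bsub>?F\<^esub> (?e m n \<oplus>\<^bsub>?F\<^esub> ?e m' n) \<in> tensor_rels R M N"
      unfolding tensor_rels_def Let_def using m n by blast
    then have "tensor_ker R M N +>\<^bsub>?F\<^esub> ?e (m \<oplus>\<^bsub>M\<^esub> m') n = tensor_ker R M N +>\<^bsub>?F\<^esub> (?e m n \<oplus>\<^bsub>?F\<^esub> ?e m' n)"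
      using m n closed by (intro eq) simp_all
    then show "tens R M N (m \<oplus>\<^bsub>M\<^esub> m') n = tens R M N m n \<oplus>\<^bsub>tensor R M N\<^esub> tens R M N m' n"
      unfolding tens_def using m n closed by (simp add: mod_hom_add[OF hom])
  next
    fix r m assume m: "r \<in> carrier R" "m \<in> carrier M"
    have "?e (r \<odot>\<^bsub>M\<^esub> m) n \<ominus>\<^bsub>?F\<^esub> (r \<odot>\<^bsub>?F\<^esub> ?e m n) \<in> tensor_rels R M N"
      unfolding tensor_rels_def Let_def using m n by blast
    then have "tensor_ker R M N +>\<^bsub>?F\<^esub> ?e (r \<odot>\<^bsub>M\<^esub> m) n = tensor_ker R M N +>\<^bsub>?F\<^esub> (r \<odot>\<^bsub>?F\<^esub> ?e m n)"
      using m n closed by (intro eq) simp_all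
    then show "tens R M N (r \<odot>\<^bsub>M\<^esub> m) n = r \<odot>\<^bsub>tensor R M N\<^esub> tens R M N m n"
      unfolding tens_def using m n closed by (simp add: mod_hom_smult[OF hom])
  qed (simp add: tens_closed[OF assms _ n])
qed

text \<open>The tensor product is generated by pure tensors, as the free module is by its basis.\<close>

lemma tensor_spanned:
  assumes "module R M" "module R N" "submodule U R (tensor R M N)"
    and "\<And>m n. \<lbrakk>m \<in> carrier M; n \<in> carrier N\<rbrakk> \<Longrightarrow> tens R M N m n \<in> U"
    and "X \<in> carrier (tensor R M N)"
  shows "X \<in> U"
proof -
  let ?F = "free_module R (carrier M \<times> carrier N)"
  note R = module_cring[OF assms(1)]
  let ?V = "{u \<in> carrier ?F. tensor_ker R M N +>\<^bsub>?F\<^esub> u \<in> U}"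
  have V: "submodule ?V R ?F"
    by (rule preimage_submodule[OF module_free_module[OF R] module_tensor[OF assms(1,2)]
          tensor_coset_hom[OF assms(1,2)] assms(3)])
  obtain u where u: "u \<in> carrier ?F" "X = tensor_ker R M N +>\<^bsub>?F\<^esub> u"
    using assms(5) by (auto simp: carrier_tensor)
  have "u \<in> ?V"
    by (rule free_module_spanned[OF R V _ u(1)])
      (use assms(4) free_basis_closed[OF R, of _ "carrier M \<times> carrier N"] in \<open>auto simp: tens_def\<close>)
  then show ?thesis using u by simp
qed

lemma tensor_hom_eqI:
  assumes "module R M" "module R N" "module R P"
    and "f \<in> mod_hom R (tensor R M N) P" "g \<in> mod_hom R (tensor R M N) P"
    and "\<And>m n. \<lbrakk>m \<in> carrier M; n \<in> carrier N\<rbrakk> \<Longrightarrow> f (tens R M N m n) = g (tens R M N m n)"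
    and "X \<in> carrier (tensor R M N)"
  shows "f X = g X"
  using tensor_spanned[OF assms(1,2) equalizer_submodule[OF module_tensor[OF assms(1,2)] assms(3-5)] _ assms(7)]
    assms(6) tens_closed[OF assms(1,2)] by simp

lemma bilinear_tens_map:
  assumes "module R M" "module R N" "f \<in> mod_hom R K M" "g \<in> mod_hom R L N"
  shows "bilinear R K L (tensor R M N) (\<lambda>(k, l). tens R M N (f k) (g l))"
  unfolding bilinear_def split_conv
  using mod_hom_comp[OF assms(4) tens_hom_right[OF assms(1,2)]]
    mod_hom_comp[OF assms(3) tens_hom_left[OF assms(1,2)]] mod_hom_closed[OF assms(3)] mod_hom_closed[OF assms(4)]
  by blast

lemma tensor_map_hom:
  assumes "module R K" "module R L" "module R M" "module R N" "f \<in> mod_hom R K M" "g \<in> mod_hom R L N"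
  shows "tensor_map R M N f g \<in> mod_hom R (tensor R K L) (tensor R M N)"
  unfolding tensor_map_def
  by (rule tensor_lift_hom[OF assms(1,2) module_tensor[OF assms(3,4)] bilinear_tens_map[OF assms(3-6)]])

lemma tensor_map_tens:
  assumes "module R K" "module R L" "module R M" "module R N" "f \<in> mod_hom R K M" "g \<in> mod_hom R L N"
    and "k \<in> carrier K" "l \<in> carrier L"
  shows "tensor_map R M N f g (tens R K L k l) = tens R M N (f k) (g l)"
  unfolding tensor_map_def
  by (simp add: tensor_lift_tens[OF assms(1,2) module_tensor[OF assms(3,4)] bilinear_tens_map[OF assms(3-6)] assms(7,8)])

lemma tensor_map_comp:
  assumes "module R K" "module R L" "module R M" "module R N" "module R M'" "module R N'"
    and "f \<in> mod_hom R K M" "g \<in> mod_hom R L N" "f' \<in> mod_hom R M M'" "g' \<in> mod_hom R N N'"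
    and "h \<in> mod_hom R K M'" "k \<in> mod_hom R L N'"
    and "\<And>x. x \<in> carrier K \<Longrightarrow> f' (f x) = h x" "\<And>x. x \<in> carrier L \<Longrightarrow> g' (g x) = k x"
    and "X \<in> carrier (tensor R K L)"
  shows "tensor_map R M' N' f' g' (tensor_map R M N f g X) = tensor_map R M' N' h k X"
  by (rule tensor_hom_eqI[OF assms(1,2) module_tensor[OF assms(5,6)]
        mod_hom_comp[OF tensor_map_hom[OF assms(1-4,7,8)] tensor_map_hom[OF assms(3-6,9,10)]]
        tensor_map_hom[OF assms(1,2,5,6,11,12)] _ assms(15)])
    (simp add: tensor_map_tens[OF assms(1-4,7,8)] tensor_map_tens[OF assms(3-6,9,10)]
      tensor_map_tens[OF assms(1,2,5,6,11,12)] mod_hom_closed[OF assms(7)] mod_hom_closed[OF assms(8)] assms(13,14))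

lemma mod_hom_plus:
  assumes "module R M" "module R N" "f \<in> mod_hom R M N" "g \<in> mod_hom R M N"
  shows "(\<lambda>x. f x \<oplus>\<^bsub>N\<^esub> g x) \<in> mod_hom R M N"
proof -
  interpret N: module R N by fact
  show ?thesis
    by (rule mod_homI)
      (auto simp: mod_homD[OF assms(3)] mod_homD[OF assms(4)] N.smult_r_distr N.M.a_ac)
qed

lemma mod_hom_scale:
  assumes "module R M" "module R N" "f \<in> mod_hom R M N" "r \<in> carrier R"
  shows "(\<lambda>x. r \<odot>\<^bsub>N\<^esub> f x) \<in> mod_hom R M N"
proof -
  interpret N: module R N by fact
  show ?thesis
    by (rule mod_homI)
      (auto simp: mod_homD[OF assms(3)] N.smult_r_distr assms(4) N.smult_assoc1[symmetric] N.R.m_comm)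
qed

text \<open>Nested uses of \<^const>\<open>tensor_lift\<close>, as in the associativity isomorphism and in the multiplication of
an algebra \<open>A \<otimes> B\<close>, are well defined only if the inner lift is linear in its parameter.\<close>

lemma tensor_lift_param_hom:
  assumes "module R L" "module R M" "module R N" "module R P"
    and "\<And>l. l \<in> carrier L \<Longrightarrow> bilinear R M N P (b l)"
    and "\<And>m n. \<lbrakk>m \<in> carrier M; n \<in> carrier N\<rbrakk> \<Longrightarrow> (\<lambda>l. b l (m, n)) \<in> mod_hom R L P"
    and "X \<in> carrier (tensor R M N)"
  shows "(\<lambda>l. tensor_lift R P (b l) X) \<in> mod_hom R L P"
proof (rule mod_homI)
  interpret L: module R L by fact
  note lift = tensor_lift_hom[OF assms(2-4) assms(5)]
  note T = module_tensor[OF assms(2,3)]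
  note tens = tensor_lift_tens[OF assms(2-4) assms(5)]
  show "tensor_lift R P (b l) X \<in> carrier P" if "l \<in> carrier L" for l
    using mod_hom_closed[OF lift[OF that] assms(7)] .
  show "tensor_lift R P (b (l \<oplus>\<^bsub>L\<^esub> l')) X = tensor_lift R P (b l) X \<oplus>\<^bsub>P\<^esub> tensor_lift R P (b l') X"
    if l: "l \<in> carrier L" "l' \<in> carrier L" for l l'
    by (rule tensor_hom_eqI[OF assms(2-4) lift mod_hom_plus[OF T assms(4) lift lift] _ assms(7)])
      (simp_all add: l tens mod_hom_add[OF assms(6)])
  show "tensor_lift R P (b (r \<odot>\<^bsub>L\<^esub> l)) X = r \<odot>\<^bsub>P\<^esub> tensor_lift R P (b l) X"
    if l: "r \<in> carrier R" "l \<in> carrier L" for r l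
    by (rule tensor_hom_eqI[OF assms(2-4) lift mod_hom_scale[OF T assms(4) lift] _ assms(7)])
      (simp_all add: l tens mod_hom_smult[OF assms(6)])
qed

context
  fixes R L M N
  assumes mods: "module R L" "module R M" "module R N"
begin

lemma tensor_assoc_inner_bilinear:
  assumes "n \<in> carrier N"
  shows "bilinear R L M (tensor R L (tensor R M N)) (\<lambda>(l, m). tens R L (tensor R M N) l (tens R M N m n))"
  by (rule bilinear_tens_map[OF mods(1) module_tensor[OF mods(2,3)] mod_hom_id tens_hom_left[OF mods(2,3) assms]])

lemma tensor_assoc_bilinear:
  "bilinear R (tensor R L M) N (tensor R L (tensor R M N)) (\<lambda>(X, n).
     tensor_lift R (tensor R L (tensor R M N)) (\<lambda>(l, m). tens R L (tensor R M N) l (tens R M N m n)) X)"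
  (is "bilinear R ?LM N ?T _")
  unfolding bilinear_def split_conv
proof safe
  note MN = module_tensor[OF mods(2,3)]
  note T = module_tensor[OF mods(1) MN]
  fix X assume X: "X \<in> carrier ?LM"
  show "(\<lambda>n. tensor_lift R ?T (\<lambda>(l, m). tens R L (tensor R M N) l (tens R M N m n)) X) \<in> mod_hom R N ?T"
  proof (rule tensor_lift_param_hom[OF mods(3,1,2) T tensor_assoc_inner_bilinear _ X])
    show "(\<lambda>n. case (l, m) of (l, m) \<Rightarrow> tens R L (tensor R M N) l (tens R M N m n)) \<in> mod_hom R N ?T"
      if "l \<in> carrier L" "m \<in> carrier M" for l m
      using mod_hom_comp[OF tens_hom_right[OF mods(2,3) that(2)] tens_hom_right[OF mods(1) MN that(1)]]
      by simp
  qed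
next
  note MN = module_tensor[OF mods(2,3)]
  fix n assume "n \<in> carrier N"
  then show "tensor_lift R ?T (\<lambda>(l, m). tens R L (tensor R M N) l (tens R M N m n)) \<in> mod_hom R ?LM ?T"
    by (rule tensor_lift_hom[OF mods(1,2) module_tensor[OF mods(1) MN] tensor_assoc_inner_bilinear])
qed

lemma tensor_assoc_hom:
  "tensor_assoc R L M N \<in> mod_hom R (tensor R (tensor R L M) N) (tensor R L (tensor R M N))"
  unfolding tensor_assoc_def Let_def
  by (rule tensor_lift_hom[OF module_tensor[OF mods(1,2)] mods(3)
        module_tensor[OF mods(1) module_tensor[OF mods(2,3)]] tensor_assoc_bilinear])

text \<open>Keeping \<open>X\<close> general, and not only a pure tensor, makes the lemma applicable to \<open>X = \<delta> a\<close> or \<open>X = \<Delta> c\<close>.\<close>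

lemma tensor_assoc_tens_left:
  assumes "X \<in> carrier (tensor R L M)" "n \<in> carrier N"
  shows "tensor_assoc R L M N (tens R (tensor R L M) N X n) =
    tensor_map R L (tensor R M N) (\<lambda>l. l) (\<lambda>m. tens R M N m n) X"
  unfolding tensor_assoc_def Let_def tensor_map_def
  using tensor_lift_tens[OF module_tensor[OF mods(1,2)] mods(3)
      module_tensor[OF mods(1) module_tensor[OF mods(2,3)]] tensor_assoc_bilinear assms] by simp

end

section \<open>Flat Mittag-Leffler modules\<close>

lemma tensor_map_right_hom:
  assumes "module R A" "module R L" "module R N" "g \<in> mod_hom R L N"
  shows "tensor_map R A N (\<lambda>a. a) g \<in> mod_hom R (tensor R A L) (tensor R A N)"
  by (rule tensor_map_hom[OF assms(1,2,1,3) mod_hom_id assms(4)])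

lemma tensor_map_right_comp:
  assumes "module R A" "module R L" "module R N" "module R P"
    and "g \<in> mod_hom R L N" "h \<in> mod_hom R N P" "k \<in> mod_hom R L P"
    and "\<And>x. x \<in> carrier L \<Longrightarrow> h (g x) = k x" "X \<in> carrier (tensor R A L)"
  shows "tensor_map R A P (\<lambda>a. a) h (tensor_map R A N (\<lambda>a. a) g X) = tensor_map R A P (\<lambda>a. a) k X"
  by (rule tensor_map_comp[OF assms(1,2,1,3,1,4) mod_hom_id assms(5) mod_hom_id assms(6) mod_hom_id assms(7)
        refl assms(8,9)])

text \<open>The action of \<open>id \<otimes> g\<close> on representatives: it carries the basis vector at \<open>(a, n)\<close> to the one at
\<open>(a, g n)\<close>. It is used to compare \<open>A \<otimes> M\<close> with \<open>A \<otimes> M\<^sub>0\<close> for submodules \<open>M\<^sub>0\<close> of \<open>M\<close>.\<close>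

lemma tensor_map_coset:
  assumes "module R A" "module R N" "module R M" "g \<in> mod_hom R N M"
    and "y \<in> carrier (free_module R (carrier A \<times> carrier N))"
  shows "tensor_map R A M (\<lambda>a. a) g (tensor_ker R A N +>\<^bsub>free_module R (carrier A \<times> carrier N)\<^esub> y) =
    tensor_ker R A M +>\<^bsub>free_module R (carrier A \<times> carrier M)\<^esub>
      free_lift R (free_module R (carrier A \<times> carrier M)) (\<lambda>(a, n). free_basis R (a, g n)) y"
proof -
  let ?S = "carrier A \<times> carrier N"
  let ?F = "free_module R (carrier A \<times> carrier M)"
  note R = module_cring[OF assms(1)]
  have b: "(\<lambda>(a, n). free_basis R (a, g n)) \<in> ?S \<rightarrow> carrier ?F"
    using mod_hom_closed[OF assms(4)] free_basis_closed[OF R, of _ "carrier A \<times> carrier M"] by auto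
  note lift = free_lift_hom[OF module_free_module[OF R] b]
  show ?thesis
  proof (rule free_module_hom_eqI[OF module_tensor[OF assms(1,3)]
        mod_hom_comp[OF tensor_coset_hom[OF assms(1,2)] tensor_map_right_hom[OF assms(1-4)]]
        mod_hom_comp[OF lift tensor_coset_hom[OF assms(1,3)]] _ assms(5)])
    fix s assume s: "s \<in> ?S"
    then show "tensor_map R A M (\<lambda>a. a) g (tensor_ker R A N +>\<^bsub>free_module R ?S\<^esub> free_basis R s) =
      tensor_ker R A M +>\<^bsub>?F\<^esub> free_lift R ?F (\<lambda>(a, n). free_basis R (a, g n)) (free_basis R s)"
      unfolding free_lift_basis[OF module_free_module[OF R] b s]
      using tensor_map_tens[OF assms(1,2,1,3) mod_hom_id assms(4), of "fst s" "snd s"]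
      by (auto simp: tens_def)
  qed
qed

lemma free_module_minus_mono:
  assumes "cring R" "S \<subseteq> S'" "x \<in> carrier (free_module R S)" "y \<in> carrier (free_module R S)"
  shows "x \<ominus>\<^bsub>free_module R S'\<^esub> y = x \<ominus>\<^bsub>free_module R S\<^esub> y"
  using mod_hom_minus[OF module_free_module[OF assms(1)] module_free_module[OF assms(1)]
      free_module_mono[OF assms(1,2)] assms(3,4)] by simp

text \<open>A defining relation of \<open>A \<otimes> M\<close> mentions at most two elements of \<open>M\<close>. It is a relation of \<open>A \<otimes> M\<^sub>0\<close>
as soon as \<open>M\<^sub>0\<close> contains these. The free modules on different sets have the same operations, so it
is literally the same function.\<close>

lemma tensor_rels_local:
  assumes "module R A" "module R M" "z \<in> tensor_rels R A M"
  obtains W where "finite W" "W \<subseteq> carrier M"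
    "\<And>M0. \<lbrakk>submodule M0 R M; W \<subseteq> M0\<rbrakk> \<Longrightarrow> z \<in> tensor_rels R A (M\<lparr>carrier := M0\<rparr>)"
proof -
  interpret A: module R A by fact
  interpret M: module R M by fact
  let ?F = "free_module R (carrier A \<times> carrier M)"
  let ?e = "\<lambda>a m. free_basis R (a, m)"
  note R = module_cring[OF assms(1)]
  have key: "x \<ominus>\<^bsub>?F\<^esub> y = x \<ominus>\<^bsub>free_module R (carrier A \<times> M0)\<^esub> y"
    if "submodule M0 R M" "x \<in> carrier (free_module R (carrier A \<times> M0))"
      "y \<in> carrier (free_module R (carrier A \<times> M0))" for M0 x y
    using module.submoduleE(1)[OF assms(2) that(1)] that by (intro free_module_minus_mono[OF R]) auto
  have plus: "add ?F = add (free_module R (carrier A \<times> M0))" "smult ?F = smult (free_module R (carrier A \<times> M0))" for M0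
    by (simp_all add: free_module_def)
  have e: "?e a m \<in> carrier (free_module R (carrier A \<times> M0))" if "a \<in> carrier A" "m \<in> M0" for a m M0
    using that by (intro free_basis_closed[OF R]) simp
  have ee: "?e a m \<oplus>\<^bsub>?F\<^esub> ?e a' m' \<in> carrier (free_module R (carrier A \<times> M0))"
    if "a \<in> carrier A" "m \<in> M0" "a' \<in> carrier A" "m' \<in> M0" for a m a' m' M0
  proof -
    interpret F0: module R "free_module R (carrier A \<times> M0)" by (rule module_free_module[OF R])
    show ?thesis unfolding plus(1)[of M0] using that by (intro F0.M.a_closed e)
  qed
  have re: "r \<odot>\<^bsub>?F\<^esub> ?e a m \<in> carrier (free_module R (carrier A \<times> M0))"
    if "r \<in> carrier R" "a \<in> carrier A" "m \<in> M0" for r a m M0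
  proof -
    interpret F0: module R "free_module R (carrier A \<times> M0)" by (rule module_free_module[OF R])
    show ?thesis unfolding plus(2)[of M0] using that by (intro F0.smult_closed e)
  qed
  note sub = module.submoduleE[OF assms(2)]
  consider
    (1) a a' m where "z = ?e (a \<oplus>\<^bsub>A\<^esub> a') m \<ominus>\<^bsub>?F\<^esub> (?e a m \<oplus>\<^bsub>?F\<^esub> ?e a' m)"
        "a \<in> carrier A" "a' \<in> carrier A" "m \<in> carrier M"
  | (2) a m m' where "z = ?e a (m \<oplus>\<^bsub>M\<^esub> m') \<ominus>\<^bsub>?F\<^esub> (?e a m \<oplus>\<^bsub>?F\<^esub> ?e a m')"
        "a \<in> carrier A" "m \<in> carrier M" "m' \<in> carrier M"
  | (3) r a m where "z = ?e (r \<odot>\<^bsub>A\<^esub> a) m \<ominus>\<^bsub>?F\<^esub> (r \<odot>\<^bsub>?F\<^esub> ?e a m)"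
        "r \<in> carrier R" "a \<in> carrier A" "m \<in> carrier M"
  | (4) r a m where "z = ?e a (r \<odot>\<^bsub>M\<^esub> m) \<ominus>\<^bsub>?F\<^esub> (r \<odot>\<^bsub>?F\<^esub> ?e a m)"
        "r \<in> carrier R" "a \<in> carrier A" "m \<in> carrier M"
    using assms(3) unfolding tensor_rels_def Let_def by blast
  then show thesis
  proof cases
    case 1
    show thesis
    proof (rule that[of "{m}"])
      fix M0 assume M0: "submodule M0 R M" "{m} \<subseteq> M0"
      have "z = ?e (a \<oplus>\<^bsub>A\<^esub> a') m \<ominus>\<^bsub>free_module R (carrier A \<times> M0)\<^esub> (?e a m \<oplus>\<^bsub>free_module R (carrier A \<times> M0)\<^esub> ?e a' m)"
        unfolding 1(1) using 1 M0 by (subst key[OF M0(1)]) (simp_all add: e ee plus(1)[of M0, symmetric])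
      then show "z \<in> tensor_rels R A (M\<lparr>carrier := M0\<rparr>)"
        unfolding tensor_rels_def Let_def using 1 M0 by auto
    qed (use 1 in auto)
  next
    case 2
    show thesis
    proof (rule that[of "{m, m'}"])
      fix M0 assume M0: "submodule M0 R M" "{m, m'} \<subseteq> M0"
      have "z = ?e a (m \<oplus>\<^bsub>M\<^esub> m') \<ominus>\<^bsub>free_module R (carrier A \<times> M0)\<^esub> (?e a m \<oplus>\<^bsub>free_module R (carrier A \<times> M0)\<^esub> ?e a m')"
        unfolding 2(1) using 2 M0 sub(5)[OF M0(1)]
        by (subst key[OF M0(1)]) (simp_all add: e ee plus(1)[of M0, symmetric])
      then show "z \<in> tensor_rels R A (M\<lparr>carrier := M0\<rparr>)"
        unfolding tensor_rels_def Let_def using 2 M0 by auto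
    qed (use 2 in auto)
  next
    case 3
    show thesis
    proof (rule that[of "{m}"])
      fix M0 assume M0: "submodule M0 R M" "{m} \<subseteq> M0"
      have "z = ?e (r \<odot>\<^bsub>A\<^esub> a) m \<ominus>\<^bsub>free_module R (carrier A \<times> M0)\<^esub> (r \<odot>\<^bsub>free_module R (carrier A \<times> M0)\<^esub> ?e a m)"
        unfolding 3(1) using 3 M0 by (subst key[OF M0(1)]) (simp_all add: e re plus(2)[of M0, symmetric])
      then show "z \<in> tensor_rels R A (M\<lparr>carrier := M0\<rparr>)"
        unfolding tensor_rels_def Let_def using 3 M0 by auto
    qed (use 3 in auto)
  next
    case 4
    show thesis
    proof (rule that[of "{m}"])
      fix M0 assume M0: "submodule M0 R M" "{m} \<subseteq> M0"
      have "z = ?e a (r \<odot>\<^bsub>M\<^esub> m) \<ominus>\<^bsub>free_module R (carrier A \<times> M0)\<^esub> (r \<odot>\<^bsub>free_module R (carrier A \<times> M0)\<^esub> ?e a m)"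
        unfolding 4(1) using 4 M0 sub(4)[OF M0(1)]
        by (subst key[OF M0(1)]) (simp_all add: e re plus(2)[of M0, symmetric])
      then show "z \<in> tensor_rels R A (M\<lparr>carrier := M0\<rparr>)"
        unfolding tensor_rels_def Let_def using 4 M0 by auto
    qed (use 4 in auto)
  qed
qed

text \<open>The elements that are consequences of relations over finitely many elements of \<open>M\<close> are closed under
sums and scalar multiples and contain the relations, so they are all of the kernel.\<close>

lemma tensor_ker_local:
  assumes "module R A" "module R M" "z \<in> tensor_ker R A M"
  obtains W where "finite W" "W \<subseteq> carrier M"
    "\<And>M0. \<lbrakk>submodule M0 R M; W \<subseteq> M0\<rbrakk> \<Longrightarrow> z \<in> tensor_ker R A (M\<lparr>carrier := M0\<rparr>)"
proof -
  let ?F = "free_module R (carrier A \<times> carrier M)"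
  note R = module_cring[OF assms(1)]
  let ?ok = "\<lambda>W z. finite W \<and> W \<subseteq> carrier M \<and>
    (\<forall>M0. submodule M0 R M \<and> W \<subseteq> M0 \<longrightarrow> z \<in> tensor_ker R A (M\<lparr>carrier := M0\<rparr>))"
  have ops: "add ?F = add (free_module R (carrier A \<times> M0))" "smult ?F = smult (free_module R (carrier A \<times> M0))"
    "zero ?F = zero (free_module R (carrier A \<times> M0))" for M0
    by (simp_all add: free_module_def)
  have F0: "module R (free_module R (carrier A \<times> M0))" for M0
    by (rule module_free_module[OF R])
  have sub: "submodule (tensor_ker R A (M\<lparr>carrier := M0\<rparr>)) R (free_module R (carrier A \<times> M0))"
    if "submodule M0 R M" for M0
    using tensor_ker_submodule[OF assms(1) submodule.submodule_is_module[OF that assms(2)]] by simp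
  have "submodule {z \<in> carrier ?F. \<exists>W. ?ok W z} R ?F"
  proof (rule submoduleI'[OF F0])
    interpret F: module R ?F by (rule F0)
    have "\<zero>\<^bsub>?F\<^esub> \<in> tensor_ker R A (M\<lparr>carrier := M0\<rparr>)" if "submodule M0 R M" for M0
      unfolding ops(3)[of M0] by (rule submodule_zero[OF F0 sub[OF that]])
    then have "?ok {} \<zero>\<^bsub>?F\<^esub>" by simp
    then show "\<zero>\<^bsub>?F\<^esub> \<in> {z \<in> carrier ?F. \<exists>W. ?ok W z}" by blast
    fix x y assume "x \<in> {z \<in> carrier ?F. \<exists>W. ?ok W z}" "y \<in> {z \<in> carrier ?F. \<exists>W. ?ok W z}"
    then obtain W W' where x: "x \<in> carrier ?F" "?ok W x" and y: "y \<in> carrier ?F" "?ok W' y" by blast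
    have "?ok (W \<union> W') (x \<oplus>\<^bsub>?F\<^esub> y)"
    proof (intro conjI allI impI)
      fix M0 assume M0: "submodule M0 R M \<and> W \<union> W' \<subseteq> M0"
      then show "x \<oplus>\<^bsub>?F\<^esub> y \<in> tensor_ker R A (M\<lparr>carrier := M0\<rparr>)"
        unfolding ops(1)[of M0] using x y by (intro module.submoduleE(5)[OF F0 sub]) auto
    qed (use x y in auto)
    then show "x \<oplus>\<^bsub>?F\<^esub> y \<in> {z \<in> carrier ?F. \<exists>W. ?ok W z}" using x y by blast
  next
    interpret F: module R ?F by (rule F0)
    fix r x assume r: "r \<in> carrier R" and "x \<in> {z \<in> carrier ?F. \<exists>W. ?ok W z}"
    then obtain W where x: "x \<in> carrier ?F" "?ok W x" by blast
    have "?ok W (r \<odot>\<^bsub>?F\<^esub> x)"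
    proof (intro conjI allI impI)
      fix M0 assume M0: "submodule M0 R M \<and> W \<subseteq> M0"
      then show "r \<odot>\<^bsub>?F\<^esub> x \<in> tensor_ker R A (M\<lparr>carrier := M0\<rparr>)"
        unfolding ops(2)[of M0] using x r by (intro module.submoduleE(4)[OF F0 sub]) auto
    qed (use x in auto)
    then show "r \<odot>\<^bsub>?F\<^esub> x \<in> {z \<in> carrier ?F. \<exists>W. ?ok W z}" using r x by blast
  qed auto
  moreover have "tensor_rels R A M \<subseteq> {z \<in> carrier ?F. \<exists>W. ?ok W z}"
  proof
    fix z assume z: "z \<in> tensor_rels R A M"
    obtain W where W: "finite W" "W \<subseteq> carrier M"
      "\<And>M0. \<lbrakk>submodule M0 R M; W \<subseteq> M0\<rbrakk> \<Longrightarrow> z \<in> tensor_rels R A (M\<lparr>carrier := M0\<rparr>)"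
      using tensor_rels_local[OF assms(1,2) z] by blast
    have "z \<in> tensor_ker R A (M\<lparr>carrier := M0\<rparr>)" if "submodule M0 R M" "W \<subseteq> M0" for M0
      using W(3)[OF that] mod_span_superset[of "tensor_rels R A (M\<lparr>carrier := M0\<rparr>)"]
      unfolding tensor_ker_def by blast
    then show "z \<in> {z \<in> carrier ?F. \<exists>W. ?ok W z}"
      using W(1,2) tensor_rels_closed[OF assms(1,2)] z by blast
  qed
  ultimately have "tensor_ker R A M \<subseteq> {z \<in> carrier ?F. \<exists>W. ?ok W z}"
    unfolding tensor_ker_def by (rule mod_span_least)
  then have "\<exists>W. ?ok W z" using assms(3) by blast
  then obtain W where "?ok W z" ..
  then show thesis by (intro that[of W]) simp_all
qed

text \<open>If a tensor vanishes in \<open>A \<otimes> M\<close>, it does so already over every submodule that contains the finitely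
many elements of \<open>M\<close> which occur in the relations involved. This brings an arbitrary module within
reach of test modules that are quotients of the free module on \<open>\<nat>\<close>.\<close>

lemma tensor_zero_local:
  assumes "module R A" "module R N" "module R M" "g \<in> mod_hom R N M" "Y \<in> carrier (tensor R A N)"
    and "tensor_map R A M (\<lambda>a. a) g Y = \<zero>\<^bsub>tensor R A M\<^esub>"
  obtains W where "finite W" "W \<subseteq> carrier M"
    "\<And>M0. \<lbrakk>submodule M0 R M; W \<subseteq> M0; g ` carrier N \<subseteq> M0\<rbrakk> \<Longrightarrow>
      tensor_map R A (M\<lparr>carrier := M0\<rparr>) (\<lambda>a. a) g Y = \<zero>\<^bsub>tensor R A (M\<lparr>carrier := M0\<rparr>)\<^esub>"
proof -
  let ?S = "carrier A \<times> carrier N"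
  note R = module_cring[OF assms(1)]
  let ?b = "\<lambda>(a, n). free_basis R (a, g n)"
  let ?F = "free_module R (carrier A \<times> carrier M)"
  obtain y where y: "y \<in> carrier (free_module R ?S)"
    and Y: "Y = tensor_ker R A N +>\<^bsub>free_module R ?S\<^esub> y"
    using assms(5) by (auto simp: carrier_tensor)
  have b: "?b \<in> ?S \<rightarrow> carrier (free_module R (carrier A \<times> M0))" if "g ` carrier N \<subseteq> M0" for M0
    using that free_basis_closed[OF R, of _ "carrier A \<times> M0"] by (auto simp: image_subset_iff)
  have F: "module R (free_module R (carrier A \<times> M0))" for M0
    by (rule module_free_module[OF R])
  have gM: "g ` carrier N \<subseteq> carrier M" using mod_hom_closed[OF assms(4)] by auto
  define z where "z = free_lift R ?F ?b y"
  have z: "z \<in> carrier ?F"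
    unfolding z_def by (rule mod_hom_closed[OF free_lift_hom[OF F b[OF gM]] y])
  have "z \<in> tensor_ker R A M"
    using assms(6) unfolding Y tensor_map_coset[OF assms(1-4) y] z_def[symmetric]
    by (simp add: tensor_coset_eq_zero_iff[OF assms(1,3) z])
  then obtain W where W: "finite W" "W \<subseteq> carrier M"
    "\<And>M0. \<lbrakk>submodule M0 R M; W \<subseteq> M0\<rbrakk> \<Longrightarrow> z \<in> tensor_ker R A (M\<lparr>carrier := M0\<rparr>)"
    using tensor_ker_local[OF assms(1,3)] by blast
  show thesis
  proof (rule that[OF W(1,2)])
    fix M0 assume M0: "submodule M0 R M" "W \<subseteq> M0" "g ` carrier N \<subseteq> M0"
    let ?Msub = "M\<lparr>carrier := M0\<rparr>"
    let ?Fsub = "free_module R (carrier A \<times> M0)"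
    have mod0: "module R ?Msub" by (rule submodule.submodule_is_module[OF M0(1) assms(3)])
    have g0: "g \<in> mod_hom R N ?Msub"
      using assms(4) M0(3) by (auto simp: mod_hom_def)
    have sub: "carrier A \<times> M0 \<subseteq> carrier A \<times> carrier M"
      using module.submoduleE(1)[OF assms(3) M0(1)] by auto
    have z0: "free_lift R ?Fsub ?b y = z"
      unfolding z_def
    proof (rule free_module_hom_eqI[OF F mod_hom_comp[OF free_lift_hom[OF F b[OF M0(3)]] free_module_mono[OF R sub]]
          free_lift_hom[OF F b[OF gM]] _ y])
      show "free_lift R ?Fsub ?b (free_basis R s) = free_lift R ?F ?b (free_basis R s)" if "s \<in> ?S" for s
        using that by (simp add: free_lift_basis[OF F b[OF gM] that] free_lift_basis[OF F b[OF M0(3)] that])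
    qed
    have "free_lift R ?Fsub ?b y \<in> carrier ?Fsub"
      by (rule mod_hom_closed[OF free_lift_hom[OF F b[OF M0(3)]] y])
    then have "z \<in> carrier (free_module R (carrier A \<times> carrier ?Msub))"
      using z0 by simp
    then show "tensor_map R A ?Msub (\<lambda>a. a) g Y = \<zero>\<^bsub>tensor R A ?Msub\<^esub>"
      unfolding Y tensor_map_coset[OF assms(1,2) mod0 g0 y]
      using tensor_coset_eq_zero_iff[OF assms(1) mod0, of z] W(3)[OF M0(1,2)] z0 by simp
  qed
qed

abbreviation free_nat_module :: "('r, 'z) ring_scheme \<Rightarrow> ('r, nat \<Rightarrow> 'r) module"
  where "free_nat_module R \<equiv> free_module R (UNIV :: nat set)"

lemma finite_enumeration:
  assumes "finite W" "W \<subseteq> C" "c \<in> C"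
  obtains w :: "nat \<Rightarrow> 'a" where "range w \<subseteq> C" "W \<subseteq> range w"
proof -
  obtain xs where xs: "set xs = W" using finite_list[OF assms(1)] by blast
  let ?w = "\<lambda>k. if k < length xs then xs ! k else c"
  have "W \<subseteq> range ?w"
  proof
    fix x assume "x \<in> W"
    then obtain k where "k < length xs" "x = xs ! k" using xs by (auto simp: in_set_conv_nth)
    then show "x \<in> range ?w" by (intro image_eqI[of _ _ k]) auto
  qed
  moreover have "range ?w \<subseteq> C" using assms xs nth_mem by fastforce
  ultimately show thesis using that by blast
qed

text \<open>Flatness for a map \<open>g\<close> from the free module \<open>F\<close> on \<open>\<nat>\<close> to a module of arbitrary type. The equation
\<open>(id \<otimes> g) Y = 0\<close> holds over a countably generated submodule \<open>M\<^sub>0\<close> that contains the image of \<open>g\<close>, and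
\<open>M\<^sub>0\<close> is isomorphic to \<open>F/ker q\<close> for some \<open>q\<close>. The induced injection \<open>F/K \<rightarrow> F/ker q\<close> is one
between test modules.\<close>

lemma free_nat_kernel:
  assumes "flat_module R A" "module R A" "module R M" "g \<in> mod_hom R (free_nat_module R) M"
    and "Y \<in> carrier (tensor R A (free_nat_module R))"
    and "tensor_map R A M (\<lambda>a. a) g Y = \<zero>\<^bsub>tensor R A M\<^esub>"
    and "K = {v \<in> carrier (free_nat_module R). g v = \<zero>\<^bsub>M\<^esub>}"
  shows "tensor_map R A (quot_module (free_nat_module R) K) (\<lambda>a. a) (\<lambda>v. K +>\<^bsub>free_nat_module R\<^esub> v) Y =
    \<zero>\<^bsub>tensor R A (quot_module (free_nat_module R) K)\<^esub>"
proof -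
  let ?F = "free_nat_module R"
  note R = module_cring[OF assms(2)]
  note F = module_free_module[OF R, of "UNIV :: nat set"]
  interpret M: module R M by fact
  note e = free_basis_closed[OF R, of _ "UNIV :: nat set", simplified]
  obtain W where W: "finite W" "W \<subseteq> carrier M"
    "\<And>M0. \<lbrakk>submodule M0 R M; W \<subseteq> M0; g ` carrier ?F \<subseteq> M0\<rbrakk> \<Longrightarrow>
      tensor_map R A (M\<lparr>carrier := M0\<rparr>) (\<lambda>a. a) g Y = \<zero>\<^bsub>tensor R A (M\<lparr>carrier := M0\<rparr>)\<^esub>"
    using tensor_zero_local[OF assms(2) F assms(3-6)] by blast
  obtain w :: "nat \<Rightarrow> _" where w: "range w \<subseteq> carrier M" "W \<subseteq> range w"
    using finite_enumeration[OF W(1,2) M.M.zero_closed] by blast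
  \<comment> \<open>Even indices make the image of \<open>q\<close> contain that of \<open>g\<close>, odd ones make it contain \<open>W\<close>.\<close>
  define c where "c k = (if even k then g (free_basis R (k div 2)) else w (k div 2))" for k
  have c: "c \<in> UNIV \<rightarrow> carrier M"
    using w(1) mod_hom_closed[OF assms(4) e] by (auto simp: c_def image_subset_iff)
  define q where "q = free_lift R M c"
  have q: "q \<in> mod_hom R ?F M" unfolding q_def by (rule free_lift_hom[OF assms(3) c])
  have qe: "q (free_basis R k) = c k" for k
    unfolding q_def using free_lift_basis[OF assms(3) c] by simp
  define M0 where "M0 = q ` carrier ?F"
  have M0: "submodule M0 R M" unfolding M0_def by (rule image_submodule[OF F assms(3) q])
  have cM0: "c k \<in> M0" for k unfolding M0_def qe[symmetric] using e by blast
  have WM0: "W \<subseteq> M0"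
  proof
    fix x assume "x \<in> W"
    then obtain k where "x = w k" using w(2) by auto
    then show "x \<in> M0" using cM0[of "2 * k + 1"] by (simp add: c_def)
  qed
  have gM0: "g ` carrier ?F \<subseteq> M0"
  proof (rule image_subsetI)
    fix v assume v: "v \<in> carrier ?F"
    have "v \<in> {v \<in> carrier ?F. g v \<in> M0}"
    proof (rule free_module_spanned[OF R preimage_submodule[OF F assms(3,4) M0] _ v])
      show "free_basis R k \<in> {v \<in> carrier ?F. g v \<in> M0}" for k
        using e[of k] cM0[of "2 * k"] by (simp add: c_def)
    qed
    then show "g v \<in> M0" by simp
  qed
  let ?N = "M\<lparr>carrier := M0\<rparr>"
  have N: "module R ?N" by (rule submodule.submodule_is_module[OF M0 assms(3)])
  have gN: "g \<in> mod_hom R ?F ?N" using assms(4) gM0 by (auto simp: mod_hom_def)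
  have qN: "q \<in> mod_hom R ?F ?N" using q by (auto simp: mod_hom_def M0_def)
  let ?Kq = "{v \<in> carrier ?F. q v = \<zero>\<^bsub>M\<^esub>}"
  have K: "submodule K R ?F" unfolding assms(7) by (rule kernel_submodule[OF F assms(3,4)])
  have Kq: "submodule ?Kq R ?F" by (rule kernel_submodule[OF F assms(3) q])
  let ?G = "quot_module ?F K"
  let ?Q = "quot_module ?F ?Kq"
  note G = module_quot_module[OF F K] and Q = module_quot_module[OF F Kq]
  \<comment> \<open>\<open>s\<close> is the inverse of the isomorphism from \<open>F/ker q\<close> to \<open>M\<^sub>0\<close>.\<close>
  obtain s where s: "s \<in> mod_hom R ?N ?Q" "\<And>v. v \<in> carrier ?F \<Longrightarrow> s (q v) = ?Kq +>\<^bsub>?F\<^esub> v"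
    by (rule surjection_factor[OF F N Q qN coset_hom[OF F Kq]])
      (auto simp: M0_def coset_eq_zero_iff[OF F Kq])
  obtain t where t: "t \<in> mod_hom R ?G ?Q" "\<And>v. v \<in> carrier ?F \<Longrightarrow> t (K +>\<^bsub>?F\<^esub> v) = s (g v)"
    by (rule quot_module_factor[OF F K Q mod_hom_comp[OF gN s(1)]])
      (auto simp: assms(7) mod_hom_zero[OF N Q s(1), simplified])
  have "inj_on t (carrier ?G)"
  proof (rule mod_hom_injI[OF G Q t(1)])
    fix X assume X: "X \<in> carrier ?G" "t X = \<zero>\<^bsub>?Q\<^esub>"
    obtain v where v: "v \<in> carrier ?F" "X = K +>\<^bsub>?F\<^esub> v" using X(1) by (auto simp: carrier_quot_module)
    obtain u where u: "u \<in> carrier ?F" "g v = q u" using gM0 v(1) by (auto simp: M0_def)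
    have "?Kq +>\<^bsub>?F\<^esub> u = \<zero>\<^bsub>?Q\<^esub>" using X(2) v t(2) s(2)[OF u(1)] u(2) by simp
    then have "g v = \<zero>\<^bsub>M\<^esub>" using coset_eq_zero_iff[OF F Kq u(1)] u(2) by simp
    then show "X = \<zero>\<^bsub>?G\<^esub>" using coset_eq_zero_iff[OF F K v(1)] v by (simp add: assms(7))
  qed
  then have inj: "inj_on (tensor_map R A ?Q (\<lambda>a. a) t) (carrier (tensor R A ?G))"
    using assms(1) G Q t(1) unfolding flat_module_def by blast
  note AG = module_tensor[OF assms(2) G] and AQ = module_tensor[OF assms(2) Q]
    and AN = module_tensor[OF assms(2) N]
  note coset = tensor_map_right_hom[OF assms(2) F G coset_hom[OF F K]]
    and tmt = tensor_map_right_hom[OF assms(2) G Q t(1)]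
    and tms = tensor_map_right_hom[OF assms(2) N Q s(1)]
  interpret AG: module R "tensor R A ?G" by (rule AG)
  have "tensor_map R A ?Q (\<lambda>a. a) t (tensor_map R A ?G (\<lambda>a. a) (\<lambda>v. K +>\<^bsub>?F\<^esub> v) Y) =
      tensor_map R A ?Q (\<lambda>a. a) (\<lambda>v. s (g v)) Y"
    by (rule tensor_map_right_comp[OF assms(2) F G Q coset_hom[OF F K] t(1) mod_hom_comp[OF gN s(1)] t(2) assms(5)])
  also have "\<dots> = tensor_map R A ?Q (\<lambda>a. a) s (tensor_map R A ?N (\<lambda>a. a) g Y)"
    by (rule tensor_map_right_comp[OF assms(2) F N Q gN s(1) mod_hom_comp[OF gN s(1)] refl assms(5), symmetric])
  also have "\<dots> = \<zero>\<^bsub>tensor R A ?Q\<^esub>"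
    unfolding W(3)[OF M0 WM0 gM0] by (rule mod_hom_zero[OF AN AQ tms])
  also have "\<dots> = tensor_map R A ?Q (\<lambda>a. a) t \<zero>\<^bsub>tensor R A ?G\<^esub>"
    by (rule mod_hom_zero[OF AG AQ tmt, symmetric])
  finally show ?thesis
    by (rule inj_onD[OF inj _ mod_hom_closed[OF coset assms(5)] AG.M.zero_closed])
qed

text \<open>A tensor involves finitely many elements of \<open>M\<close>, which are the images of basis vectors of the free
module on \<open>\<nat>\<close>. So statements about single tensors can be pulled back to that module.\<close>

lemma tensor_from_free_nat:
  assumes "module R A" "module R M" "X \<in> carrier (tensor R A M)"
  obtains p Y where "p \<in> mod_hom R (free_nat_module R) M" "Y \<in> carrier (tensor R A (free_nat_module R))"
    "tensor_map R A M (\<lambda>a. a) p Y = X"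
proof -
  let ?F = "free_nat_module R"
  let ?S = "carrier A \<times> carrier M"
  interpret M: module R M by fact
  note R = module_cring[OF assms(1)]
  note F = module_free_module[OF R, of "UNIV :: nat set"]
  note e = free_basis_closed[OF R, of _ "UNIV :: nat set", simplified]
  note AF = module_tensor[OF assms(1) F] and AM = module_tensor[OF assms(1,2)]
  obtain x where x: "x \<in> carrier (free_module R ?S)" "X = tensor_ker R A M +>\<^bsub>free_module R ?S\<^esub> x"
    using assms(3) by (auto simp: carrier_tensor)
  let ?T = "{s. x s \<noteq> \<zero>\<^bsub>R\<^esub>}"
  note T = free_support[OF x(1)]
  have W: "finite (snd ` ?T)" "snd ` ?T \<subseteq> carrier M" using T by auto
  obtain c :: "nat \<Rightarrow> _" where c: "range c \<subseteq> carrier M" "snd ` ?T \<subseteq> range c"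
    using finite_enumeration[OF W M.M.zero_closed] by blast
  have cP: "c \<in> UNIV \<rightarrow> carrier M" using c(1) by auto
  define p where "p = free_lift R M c"
  have p: "p \<in> mod_hom R ?F M" unfolding p_def by (rule free_lift_hom[OF assms(2) cP])
  have pe: "p (free_basis R k) = c k" for k
    unfolding p_def using free_lift_basis[OF assms(2) cP] by simp
  note tmp = tensor_map_right_hom[OF assms(1) F assms(2) p]
  let ?U = "tensor_map R A M (\<lambda>a. a) p ` carrier (tensor R A ?F)"
  have U: "submodule ?U R (tensor R A M)" by (rule image_submodule[OF AF AM tmp])
  have xT: "x \<in> carrier (free_module R ?T)" using x(1) T by (auto simp: free_module_def)
  note coset = mod_hom_comp[OF free_module_mono[OF R T(2)] tensor_coset_hom[OF assms(1,2)]]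
  \<comment> \<open>Only the basis vectors in the support of \<open>x\<close> are known to have their image in \<open>?U\<close>, so \<open>x\<close> is
    regarded as an element of the free module on its support.\<close>
  have "x \<in> {x \<in> carrier (free_module R ?T). tensor_ker R A M +>\<^bsub>free_module R ?S\<^esub> x \<in> ?U}"
  proof (rule free_module_spanned[OF R preimage_submodule[OF module_free_module[OF R] AM coset U] _ xT])
    fix s assume s: "s \<in> ?T"
    obtain a m where am: "s = (a, m)" by (cases s)
    obtain k where k: "m = c k" using c(2) s am by (force simp: image_subset_iff)
    have a: "a \<in> carrier A" using T(2) s am by auto
    have "tensor_ker R A M +>\<^bsub>free_module R ?S\<^esub> free_basis R s = tens R A M a m"
      by (simp add: tens_def am)
    also have "\<dots> = tensor_map R A M (\<lambda>a. a) p (tens R A ?F a (free_basis R k))"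
      by (simp add: tensor_map_tens[OF assms(1) F assms(1,2) mod_hom_id p a e] pe k)
    also have "\<dots> \<in> ?U" using tens_closed[OF assms(1) F a e] by blast
    finally show "free_basis R s \<in> {x \<in> carrier (free_module R ?T). tensor_ker R A M +>\<^bsub>free_module R ?S\<^esub> x \<in> ?U}"
      using free_basis_closed[OF R s] by simp
  qed
  then have "X \<in> ?U" using x(2) by simp
  then show thesis using that[OF p] by blast
qed

text \<open>Flatness in the form in which it is used: \<open>ker (id \<otimes> f)\<close> is the image of \<open>A \<otimes> ker f\<close>, the image being
described as the kernel of \<open>A \<otimes> N \<rightarrow> A \<otimes> N/ker f\<close>. The statement is pulled back along
\<open>p : F \<rightarrow> N\<close> to the free module on \<open>\<nat>\<close> and pushed forward again along \<open>F/ker (f p) \<rightarrow> N/ker f\<close>.\<close>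

lemma flat_kernel:
  assumes "flat_module R A" "module R A" "module R N" "module R M" "f \<in> mod_hom R N M"
    and "X \<in> carrier (tensor R A N)"
    and "tensor_map R A M (\<lambda>a. a) f X = \<zero>\<^bsub>tensor R A M\<^esub>"
    and "K = {v \<in> carrier N. f v = \<zero>\<^bsub>M\<^esub>}"
  shows "tensor_map R A (quot_module N K) (\<lambda>a. a) (\<lambda>v. K +>\<^bsub>N\<^esub> v) X = \<zero>\<^bsub>tensor R A (quot_module N K)\<^esub>"
proof -
  let ?F = "free_nat_module R"
  note R = module_cring[OF assms(2)]
  note F = module_free_module[OF R, of "UNIV :: nat set"]
  obtain p Y where p: "p \<in> mod_hom R ?F N" and Y: "Y \<in> carrier (tensor R A ?F)"
    and pY: "tensor_map R A N (\<lambda>a. a) p Y = X"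
    by (rule tensor_from_free_nat[OF assms(2,3,6)])
  let ?L = "{v \<in> carrier ?F. f (p v) = \<zero>\<^bsub>M\<^esub>}"
  note fp = mod_hom_comp[OF p assms(5)]
  have K: "submodule K R N" unfolding assms(8) by (rule kernel_submodule[OF assms(3-5)])
  have L: "submodule ?L R ?F" by (rule kernel_submodule[OF F assms(4) fp])
  note QK = module_quot_module[OF assms(3) K] and QL = module_quot_module[OF F L]
  note cK = coset_hom[OF assms(3) K] and cL = coset_hom[OF F L]
  have "tensor_map R A M (\<lambda>a. a) (\<lambda>v. f (p v)) Y = \<zero>\<^bsub>tensor R A M\<^esub>"
    using tensor_map_right_comp[OF assms(2) F assms(3,4) p assms(5) fp refl Y] pY assms(7) by simp
  then have Y0: "tensor_map R A (quot_module ?F ?L) (\<lambda>a. a) (\<lambda>v. ?L +>\<^bsub>?F\<^esub> v) Y =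
      \<zero>\<^bsub>tensor R A (quot_module ?F ?L)\<^esub>"
    by (rule free_nat_kernel[OF assms(1,2,4) fp Y _ refl])
  note pK = mod_hom_comp[OF p cK]
  have ker: "K +>\<^bsub>N\<^esub> p v = \<zero>\<^bsub>quot_module N K\<^esub>" if "v \<in> ?L" for v
    using that coset_eq_zero_iff[OF assms(3) K, of "p v"] mod_hom_closed[OF p] assms(8) by blast
  obtain t where t: "t \<in> mod_hom R (quot_module ?F ?L) (quot_module N K)"
    "\<And>v. v \<in> carrier ?F \<Longrightarrow> t (?L +>\<^bsub>?F\<^esub> v) = K +>\<^bsub>N\<^esub> p v"
    using quot_module_factor[OF F L QK pK ker] by blast
  have "tensor_map R A (quot_module N K) (\<lambda>a. a) (\<lambda>v. K +>\<^bsub>N\<^esub> v) X =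
      tensor_map R A (quot_module N K) (\<lambda>a. a) (\<lambda>v. K +>\<^bsub>N\<^esub> p v) Y"
    unfolding pY[symmetric] by (rule tensor_map_right_comp[OF assms(2) F assms(3) QK p cK pK refl Y])
  also have "\<dots> = tensor_map R A (quot_module N K) (\<lambda>a. a) t
      (tensor_map R A (quot_module ?F ?L) (\<lambda>a. a) (\<lambda>v. ?L +>\<^bsub>?F\<^esub> v) Y)"
    by (rule tensor_map_right_comp[OF assms(2) F QL QK cL t(1) pK t(2) Y, symmetric])
  also have "\<dots> = \<zero>\<^bsub>tensor R A (quot_module N K)\<^esub>"
    unfolding Y0
    by (rule mod_hom_zero[OF module_tensor[OF assms(2) QL] module_tensor[OF assms(2) QK]
          tensor_map_right_hom[OF assms(2) QL QK t(1)]])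
  finally show ?thesis .
qed

text \<open>For a flat Mittag-Leffler module \<open>A\<close>, the functor \<open>A \<otimes> _\<close> commutes with arbitrary intersections of
submodules: \<open>N/D\<close> embeds into the product of the \<open>N/K\<close>, which flatness carries over to the tensor
product, and the Mittag-Leffler property allows to test for zero in each factor. After pulling back to
the free module \<open>F\<close> on \<open>\<nat>\<close>, the factors are quotients \<open>F/l\<close>, and the submodules \<open>l\<close> themselves
serve as the indices of the family.\<close>

lemma flat_mittag_leffler_Inter:
  assumes "flat_module R A" "mittag_leffler R A" "module R A" "module R N"
    and "\<And>K. K \<in> \<K> \<Longrightarrow> submodule K R N"
    and "X \<in> carrier (tensor R A N)"
    and "\<And>K. K \<in> \<K> \<Longrightarrow>
      tensor_map R A (quot_module N K) (\<lambda>a. a) (\<lambda>v. K +>\<^bsub>N\<^esub> v) X = \<zero>\<^bsub>tensor R A (quot_module N K)\<^esub>"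
    and "D = {v \<in> carrier N. \<forall>K\<in>\<K>. v \<in> K}"
  shows "tensor_map R A (quot_module N D) (\<lambda>a. a) (\<lambda>v. D +>\<^bsub>N\<^esub> v) X = \<zero>\<^bsub>tensor R A (quot_module N D)\<^esub>"
proof -
  let ?F = "free_nat_module R"
  note R = module_cring[OF assms(3)]
  note F = module_free_module[OF R, of "UNIV :: nat set"]
  interpret N: module R N by fact
  obtain p Y where p: "p \<in> mod_hom R ?F N" and Y: "Y \<in> carrier (tensor R A ?F)"
    and pY: "tensor_map R A N (\<lambda>a. a) p Y = X"
    by (rule tensor_from_free_nat[OF assms(3,4,6)])
  define L where "L = (\<lambda>K. {v \<in> carrier ?F. p v \<in> K}) ` \<K>"
  let ?Q = "\<lambda>l. quot_module ?F l"
  have L: "submodule l R ?F" if "l \<in> L" for l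
    using that preimage_submodule[OF F assms(4) p assms(5)] by (auto simp: L_def)
  note Q = module_quot_module[OF F L]
  have Y0: "tensor_map R A (?Q l) (\<lambda>a. a) (\<lambda>v. l +>\<^bsub>?F\<^esub> v) Y = \<zero>\<^bsub>tensor R A (?Q l)\<^esub>" if l: "l \<in> L" for l
  proof -
    obtain K where K: "K \<in> \<K>" "l = {v \<in> carrier ?F. p v \<in> K}" using l by (auto simp: L_def)
    note sub = assms(5)[OF K(1)]
    note QK = module_quot_module[OF assms(4) sub] and cK = coset_hom[OF assms(4) sub]
    note pK = mod_hom_comp[OF p cK]
    have "tensor_map R A (quot_module N K) (\<lambda>a. a) (\<lambda>v. K +>\<^bsub>N\<^esub> p v) Y = \<zero>\<^bsub>tensor R A (quot_module N K)\<^esub>"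
      using tensor_map_right_comp[OF assms(3) F assms(4) QK p cK pK refl Y] pY assms(7)[OF K(1)] by simp
    moreover have "l = {v \<in> carrier ?F. K +>\<^bsub>N\<^esub> p v = \<zero>\<^bsub>quot_module N K\<^esub>}"
      unfolding K(2) using coset_eq_zero_iff[OF assms(4) sub mod_hom_closed[OF p]] by blast
    ultimately show ?thesis
      by (rule free_nat_kernel[OF assms(1,3) QK pK Y])
  qed
  let ?P = "prod_module L ?Q"
  have P: "module R ?P" by (rule module_prod_module[OF R Q])
  define c where "c v = (\<lambda>l\<in>L. l +>\<^bsub>?F\<^esub> v)" for v
  have c: "c \<in> mod_hom R ?F ?P"
    by (rule mod_homI)
      (auto simp: c_def prod_module_def mod_homD[OF coset_hom[OF F L]] intro!: restrict_ext)
  have ev: "(\<lambda>f. f l) \<in> mod_hom R ?P (?Q l)" if "l \<in> L" for l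
    using that by (intro mod_homI) (auto simp: prod_module_def)
  note AP = module_tensor[OF assms(3) P]
  interpret AP: module R "tensor R A ?P" by (rule AP)
  note tmc = tensor_map_right_hom[OF assms(3) F P c]
  \<comment> \<open>The Mittag-Leffler property: all components vanish, hence the element of \<open>A \<otimes> \<Prod>F/l\<close> does.\<close>
  have cY: "tensor_map R A ?P (\<lambda>a. a) c Y = \<zero>\<^bsub>tensor R A ?P\<^esub>"
  proof (rule inj_onD)
    show "inj_on (\<lambda>X. \<lambda>l\<in>L. tensor_map R A (?Q l) (\<lambda>m. m) (\<lambda>f. f l) X) (carrier (tensor R A ?P))"
      using assms(2) Q unfolding mittag_leffler_def by blast
    show "(\<lambda>l\<in>L. tensor_map R A (?Q l) (\<lambda>m. m) (\<lambda>f. f l) (tensor_map R A ?P (\<lambda>a. a) c Y)) =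
        (\<lambda>l\<in>L. tensor_map R A (?Q l) (\<lambda>m. m) (\<lambda>f. f l) \<zero>\<^bsub>tensor R A ?P\<^esub>)"
    proof (rule restrict_ext)
      fix l assume l: "l \<in> L"
      have "tensor_map R A (?Q l) (\<lambda>m. m) (\<lambda>f. f l) (tensor_map R A ?P (\<lambda>a. a) c Y) =
          tensor_map R A (?Q l) (\<lambda>a. a) (\<lambda>v. l +>\<^bsub>?F\<^esub> v) Y"
        by (rule tensor_map_right_comp[OF assms(3) F P Q[OF l] c ev[OF l] coset_hom[OF F L[OF l]] _ Y])
          (simp add: c_def l)
      then show "tensor_map R A (?Q l) (\<lambda>m. m) (\<lambda>f. f l) (tensor_map R A ?P (\<lambda>a. a) c Y) =
          tensor_map R A (?Q l) (\<lambda>m. m) (\<lambda>f. f l) \<zero>\<^bsub>tensor R A ?P\<^esub>"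
        using Y0[OF l] mod_hom_zero[OF AP module_tensor[OF assms(3) Q[OF l]]
            tensor_map_right_hom[OF assms(3) P Q[OF l] ev[OF l]]] by simp
    qed
  qed (use mod_hom_closed[OF tmc Y] in simp_all)
  let ?C = "{v \<in> carrier ?F. c v = \<zero>\<^bsub>?P\<^esub>}"
  have C: "submodule ?C R ?F" by (rule kernel_submodule[OF F P c])
  have D: "submodule D R N"
    using submodule_zero[OF assms(4) assms(5)] module.submoduleE(4,5)[OF assms(4) assms(5)]
    by (intro submoduleI'[OF assms(4)]) (auto simp: assms(8))
  note QC = module_quot_module[OF F C] and QD = module_quot_module[OF assms(4) D]
  note cC = coset_hom[OF F C] and cD = coset_hom[OF assms(4) D]
  note pD = mod_hom_comp[OF p cD]
  \<comment> \<open>Flatness for \<open>c : F \<rightarrow> \<Prod>F/l\<close>, whose kernel is the preimage of \<open>D\<close>.\<close>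
  have Y1: "tensor_map R A (?Q ?C) (\<lambda>a. a) (\<lambda>v. ?C +>\<^bsub>?F\<^esub> v) Y = \<zero>\<^bsub>tensor R A (?Q ?C)\<^esub>"
    by (rule free_nat_kernel[OF assms(1,3) P c Y cY refl])
  have kerC: "p v \<in> D" if v: "v \<in> ?C" for v
  proof -
    have "v \<in> l" if l: "l \<in> L" for l
    proof -
      have "c v l = \<zero>\<^bsub>?P\<^esub> l" using v by simp
      then have "l +>\<^bsub>?F\<^esub> v = \<zero>\<^bsub>?Q l\<^esub>" using l by (simp add: c_def prod_module_def)
      then show ?thesis using coset_eq_zero_iff[OF F L[OF l]] v by simp
    qed
    then show ?thesis using v mod_hom_closed[OF p] by (auto simp: L_def assms(8))
  qed
  have kerD: "D +>\<^bsub>N\<^esub> p v = \<zero>\<^bsub>quot_module N D\<^esub>" if "v \<in> ?C" for v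
    using kerC[OF that] that coset_eq_zero_iff[OF assms(4) D, of "p v"] mod_hom_closed[OF p] by blast
  obtain t where t: "t \<in> mod_hom R (?Q ?C) (quot_module N D)"
    "\<And>v. v \<in> carrier ?F \<Longrightarrow> t (?C +>\<^bsub>?F\<^esub> v) = D +>\<^bsub>N\<^esub> p v"
    using quot_module_factor[OF F C QD pD kerD] by blast
  have "tensor_map R A (quot_module N D) (\<lambda>a. a) (\<lambda>v. D +>\<^bsub>N\<^esub> v) X =
      tensor_map R A (quot_module N D) (\<lambda>a. a) (\<lambda>v. D +>\<^bsub>N\<^esub> p v) Y"
    unfolding pY[symmetric] by (rule tensor_map_right_comp[OF assms(3) F assms(4) QD p cD pD refl Y])
  also have "\<dots> = tensor_map R A (quot_module N D) (\<lambda>a. a) t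
      (tensor_map R A (?Q ?C) (\<lambda>a. a) (\<lambda>v. ?C +>\<^bsub>?F\<^esub> v) Y)"
    by (rule tensor_map_right_comp[OF assms(3) F QC QD cC t(1) pD t(2) Y, symmetric])
  also have "\<dots> = \<zero>\<^bsub>tensor R A (quot_module N D)\<^esub>"
    unfolding Y1
    by (rule mod_hom_zero[OF module_tensor[OF assms(3) QC] module_tensor[OF assms(3) QD]
          tensor_map_right_hom[OF assms(3) QC QD t(1)]])
  finally show ?thesis .
qed

section \<open>Multiplication on tensor products\<close>

lemma assoc_algebra_module: "assoc_algebra R A \<Longrightarrow> module R A"
  by (rule assoc_algebra.axioms)

lemma assoc_algebra_mult_hom:
  assumes "assoc_algebra R A" "x \<in> carrier A"
  shows mult_left_hom: "(\<lambda>y. x \<otimes>\<^bsub>A\<^esub> y) \<in> mod_hom R A A"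
    and mult_right_hom: "(\<lambda>y. y \<otimes>\<^bsub>A\<^esub> x) \<in> mod_hom R A A"
proof -
  interpret A: assoc_algebra R A by fact
  show "(\<lambda>y. x \<otimes>\<^bsub>A\<^esub> y) \<in> mod_hom R A A"
    by (rule mod_homI) (auto simp: assms(2) A.r_distr A.smult_mult_right)
  show "(\<lambda>y. y \<otimes>\<^bsub>A\<^esub> x) \<in> mod_hom R A A"
    by (rule mod_homI) (auto simp: assms(2) A.l_distr A.smult_mult_left)
qed

lemma mod_hom_tensor_alg [simp]: "mod_hom R M (tensor_alg R A B) = mod_hom R M (tensor R A B)"
  by (simp add: mod_hom_def tensor_alg_def)

lemma one_tensor_alg: "\<one>\<^bsub>tensor_alg R A B\<^esub> = tens R A B \<one>\<^bsub>A\<^esub> \<one>\<^bsub>B\<^esub>"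
  by (simp add: tensor_alg_def)

context
  fixes R A B
  assumes alg: "assoc_algebra R A" "assoc_algebra R B"
begin

lemmas algebra_modules = assoc_algebra_module[OF alg(1)] assoc_algebra_module[OF alg(2)]

lemma tensor_alg_mult:
  "X \<otimes>\<^bsub>tensor_alg R A B\<^esub> Y = tensor_lift R (tensor R A B)
    (\<lambda>(a, b). tensor_map R A B (\<lambda>a'. a \<otimes>\<^bsub>A\<^esub> a') (\<lambda>b'. b \<otimes>\<^bsub>B\<^esub> b') Y) X"
  by (simp add: tensor_alg_def tensor_map_def)

lemma tensor_alg_mult_bilinear:
  assumes Y: "Y \<in> carrier (tensor R A B)"
  shows "bilinear R A B (tensor R A B) (\<lambda>(a, b). tensor_map R A B (\<lambda>a'. a \<otimes>\<^bsub>A\<^esub> a') (\<lambda>b'. b \<otimes>\<^bsub>B\<^esub> b') Y)"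
  unfolding bilinear_def split_conv
proof (intro conjI ballI)
  note AB = module_tensor[OF algebra_modules]
  note inner = bilinear_tens_map[OF algebra_modules mult_left_hom[OF alg(1)] mult_left_hom[OF alg(2)]]
  fix a assume a: "a \<in> carrier A"
  show "(\<lambda>b. tensor_map R A B (\<lambda>a'. a \<otimes>\<^bsub>A\<^esub> a') (\<lambda>b'. b \<otimes>\<^bsub>B\<^esub> b') Y) \<in> mod_hom R B (tensor R A B)"
    unfolding tensor_map_def
  proof (rule tensor_lift_param_hom[OF algebra_modules(2) algebra_modules AB inner[OF a] _ Y])
    show "(\<lambda>b. case (x, y) of (x, y) \<Rightarrow> tens R A B (a \<otimes>\<^bsub>A\<^esub> x) (b \<otimes>\<^bsub>B\<^esub> y)) \<in> mod_hom R B (tensor R A B)"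
      if "x \<in> carrier A" "y \<in> carrier B" for x y
      using mod_hom_comp[OF mult_right_hom[OF alg(2) that(2)]
          tens_hom_right[OF algebra_modules mod_hom_closed[OF mult_left_hom[OF alg(1) a] that(1)]]] by simp
  qed
next
  note AB = module_tensor[OF algebra_modules]
  note inner = bilinear_tens_map[OF algebra_modules mult_left_hom[OF alg(1)] mult_left_hom[OF alg(2)]]
  fix b assume b: "b \<in> carrier B"
  show "(\<lambda>a. tensor_map R A B (\<lambda>a'. a \<otimes>\<^bsub>A\<^esub> a') (\<lambda>b'. b \<otimes>\<^bsub>B\<^esub> b') Y) \<in> mod_hom R A (tensor R A B)"
    unfolding tensor_map_def
  proof (rule tensor_lift_param_hom[OF algebra_modules(1) algebra_modules AB inner[OF _ b] _ Y])
    show "(\<lambda>a. case (x, y) of (x, y) \<Rightarrow> tens R A B (a \<otimes>\<^bsub>A\<^esub> x) (b \<otimes>\<^bsub>B\<^esub> y)) \<in> mod_hom R A (tensor R A B)"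
      if "x \<in> carrier A" "y \<in> carrier B" for x y
      using mod_hom_comp[OF mult_right_hom[OF alg(1) that(1)]
          tens_hom_left[OF algebra_modules mod_hom_closed[OF mult_left_hom[OF alg(2) b] that(2)]]] by simp
  qed
qed

lemma tensor_alg_mult_hom_left:
  assumes "Y \<in> carrier (tensor R A B)"
  shows "(\<lambda>X. X \<otimes>\<^bsub>tensor_alg R A B\<^esub> Y) \<in> mod_hom R (tensor R A B) (tensor R A B)"
  unfolding tensor_alg_mult
  by (rule tensor_lift_hom[OF algebra_modules module_tensor[OF algebra_modules] tensor_alg_mult_bilinear[OF assms]])

lemma tensor_alg_mult_tens_left:
  assumes "a \<in> carrier A" "b \<in> carrier B" "Y \<in> carrier (tensor R A B)"
  shows "tens R A B a b \<otimes>\<^bsub>tensor_alg R A B\<^esub> Y =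
    tensor_map R A B (\<lambda>a'. a \<otimes>\<^bsub>A\<^esub> a') (\<lambda>b'. b \<otimes>\<^bsub>B\<^esub> b') Y"
  unfolding tensor_alg_mult
  by (simp add: tensor_lift_tens[OF algebra_modules module_tensor[OF algebra_modules] tensor_alg_mult_bilinear[OF assms(3)] assms(1,2)])

lemma tensor_alg_mult_hom_right:
  assumes "X \<in> carrier (tensor R A B)"
  shows "(\<lambda>Y. X \<otimes>\<^bsub>tensor_alg R A B\<^esub> Y) \<in> mod_hom R (tensor R A B) (tensor R A B)"
  unfolding tensor_alg_mult
proof (rule tensor_lift_param_hom[OF module_tensor[OF algebra_modules] algebra_modules module_tensor[OF algebra_modules] tensor_alg_mult_bilinear _ assms])
  fix a b assume "a \<in> carrier A" "b \<in> carrier B"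
  then show "(\<lambda>Y. case (a, b) of (a, b) \<Rightarrow> tensor_map R A B (\<lambda>a'. a \<otimes>\<^bsub>A\<^esub> a') (\<lambda>b'. b \<otimes>\<^bsub>B\<^esub> b') Y)
      \<in> mod_hom R (tensor R A B) (tensor R A B)"
    using tensor_map_hom[OF algebra_modules algebra_modules mult_left_hom[OF alg(1)] mult_left_hom[OF alg(2)]] by simp
qed

lemma tensor_alg_mult_tens_right:
  assumes "a \<in> carrier A" "b \<in> carrier B" "X \<in> carrier (tensor R A B)"
  shows "X \<otimes>\<^bsub>tensor_alg R A B\<^esub> tens R A B a b =
    tensor_map R A B (\<lambda>x. x \<otimes>\<^bsub>A\<^esub> a) (\<lambda>y. y \<otimes>\<^bsub>B\<^esub> b) X"
proof (rule tensor_hom_eqI[OF algebra_modules module_tensor[OF algebra_modules]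
      tensor_alg_mult_hom_left[OF tens_closed[OF algebra_modules assms(1,2)]]
      tensor_map_hom[OF algebra_modules algebra_modules mult_right_hom[OF alg(1) assms(1)] mult_right_hom[OF alg(2) assms(2)]] _ assms(3)])
  fix x y assume xy: "x \<in> carrier A" "y \<in> carrier B"
  show "tens R A B x y \<otimes>\<^bsub>tensor_alg R A B\<^esub> tens R A B a b =
      tensor_map R A B (\<lambda>x. x \<otimes>\<^bsub>A\<^esub> a) (\<lambda>y. y \<otimes>\<^bsub>B\<^esub> b) (tens R A B x y)"
    unfolding tensor_alg_mult_tens_left[OF xy tens_closed[OF algebra_modules assms(1,2)]]
      tensor_map_tens[OF algebra_modules algebra_modules mult_left_hom[OF alg(1) xy(1)] mult_left_hom[OF alg(2) xy(2)] assms(1,2)]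
      tensor_map_tens[OF algebra_modules algebra_modules mult_right_hom[OF alg(1) assms(1)] mult_right_hom[OF alg(2) assms(2)] xy] ..
qed

text \<open>If right multiplication by every element descends along \<open>f\<close> and along \<open>g\<close>, then the kernel of
\<open>f \<otimes> g\<close> is a right ideal. It suffices to multiply by pure tensors \<open>a \<otimes> b\<close>, and right multiplication by
such a tensor is \<open>(x \<mapsto> xa) \<otimes> (y \<mapsto> yb)\<close>, which descends to the target.\<close>

lemma tensor_map_mult_cong:
  assumes "module R P" "module R Q" "f \<in> mod_hom R A P" "g \<in> mod_hom R B Q"
    and f: "\<And>y. y \<in> carrier A \<Longrightarrow> \<exists>\<rho>\<in>mod_hom R P P. \<forall>x\<in>carrier A. \<rho> (f x) = f (x \<otimes>\<^bsub>A\<^esub> y)"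
    and g: "\<And>y. y \<in> carrier B \<Longrightarrow> \<exists>\<rho>\<in>mod_hom R Q Q. \<forall>x\<in>carrier B. \<rho> (g x) = g (x \<otimes>\<^bsub>B\<^esub> y)"
    and X: "X \<in> carrier (tensor R A B)" "X' \<in> carrier (tensor R A B)"
    and Y: "Y \<in> carrier (tensor R A B)"
    and eq: "tensor_map R P Q f g X = tensor_map R P Q f g X'"
  shows "tensor_map R P Q f g (X \<otimes>\<^bsub>tensor_alg R A B\<^esub> Y) = tensor_map R P Q f g (X' \<otimes>\<^bsub>tensor_alg R A B\<^esub> Y)"
proof (rule tensor_hom_eqI[OF algebra_modules module_tensor[OF assms(1,2)] _ _ _ Y])
  note fg = tensor_map_hom[OF algebra_modules assms(1-4)]
  show "(\<lambda>Y. tensor_map R P Q f g (X \<otimes>\<^bsub>tensor_alg R A B\<^esub> Y)) \<in> mod_hom R (tensor R A B) (tensor R P Q)"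
    by (rule mod_hom_comp[OF tensor_alg_mult_hom_right[OF X(1)] fg])
  show "(\<lambda>Y. tensor_map R P Q f g (X' \<otimes>\<^bsub>tensor_alg R A B\<^esub> Y)) \<in> mod_hom R (tensor R A B) (tensor R P Q)"
    by (rule mod_hom_comp[OF tensor_alg_mult_hom_right[OF X(2)] fg])
  fix a b assume a: "a \<in> carrier A" and b: "b \<in> carrier B"
  obtain \<rho> where \<rho>: "\<rho> \<in> mod_hom R P P" "\<And>x. x \<in> carrier A \<Longrightarrow> \<rho> (f x) = f (x \<otimes>\<^bsub>A\<^esub> a)" using f[OF a] by blast
  obtain \<sigma> where \<sigma>: "\<sigma> \<in> mod_hom R Q Q" "\<And>x. x \<in> carrier B \<Longrightarrow> \<sigma> (g x) = g (x \<otimes>\<^bsub>B\<^esub> b)" using g[OF b] by blast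
  note fa = mod_hom_comp[OF mult_right_hom[OF alg(1) a] assms(3)]
    and gb = mod_hom_comp[OF mult_right_hom[OF alg(2) b] assms(4)]
  have "tensor_map R P Q f g (Z \<otimes>\<^bsub>tensor_alg R A B\<^esub> tens R A B a b) = tensor_map R P Q \<rho> \<sigma> (tensor_map R P Q f g Z)"
    if Z: "Z \<in> carrier (tensor R A B)" for Z
  proof -
    have "tensor_map R P Q f g (Z \<otimes>\<^bsub>tensor_alg R A B\<^esub> tens R A B a b) =
        tensor_map R P Q (\<lambda>x. f (x \<otimes>\<^bsub>A\<^esub> a)) (\<lambda>x. g (x \<otimes>\<^bsub>B\<^esub> b)) Z"
      unfolding tensor_alg_mult_tens_right[OF a b Z]
      by (rule tensor_map_comp[OF algebra_modules algebra_modules assms(1,2) mult_right_hom[OF alg(1) a] mult_right_hom[OF alg(2) b]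
            assms(3,4) fa gb refl refl Z])
    also have "\<dots> = tensor_map R P Q \<rho> \<sigma> (tensor_map R P Q f g Z)"
      by (rule tensor_map_comp[OF algebra_modules assms(1,2) assms(1,2) assms(3,4) \<rho>(1) \<sigma>(1) fa gb \<rho>(2) \<sigma>(2) Z, symmetric])
    finally show ?thesis .
  qed
  then show "tensor_map R P Q f g (X \<otimes>\<^bsub>tensor_alg R A B\<^esub> tens R A B a b) =
      tensor_map R P Q f g (X' \<otimes>\<^bsub>tensor_alg R A B\<^esub> tens R A B a b)"
    using X eq by simp
qed

end

lemma right_ideal_quotient_mult:
  assumes "assoc_algebra R H" "submodule I R H" "\<And>i h. \<lbrakk>i \<in> I; h \<in> carrier H\<rbrakk> \<Longrightarrow> i \<otimes>\<^bsub>H\<^esub> h \<in> I"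
    and "y \<in> carrier H"
  shows "\<exists>\<rho>\<in>mod_hom R (quot_module H I) (quot_module H I). \<forall>x\<in>carrier H. \<rho> (I +>\<^bsub>H\<^esub> x) = I +>\<^bsub>H\<^esub> (x \<otimes>\<^bsub>H\<^esub> y)"
proof -
  interpret H: assoc_algebra R H by fact
  note H = assoc_algebra_module[OF assms(1)]
  note sub = module.submoduleE(1)[OF H assms(2)]
  have zero: "I +>\<^bsub>H\<^esub> (x \<otimes>\<^bsub>H\<^esub> y) = \<zero>\<^bsub>quot_module H I\<^esub>" if "x \<in> I" for x
    using that sub assms(3,4) coset_eq_zero_iff[OF H assms(2), of "x \<otimes>\<^bsub>H\<^esub> y"] by auto
  show ?thesis
    using quot_module_factor[OF H assms(2) module_quot_module[OF H assms(2)]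
        mod_hom_comp[OF mult_right_hom[OF assms(1,4)] coset_hom[OF H assms(2)]] zero] by metis
qed

section \<open>Coideals\<close>

lemma module_self_module: "cring R \<Longrightarrow> module R (self_module R)"
proof -
  assume "cring R"
  then interpret R: cring R .
  show ?thesis
    by (rule moduleI[OF \<open>cring R\<close>]; (rule abelian_groupI)?)
      (auto simp: self_module_def R.a_ac R.l_distr R.r_distr R.m_assoc intro: R.l_neg
        bexI[of _ "\<ominus>\<^bsub>R\<^esub> x" for x])
qed

lemma bilinear_scale:
  assumes "module R M" "module R N"
  shows bilinear_scale_left: "e \<in> mod_hom R M (self_module R) \<Longrightarrow> bilinear R M N N (\<lambda>(x, y). e x \<odot>\<^bsub>N\<^esub> y)"
    and bilinear_scale_right: "e' \<in> mod_hom R N (self_module R) \<Longrightarrow> bilinear R M N M (\<lambda>(x, y). e' y \<odot>\<^bsub>M\<^esub> x)"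
proof -
  interpret M: module R M by fact
  interpret N: module R N by fact
  show "bilinear R M N N (\<lambda>(x, y). e x \<odot>\<^bsub>N\<^esub> y)" if e: "e \<in> mod_hom R M (self_module R)"
    using mod_homD[OF e] unfolding bilinear_def split_conv
    by (intro conjI ballI; intro mod_homI)
      (auto simp: self_module_def N.smult_l_distr N.smult_r_distr N.smult_assoc1[symmetric] M.R.m_comm)
  show "bilinear R M N M (\<lambda>(x, y). e' y \<odot>\<^bsub>M\<^esub> x)" if e: "e' \<in> mod_hom R N (self_module R)"
    using mod_homD[OF e] unfolding bilinear_def split_conv
    by (intro conjI ballI; intro mod_homI)
      (auto simp: self_module_def M.smult_l_distr M.smult_r_distr M.smult_assoc1[symmetric] M.R.m_comm)
qed

text \<open>The comultiplication and counit of \<open>C\<close> descend to \<open>C/I\<close>, and each coalgebra axiom for \<open>C/I\<close> is the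
image of the one for \<open>C\<close> under \<open>p\<close> or \<open>p \<otimes> (p \<otimes> p)\<close>, where \<open>p : C \<rightarrow> C/I\<close> is the projection.\<close>

lemma coideal_criterion:
  assumes "coalgebra R C \<Delta> \<epsilon>" "submodule I R C"
    and counit: "\<And>i. i \<in> I \<Longrightarrow> \<epsilon> i = \<zero>\<^bsub>R\<^esub>"
    and comult: "\<And>i. i \<in> I \<Longrightarrow> tensor_map R (quot_module C I) (quot_module C I)
      (\<lambda>c. I +>\<^bsub>C\<^esub> c) (\<lambda>c. I +>\<^bsub>C\<^esub> c) (\<Delta> i) = \<zero>\<^bsub>tensor R (quot_module C I) (quot_module C I)\<^esub>"
  shows "coideal R C \<Delta> \<epsilon> I"
proof -
  interpret C: coalgebra R C \<Delta> \<epsilon> by fact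
  note C = C.module_axioms
  let ?Q = "quot_module C I"
  let ?p = "\<lambda>c. I +>\<^bsub>C\<^esub> c"
  note Q = module_quot_module[OF C assms(2)] and p = coset_hom[OF C assms(2)]
  note S = module_self_module[OF module_cring[OF C]]
  note CC = module_tensor[OF C C] and QQ = module_tensor[OF Q Q]
  note pp = tensor_map_hom[OF C C Q Q p p]
  note ppD = mod_hom_comp[OF C.comult_hom pp]
  obtain \<Delta>' where \<Delta>': "\<Delta>' \<in> mod_hom R ?Q (tensor R ?Q ?Q)"
    "\<And>c. c \<in> carrier C \<Longrightarrow> \<Delta>' (?p c) = tensor_map R ?Q ?Q ?p ?p (\<Delta> c)"
    using quot_module_factor[OF C assms(2) QQ ppD comult] by blast
  have counit': "\<epsilon> i = \<zero>\<^bsub>self_module R\<^esub>" if "i \<in> I" for i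
    using counit[OF that] by (simp add: self_module_def)
  obtain \<epsilon>' where \<epsilon>': "\<epsilon>' \<in> mod_hom R ?Q (self_module R)"
    "\<And>c. c \<in> carrier C \<Longrightarrow> \<epsilon>' (?p c) = \<epsilon> c"
    using quot_module_factor[OF C assms(2) S C.counit_hom counit'] by blast
  note p_closed = mod_hom_closed[OF p] and D_closed = mod_hom_closed[OF C.comult_hom]
  have coassoc: "tensor_assoc R ?Q ?Q ?Q (tensor_map R (tensor R ?Q ?Q) ?Q \<Delta>' (\<lambda>x. x) (\<Delta>' (?p c))) =
      tensor_map R ?Q (tensor R ?Q ?Q) (\<lambda>x. x) \<Delta>' (\<Delta>' (?p c))" if c: "c \<in> carrier C" for c
  proof -
    let ?T = "tensor R ?Q (tensor R ?Q ?Q)"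
    let ?ppp = "tensor_map R ?Q (tensor R ?Q ?Q) ?p (tensor_map R ?Q ?Q ?p ?p)"
    note T = module_tensor[OF Q QQ]
    note ppp = tensor_map_hom[OF C CC Q QQ p pp]
    note L = mod_hom_comp[OF mod_hom_comp[OF pp tensor_map_hom[OF Q Q QQ Q \<Delta>'(1) mod_hom_id]] tensor_assoc_hom[OF Q Q Q]]
    note L' = mod_hom_comp[OF mod_hom_comp[OF tensor_map_hom[OF C C CC C C.comult_hom mod_hom_id] tensor_assoc_hom[OF C C C]] ppp]
    \<comment> \<open>Naturality of \<open>assoc \<circ> (\<Delta> \<otimes> id)\<close> along \<open>p\<close>.\<close>
    have left: "tensor_assoc R ?Q ?Q ?Q (tensor_map R (tensor R ?Q ?Q) ?Q \<Delta>' (\<lambda>x. x) (tensor_map R ?Q ?Q ?p ?p U)) =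
        ?ppp (tensor_assoc R C C C (tensor_map R (tensor R C C) C \<Delta> (\<lambda>x. x) U))"
      if U: "U \<in> carrier (tensor R C C)" for U
    proof (rule tensor_hom_eqI[OF C C T L L' _ U])
      fix y z assume y: "y \<in> carrier C" and z: "z \<in> carrier C"
      note tz = tens_hom_left[OF C C z] and tpz = tens_hom_left[OF Q Q p_closed[OF z]]
      note ptz = mod_hom_comp[OF p tpz]
      have "tensor_assoc R ?Q ?Q ?Q (tensor_map R (tensor R ?Q ?Q) ?Q \<Delta>' (\<lambda>x. x) (tensor_map R ?Q ?Q ?p ?p (tens R C C y z)))
          = tensor_assoc R ?Q ?Q ?Q (tens R (tensor R ?Q ?Q) ?Q (tensor_map R ?Q ?Q ?p ?p (\<Delta> y)) (?p z))"
        by (simp add: tensor_map_tens[OF C C Q Q p p y z] \<Delta>'(2)[OF y]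
            tensor_map_tens[OF Q Q QQ Q \<Delta>'(1) mod_hom_id p_closed[OF y] p_closed[OF z]])
      also have "\<dots> = tensor_map R ?Q (tensor R ?Q ?Q) (\<lambda>x. x) (\<lambda>m. tens R ?Q ?Q m (?p z)) (tensor_map R ?Q ?Q ?p ?p (\<Delta> y))"
        by (rule tensor_assoc_tens_left[OF Q Q Q mod_hom_closed[OF pp D_closed[OF y]] p_closed[OF z]])
      also have "\<dots> = tensor_map R ?Q (tensor R ?Q ?Q) ?p (\<lambda>m. tens R ?Q ?Q (?p m) (?p z)) (\<Delta> y)"
        by (rule tensor_map_comp[OF C C Q Q Q QQ p p mod_hom_id tpz p ptz refl refl D_closed[OF y]])
      also have "\<dots> = ?ppp (tensor_map R C (tensor R C C) (\<lambda>x. x) (\<lambda>m. tens R C C m z) (\<Delta> y))"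
        by (rule tensor_map_comp[OF C C C CC Q QQ mod_hom_id tz p pp p ptz refl _ D_closed[OF y], symmetric])
          (rule tensor_map_tens[OF C C Q Q p p _ z])
      also have "\<dots> = ?ppp (tensor_assoc R C C C (tens R (tensor R C C) C (\<Delta> y) z))"
        by (simp add: tensor_assoc_tens_left[OF C C C D_closed[OF y] z])
      also have "\<dots> = ?ppp (tensor_assoc R C C C (tensor_map R (tensor R C C) C \<Delta> (\<lambda>x. x) (tens R C C y z)))"
        by (simp add: tensor_map_tens[OF C C CC C C.comult_hom mod_hom_id y z])
      finally show "tensor_assoc R ?Q ?Q ?Q (tensor_map R (tensor R ?Q ?Q) ?Q \<Delta>' (\<lambda>x. x) (tensor_map R ?Q ?Q ?p ?p (tens R C C y z))) =
        ?ppp (tensor_assoc R C C C (tensor_map R (tensor R C C) C \<Delta> (\<lambda>x. x) (tens R C C y z)))" .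
    qed
    note U = D_closed[OF c]
    have "tensor_map R ?Q (tensor R ?Q ?Q) (\<lambda>x. x) \<Delta>' (tensor_map R ?Q ?Q ?p ?p (\<Delta> c)) =
        tensor_map R ?Q (tensor R ?Q ?Q) ?p (\<lambda>x. tensor_map R ?Q ?Q ?p ?p (\<Delta> x)) (\<Delta> c)"
      by (rule tensor_map_comp[OF C C Q Q Q QQ p p mod_hom_id \<Delta>'(1) p ppD refl \<Delta>'(2) U])
    also have "\<dots> = ?ppp (tensor_map R C (tensor R C C) (\<lambda>x. x) \<Delta> (\<Delta> c))"
      by (rule tensor_map_comp[OF C C C CC Q QQ mod_hom_id C.comult_hom p pp p ppD refl refl U, symmetric])
    finally show ?thesis
      unfolding \<Delta>'(2)[OF c] left[OF U] C.coassoc[OF c] by simp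
  qed
  have counit_left: "tensor_lift R ?Q (\<lambda>(x, y). \<epsilon>' x \<odot>\<^bsub>?Q\<^esub> y) (\<Delta>' (?p c)) = ?p c" if c: "c \<in> carrier C" for c
  proof -
    note b = bilinear_scale_left[OF C C C.counit_hom] and b' = bilinear_scale_left[OF Q Q \<epsilon>'(1)]
    have "tensor_lift R ?Q (\<lambda>(x, y). \<epsilon>' x \<odot>\<^bsub>?Q\<^esub> y) (tensor_map R ?Q ?Q ?p ?p (\<Delta> c)) =
        ?p (tensor_lift R C (\<lambda>(x, y). \<epsilon> x \<odot>\<^bsub>C\<^esub> y) (\<Delta> c))"
    proof (rule tensor_hom_eqI[OF C C Q mod_hom_comp[OF pp tensor_lift_hom[OF Q Q Q b']]
          mod_hom_comp[OF tensor_lift_hom[OF C C C b] p] _ D_closed[OF c]])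
      fix x y assume x: "x \<in> carrier C" and y: "y \<in> carrier C"
      have "\<epsilon> x \<in> carrier R" using mod_hom_closed[OF C.counit_hom x] by (simp add: self_module_def)
      then show "tensor_lift R ?Q (\<lambda>(x, y). \<epsilon>' x \<odot>\<^bsub>?Q\<^esub> y) (tensor_map R ?Q ?Q ?p ?p (tens R C C x y)) =
          ?p (tensor_lift R C (\<lambda>(x, y). \<epsilon> x \<odot>\<^bsub>C\<^esub> y) (tens R C C x y))"
        using x y by (simp add: tensor_map_tens[OF C C Q Q p p] tensor_lift_tens[OF Q Q Q b'] p_closed
            tensor_lift_tens[OF C C C b] \<epsilon>'(2) mod_hom_smult[OF p])
    qed
    then show ?thesis using C.counit_left[OF c] \<Delta>'(2)[OF c] by simp
  qed
  have counit_right: "tensor_lift R ?Q (\<lambda>(x, y). \<epsilon>' y \<odot>\<^bsub>?Q\<^esub> x) (\<Delta>' (?p c)) = ?p c" if c: "c \<in> carrier C" for c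
  proof -
    note b = bilinear_scale_right[OF C C C.counit_hom] and b' = bilinear_scale_right[OF Q Q \<epsilon>'(1)]
    have "tensor_lift R ?Q (\<lambda>(x, y). \<epsilon>' y \<odot>\<^bsub>?Q\<^esub> x) (tensor_map R ?Q ?Q ?p ?p (\<Delta> c)) =
        ?p (tensor_lift R C (\<lambda>(x, y). \<epsilon> y \<odot>\<^bsub>C\<^esub> x) (\<Delta> c))"
    proof (rule tensor_hom_eqI[OF C C Q mod_hom_comp[OF pp tensor_lift_hom[OF Q Q Q b']]
          mod_hom_comp[OF tensor_lift_hom[OF C C C b] p] _ D_closed[OF c]])
      fix x y assume x: "x \<in> carrier C" and y: "y \<in> carrier C"
      have "\<epsilon> y \<in> carrier R" using mod_hom_closed[OF C.counit_hom y] by (simp add: self_module_def)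
      then show "tensor_lift R ?Q (\<lambda>(x, y). \<epsilon>' y \<odot>\<^bsub>?Q\<^esub> x) (tensor_map R ?Q ?Q ?p ?p (tens R C C x y)) =
          ?p (tensor_lift R C (\<lambda>(x, y). \<epsilon> y \<odot>\<^bsub>C\<^esub> x) (tens R C C x y))"
        using x y by (simp add: tensor_map_tens[OF C C Q Q p p] tensor_lift_tens[OF Q Q Q b'] p_closed
            tensor_lift_tens[OF C C C b] \<epsilon>'(2) mod_hom_smult[OF p])
    qed
    then show ?thesis using C.counit_right[OF c] \<Delta>'(2)[OF c] by simp
  qed
  have "coalgebra R ?Q \<Delta>' \<epsilon>'"
  proof (intro coalgebra.intro coalgebra_axioms.intro)
    fix X assume "X \<in> carrier ?Q"
    then obtain c where "c \<in> carrier C" "X = ?p c" by (auto simp: carrier_quot_module)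
    then show "tensor_assoc R ?Q ?Q ?Q (tensor_map R (tensor R ?Q ?Q) ?Q \<Delta>' (\<lambda>x. x) (\<Delta>' X)) =
          tensor_map R ?Q (tensor R ?Q ?Q) (\<lambda>x. x) \<Delta>' (\<Delta>' X)"
      and "tensor_lift R ?Q (\<lambda>(x, y). \<epsilon>' x \<odot>\<^bsub>?Q\<^esub> y) (\<Delta>' X) = X"
      and "tensor_lift R ?Q (\<lambda>(x, y). \<epsilon>' y \<odot>\<^bsub>?Q\<^esub> x) (\<Delta>' X) = X"
      using coassoc counit_left counit_right by auto
  qed (fact Q \<Delta>'(1) \<epsilon>'(1))+
  moreover have "?p \<in> coalg_hom R C \<Delta> \<epsilon> ?Q \<Delta>' \<epsilon>'"
    using p \<Delta>'(2) \<epsilon>'(2) by (simp add: coalg_hom_def)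
  ultimately show ?thesis
    using assms(2) unfolding coideal_def by blast
qed

section \<open>Coinvariants of generalised quotients\<close>

definition right_ideal :: "('r, 'z) ring_scheme \<Rightarrow> ('r, 'h, 'x) module_scheme \<Rightarrow> 'h set \<Rightarrow> bool"
  where "right_ideal R H I \<longleftrightarrow> submodule I R H \<and> (\<forall>i\<in>I. \<forall>h\<in>carrier H. i \<otimes>\<^bsub>H\<^esub> h \<in> I)"

context comodule_algebra
begin

lemmas H_module = H.module_axioms and A_module = A.module_axioms
  and H_algebra = H.assoc_algebra_axioms and A_algebra = A.assoc_algebra_axioms

lemma coact_hom: "\<delta> \<in> mod_hom R A (tensor R A H)"
  using coact_alg_hom by (simp add: alg_hom_def)

lemma coact_mult:
  "\<lbrakk>a \<in> carrier A; b \<in> carrier A\<rbrakk> \<Longrightarrow> \<delta> (a \<otimes>\<^bsub>A\<^esub> b) = \<delta> a \<otimes>\<^bsub>tensor_alg R A H\<^esub> \<delta> b"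
  using coact_alg_hom by (auto simp: alg_hom_def dest: ring_hom_mult)

lemma coact_one: "\<delta> \<one>\<^bsub>A\<^esub> = tens R A H \<one>\<^bsub>A\<^esub> \<one>\<^bsub>H\<^esub>"
  using coact_alg_hom by (auto simp: alg_hom_def one_tensor_alg dest: ring_hom_one)

lemma comult_mult:
  "\<lbrakk>g \<in> carrier H; h \<in> carrier H\<rbrakk> \<Longrightarrow> \<Delta> (g \<otimes>\<^bsub>H\<^esub> h) = \<Delta> g \<otimes>\<^bsub>tensor_alg R H H\<^esub> \<Delta> h"
  using H.comult_alg_hom by (auto simp: alg_hom_def dest: ring_hom_mult)

lemma comult_one: "\<Delta> \<one>\<^bsub>H\<^esub> = tens R H H \<one>\<^bsub>H\<^esub> \<one>\<^bsub>H\<^esub>"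
  using H.comult_alg_hom by (auto simp: alg_hom_def one_tensor_alg dest: ring_hom_one)

lemma counit_mult: "\<lbrakk>g \<in> carrier H; h \<in> carrier H\<rbrakk> \<Longrightarrow> \<epsilon> (g \<otimes>\<^bsub>H\<^esub> h) = \<epsilon> g \<otimes>\<^bsub>R\<^esub> \<epsilon> h"
  using H.counit_alg_hom by (auto simp: alg_hom_def self_module_def dest: ring_hom_mult)

lemma counit_one: "\<epsilon> \<one>\<^bsub>H\<^esub> = \<one>\<^bsub>R\<^esub>"
  using H.counit_alg_hom ring_hom_one[of \<epsilon> H "self_module R"] by (auto simp: alg_hom_def self_module_def)


text \<open>Writing both sides as images under \<open>id \<otimes> \<pi>\<close> exhibits \<open>a\<close> as coinvariant if and only if
\<open>\<delta> a - a \<otimes> 1\<close> lies in the kernel of \<open>id \<otimes> \<pi>\<close>.\<close>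

lemma quot_coinvariants_iff:
  assumes "submodule I R H" "a \<in> carrier A"
  shows "a \<in> quot_coinvariants R H A \<delta> (quot_module H I) \<longleftrightarrow>
    tensor_map R A (quot_module H I) (\<lambda>x. x) (\<lambda>h. I +>\<^bsub>H\<^esub> h) (\<delta> a) =
    tensor_map R A (quot_module H I) (\<lambda>x. x) (\<lambda>h. I +>\<^bsub>H\<^esub> h) (tens R A H a \<one>\<^bsub>H\<^esub>)"
proof -
  have proj: "quot_proj H (quot_module H I) = (\<lambda>h. I +>\<^bsub>H\<^esub> h)"
    by (simp add: quot_proj_def quot_module_def fun_eq_iff)
  show ?thesis
    using assms(2) tensor_map_tens[OF A_module H_module A_module module_quot_module[OF H_module assms(1)]
        mod_hom_id coset_hom[OF H_module assms(1)] assms(2) H.one_closed]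
    by (simp add: quot_coinvariants_def proj)
qed

text \<open>Let \<open>\<pi> : H \<rightarrow> H/I\<close> be the projection. As \<open>I\<close> is a right ideal, \<open>A \<otimes> H/I\<close> is a right module over
\<open>A \<otimes> H\<close> and \<open>id \<otimes> \<pi>\<close> is linear over it. For coinvariant \<open>a\<close> and \<open>b\<close> this gives
\<open>(id \<otimes> \<pi>)(\<delta> a \<cdot> \<delta> b) = (id \<otimes> \<pi>)((a \<otimes> 1) \<cdot> \<delta> b) = a \<cdot> (id \<otimes> \<pi>)(\<delta> b) = ab \<otimes> \<pi>(1)\<close>
with \<open>A\<close> acting on the left factor.\<close>

lemma quot_coinvariants_subalgebra:
  assumes "right_ideal R H I"
  shows "quot_coinvariants R H A \<delta> (quot_module H I) \<in> carrier (Sub_Alg R A (coinvariants R H A \<delta>))"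
proof -
  let ?Q = "quot_module H I"
  let ?p = "\<lambda>h. I +>\<^bsub>H\<^esub> h"
  let ?S = "quot_coinvariants R H A \<delta> ?Q"
  have I: "submodule I R H" "\<And>i h. \<lbrakk>i \<in> I; h \<in> carrier H\<rbrakk> \<Longrightarrow> i \<otimes>\<^bsub>H\<^esub> h \<in> I"
    using assms by (auto simp: right_ideal_def)
  note mem = quot_coinvariants_iff[OF I(1)]
  have sub: "?S \<subseteq> carrier A" by (auto simp: quot_coinvariants_def)
  note Q = module_quot_module[OF H_module I(1)] and p = coset_hom[OF H_module I(1)]
  note AQ = module_tensor[OF A_module Q]
  note idp = tensor_map_right_hom[OF A_module H_module Q p]
  note left_hom = mod_hom_comp[OF coact_hom idp]
    and right_hom = mod_hom_comp[OF tens_hom_left[OF A_module H_module H.one_closed] idp]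
  have eq: "?S = {a \<in> carrier A. tensor_map R A ?Q (\<lambda>x. x) ?p (\<delta> a) = tensor_map R A ?Q (\<lambda>x. x) ?p (tens R A H a \<one>\<^bsub>H\<^esub>)}"
    using mem sub by auto
  have submod: "submodule ?S R A"
    unfolding eq by (rule equalizer_submodule[OF A_module AQ left_hom right_hom])
  note subE = module.submoduleE[OF A_module submod]
  have mult: "a \<otimes>\<^bsub>A\<^esub> b \<in> ?S" if a: "a \<in> ?S" and b: "b \<in> ?S" for a b
  proof -
    have ac: "a \<in> carrier A" "b \<in> carrier A" using a b sub by auto
    note closed = mod_hom_closed[OF coact_hom ac(1)] mod_hom_closed[OF coact_hom ac(2)]
      tens_closed[OF A_module H_module ac(1) H.one_closed] tens_closed[OF A_module H_module ac(2) H.one_closed]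
    have id_mult: "\<exists>\<rho>\<in>mod_hom R A A. \<forall>x\<in>carrier A. \<rho> x = x \<otimes>\<^bsub>A\<^esub> y" if "y \<in> carrier A" for y
      using mult_right_hom[OF A_algebra that] by auto
    note left_mult = mult_left_hom[OF A_algebra ac(1)]
    have one_mult: "(\<lambda>h. \<one>\<^bsub>H\<^esub> \<otimes>\<^bsub>H\<^esub> h) \<in> mod_hom R H H" by (rule mult_left_hom[OF H_algebra H.one_closed])
    have one_left: "tensor_map R A ?Q (\<lambda>x. x) ?p (tens R A H a \<one>\<^bsub>H\<^esub> \<otimes>\<^bsub>tensor_alg R A H\<^esub> Y) =
        tensor_map R A ?Q (\<lambda>y. a \<otimes>\<^bsub>A\<^esub> y) (\<lambda>q. q) (tensor_map R A ?Q (\<lambda>x. x) ?p Y)"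
      if Y: "Y \<in> carrier (tensor R A H)" for Y
    proof -
      have "tensor_map R A ?Q (\<lambda>x. x) ?p (tens R A H a \<one>\<^bsub>H\<^esub> \<otimes>\<^bsub>tensor_alg R A H\<^esub> Y) =
          tensor_map R A ?Q (\<lambda>y. a \<otimes>\<^bsub>A\<^esub> y) ?p Y"
        unfolding tensor_alg_mult_tens_left[OF A_algebra H_algebra ac(1) H.one_closed Y]
        by (rule tensor_map_comp[OF A_module H_module A_module H_module A_module Q left_mult one_mult
              mod_hom_id p left_mult p refl _ Y]) simp
      also have "\<dots> = tensor_map R A ?Q (\<lambda>y. a \<otimes>\<^bsub>A\<^esub> y) (\<lambda>q. q) (tensor_map R A ?Q (\<lambda>x. x) ?p Y)"
        by (rule tensor_map_comp[OF A_module H_module A_module Q A_module Q mod_hom_id p left_mult mod_hom_id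
              left_mult p refl refl Y, symmetric])
      finally show ?thesis .
    qed
    have "tensor_map R A ?Q (\<lambda>x. x) ?p (\<delta> (a \<otimes>\<^bsub>A\<^esub> b)) =
        tensor_map R A ?Q (\<lambda>x. x) ?p (tens R A H a \<one>\<^bsub>H\<^esub> \<otimes>\<^bsub>tensor_alg R A H\<^esub> \<delta> b)"
      unfolding coact_mult[OF ac]
      by (rule tensor_map_mult_cong[OF A_algebra H_algebra A_module Q mod_hom_id p id_mult
            right_ideal_quotient_mult[OF H_algebra I] closed(1,3,2)])
        (use mem[OF ac(1)] a in auto)
    also have "\<dots> = tensor_map R A ?Q (\<lambda>x. x) ?p
        (tens R A H a \<one>\<^bsub>H\<^esub> \<otimes>\<^bsub>tensor_alg R A H\<^esub> tens R A H b \<one>\<^bsub>H\<^esub>)"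
      using mem[OF ac(2)] b by (simp add: one_left closed)
    also have "tens R A H a \<one>\<^bsub>H\<^esub> \<otimes>\<^bsub>tensor_alg R A H\<^esub> tens R A H b \<one>\<^bsub>H\<^esub> = tens R A H (a \<otimes>\<^bsub>A\<^esub> b) \<one>\<^bsub>H\<^esub>"
      by (simp add: tensor_alg_mult_tens_left[OF A_algebra H_algebra ac(1) H.one_closed closed(4)]
          tensor_map_tens[OF A_module H_module A_module H_module left_mult one_mult ac(2) H.one_closed])
    finally show ?thesis using mem[of "a \<otimes>\<^bsub>A\<^esub> b"] ac by simp
  qed
  have one: "\<one>\<^bsub>A\<^esub> \<in> ?S" using mem[OF A.one_closed] coact_one by simp
  have "subring ?S A"
    by (rule A.subringI[OF sub one subE(3) mult subE(5)])
  moreover have "coinvariants R H A \<delta> \<subseteq> ?S"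
    using mem by (auto simp: coinvariants_def)
  ultimately show ?thesis
    using submod by (simp add: Sub_Alg_def)
qed

lemma quot_coinvariants_mono:
  assumes "submodule I R H" "submodule J R H" "I \<subseteq> J"
  shows "quot_coinvariants R H A \<delta> (quot_module H I) \<subseteq> quot_coinvariants R H A \<delta> (quot_module H J)"
proof
  fix a assume a: "a \<in> quot_coinvariants R H A \<delta> (quot_module H I)"
  then have ac: "a \<in> carrier A" by (simp add: quot_coinvariants_def)
  let ?Q = "quot_module H I" and ?P = "quot_module H J"
  note Q = module_quot_module[OF H_module assms(1)] and p = coset_hom[OF H_module assms(1)]
  note P = module_quot_module[OF H_module assms(2)] and q = coset_hom[OF H_module assms(2)]
  have zero: "J +>\<^bsub>H\<^esub> x = \<zero>\<^bsub>?P\<^esub>" if "x \<in> I" for x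
    using that assms(3) module.submoduleE(1)[OF H_module assms(2)] coset_eq_zero_iff[OF H_module assms(2), of x] by auto
  obtain t where t: "t \<in> mod_hom R ?Q ?P" "\<And>x. x \<in> carrier H \<Longrightarrow> t (I +>\<^bsub>H\<^esub> x) = J +>\<^bsub>H\<^esub> x"
    using quot_module_factor[OF H_module assms(1) P q zero] by blast
  have "tensor_map R A ?P (\<lambda>x. x) t (tensor_map R A ?Q (\<lambda>x. x) (\<lambda>h. I +>\<^bsub>H\<^esub> h) X) =
      tensor_map R A ?P (\<lambda>x. x) (\<lambda>h. J +>\<^bsub>H\<^esub> h) X" if "X \<in> carrier (tensor R A H)" for X
    by (rule tensor_map_right_comp[OF A_module H_module Q P p t(1) q t(2) that])
  then show "a \<in> quot_coinvariants R H A \<delta> ?P"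
    using a quot_coinvariants_iff[OF assms(1) ac] quot_coinvariants_iff[OF assms(2) ac]
      mod_hom_closed[OF coact_hom ac] tens_closed[OF A_module H_module ac H.one_closed] by metis
qed

text \<open>This is where coassociativity enters. Let \<open>p : H \<rightarrow> Q = H/I\<close> be the projection. Coassociativity turns
\<open>(id \<otimes> (p \<otimes> p)\<Delta>)(\<delta> a)\<close> into \<open>(id \<otimes> p \<otimes> p)(\<delta> \<otimes> id)(\<delta> a)\<close>, which depends only on
\<open>(id \<otimes> p)(\<delta> a)\<close>. So \<open>\<delta> a\<close> may be replaced by \<open>a \<otimes> 1\<close>, giving \<open>(id \<otimes> p)(\<delta> a) \<otimes> p(1)\<close>, and a
second replacement gives \<open>a \<otimes> p(1) \<otimes> p(1)\<close>.\<close>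

lemma coinvariant_comult:
  assumes "submodule I R H" "a \<in> quot_coinvariants R H A \<delta> (quot_module H I)"
    and "Q = quot_module H I" "p = (\<lambda>h. I +>\<^bsub>H\<^esub> h)"
  shows "tensor_map R A (tensor R Q Q) (\<lambda>x. x) (\<lambda>h. tensor_map R Q Q p p (\<Delta> h)) (\<delta> a) =
    tensor_map R A (tensor R Q Q) (\<lambda>x. x) (\<lambda>h. tensor_map R Q Q p p (\<Delta> h)) (tens R A H a \<one>\<^bsub>H\<^esub>)"
proof -
  note mA = A_module and mH = H_module
  have ac: "a \<in> carrier A" using assms(2) by (simp add: quot_coinvariants_def)
  have Q: "module R Q" unfolding assms(3) by (rule module_quot_module[OF mH assms(1)])
  have p: "p \<in> mod_hom R H Q" unfolding assms(3,4) by (rule coset_hom[OF mH assms(1)])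
  note one = H.one_closed
  note pc = mod_hom_closed[OF p] and dc = mod_hom_closed[OF coact_hom]
  let ?QQ = "tensor R Q Q"
  let ?HH = "tensor R H H"
  note QQ = module_tensor[OF Q Q] and HH = module_tensor[OF mH mH] and HQ = module_tensor[OF mH Q]
  note AH = module_tensor[OF mA mH]
  note pp = tensor_map_hom[OF mH mH Q Q p p]
  note ppD = mod_hom_comp[OF H.comult_hom pp]
  have a: "tensor_map R A Q (\<lambda>x. x) p (\<delta> a) = tensor_map R A Q (\<lambda>x. x) p (tens R A H a \<one>\<^bsub>H\<^esub>)"
    using assms(2) quot_coinvariants_iff[OF assms(1) ac] by (simp add: assms(3,4))
  \<comment> \<open>\<open>\<Phi>\<close> is \<open>(id \<otimes> p \<otimes> p)(\<delta> \<otimes> id)\<close> up to associativity, and \<open>\<Psi>\<close> is the map that it induces on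
    \<open>A \<otimes> Q\<close>.\<close>
  define \<Phi> where "\<Phi> Z = tensor_map R A ?QQ (\<lambda>x. x) (tensor_map R Q Q p p)
    (tensor_assoc R A H H (tensor_map R (tensor R A H) H \<delta> (\<lambda>h. h) Z))" for Z
  define \<Psi> where "\<Psi> W = tensor_map R A ?QQ (\<lambda>x. x) (tensor_map R Q Q p (\<lambda>q. q))
    (tensor_assoc R A H Q (tensor_map R (tensor R A H) Q \<delta> (\<lambda>q. q) W))" for W
  note pid = tensor_map_hom[OF mH Q Q Q p mod_hom_id]
  have \<Phi>: "\<Phi> \<in> mod_hom R (tensor R A H) (tensor R A ?QQ)"
    unfolding \<Phi>_def
    by (rule mod_hom_comp[OF mod_hom_comp[OF tensor_map_hom[OF mA mH AH mH coact_hom mod_hom_id]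
            tensor_assoc_hom[OF mA mH mH]] tensor_map_right_hom[OF mA HH QQ pp]])
  have \<Psi>: "\<Psi> \<in> mod_hom R (tensor R A Q) (tensor R A ?QQ)"
    unfolding \<Psi>_def
    by (rule mod_hom_comp[OF mod_hom_comp[OF tensor_map_hom[OF mA Q AH Q coact_hom mod_hom_id]
            tensor_assoc_hom[OF mA mH Q]] tensor_map_right_hom[OF mA HQ QQ pid]])
  have \<Phi>_tens: "\<Phi> (tens R A H x h) = tensor_map R A ?QQ (\<lambda>x. x) (\<lambda>m. tens R Q Q (p m) (p h)) (\<delta> x)"
    if x: "x \<in> carrier A" and h: "h \<in> carrier H" for x h
  proof -
    note th = tens_hom_left[OF mH mH h] and pth = mod_hom_comp[OF p tens_hom_left[OF Q Q pc[OF h]]]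
    have "\<Phi> (tens R A H x h) = tensor_map R A ?QQ (\<lambda>x. x) (tensor_map R Q Q p p)
        (tensor_map R A ?HH (\<lambda>x. x) (\<lambda>m. tens R H H m h) (\<delta> x))"
      by (simp add: \<Phi>_def tensor_map_tens[OF mA mH AH mH coact_hom mod_hom_id x h]
          tensor_assoc_tens_left[OF mA mH mH dc[OF x] h])
    also have "\<dots> = tensor_map R A ?QQ (\<lambda>x. x) (\<lambda>m. tens R Q Q (p m) (p h)) (\<delta> x)"
      by (rule tensor_map_right_comp[OF mA mH HH QQ th pp pth _ dc[OF x]])
        (rule tensor_map_tens[OF mH mH Q Q p p _ h])
    finally show ?thesis .
  qed
  have \<Psi>_tens: "\<Psi> (tens R A Q x (p h)) = tensor_map R A ?QQ (\<lambda>x. x) (\<lambda>m. tens R Q Q (p m) (p h)) (\<delta> x)"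
    if x: "x \<in> carrier A" and h: "h \<in> carrier H" for x h
  proof -
    note th = tens_hom_left[OF mH Q pc[OF h]] and pth = mod_hom_comp[OF p tens_hom_left[OF Q Q pc[OF h]]]
    have "\<Psi> (tens R A Q x (p h)) = tensor_map R A ?QQ (\<lambda>x. x) (tensor_map R Q Q p (\<lambda>q. q))
        (tensor_map R A (tensor R H Q) (\<lambda>x. x) (\<lambda>m. tens R H Q m (p h)) (\<delta> x))"
      by (simp add: \<Psi>_def tensor_map_tens[OF mA Q AH Q coact_hom mod_hom_id x pc[OF h]]
          tensor_assoc_tens_left[OF mA mH Q dc[OF x] pc[OF h]])
    also have "\<dots> = tensor_map R A ?QQ (\<lambda>x. x) (\<lambda>m. tens R Q Q (p m) (p h)) (\<delta> x)"
      by (rule tensor_map_right_comp[OF mA mH HQ QQ th pid pth _ dc[OF x]])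
        (rule tensor_map_tens[OF mH Q Q Q p mod_hom_id _ pc[OF h]])
    finally show ?thesis .
  qed
  have factor: "\<Phi> Z = \<Psi> (tensor_map R A Q (\<lambda>x. x) p Z)" if Z: "Z \<in> carrier (tensor R A H)" for Z
    by (rule tensor_hom_eqI[OF mA mH module_tensor[OF mA QQ] \<Phi>
          mod_hom_comp[OF tensor_map_right_hom[OF mA mH Q p] \<Psi>] _ Z])
      (simp add: \<Phi>_tens \<Psi>_tens tensor_map_tens[OF mA mH mA Q mod_hom_id p])
  have "tensor_map R A ?QQ (\<lambda>x. x) (\<lambda>h. tensor_map R Q Q p p (\<Delta> h)) (\<delta> a) =
      tensor_map R A ?QQ (\<lambda>x. x) (tensor_map R Q Q p p) (tensor_map R A ?HH (\<lambda>x. x) \<Delta> (\<delta> a))"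
    by (rule tensor_map_right_comp[OF mA mH HH QQ H.comult_hom pp ppD refl dc[OF ac], symmetric])
  also have "\<dots> = \<Phi> (\<delta> a)"
    by (simp add: \<Phi>_def coact_coassoc[OF ac])
  also have "\<dots> = \<Phi> (tens R A H a \<one>\<^bsub>H\<^esub>)"
    by (simp add: factor dc[OF ac] tens_closed[OF mA mH ac one] a)
  also have "\<dots> = tensor_map R A ?QQ (\<lambda>x. x) (\<lambda>m. tens R Q Q (p m) (p \<one>\<^bsub>H\<^esub>)) (\<delta> a)"
    by (rule \<Phi>_tens[OF ac one])
  also have "\<dots> = tensor_map R A ?QQ (\<lambda>x. x) (\<lambda>q. tens R Q Q q (p \<one>\<^bsub>H\<^esub>)) (tensor_map R A Q (\<lambda>x. x) p (\<delta> a))"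
    by (rule tensor_map_right_comp[OF mA mH Q QQ p tens_hom_left[OF Q Q pc[OF one]]
          mod_hom_comp[OF p tens_hom_left[OF Q Q pc[OF one]]] refl dc[OF ac], symmetric])
  also have "\<dots> = tens R A ?QQ a (tens R Q Q (p \<one>\<^bsub>H\<^esub>) (p \<one>\<^bsub>H\<^esub>))"
    by (simp add: a tensor_map_tens[OF mA mH mA Q mod_hom_id p ac one]
        tensor_map_tens[OF mA Q mA QQ mod_hom_id tens_hom_left[OF Q Q pc[OF one]] ac pc[OF one]])
  also have "\<dots> = tensor_map R A ?QQ (\<lambda>x. x) (\<lambda>h. tensor_map R Q Q p p (\<Delta> h)) (tens R A H a \<one>\<^bsub>H\<^esub>)"
    by (simp add: tensor_map_tens[OF mA mH mA QQ mod_hom_id ppD ac one] comult_one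
        tensor_map_tens[OF mH mH Q Q p p one one])
  finally show ?thesis .
qed

lemma coact_counit_tens:
  assumes ac: "a \<in> carrier A"
  shows "tensor_map R A (self_module R) (\<lambda>x. x) \<epsilon> (\<delta> a) =
    tensor_map R A (self_module R) (\<lambda>x. x) \<epsilon> (tens R A H a \<one>\<^bsub>H\<^esub>)"
proof -
  note mA = A_module and mH = H_module
  note S = module_self_module[OF module_cring[OF mA]]
  note AS = module_tensor[OF mA S]
  have one: "\<one>\<^bsub>R\<^esub> \<in> carrier (self_module R)" by (simp add: self_module_def)
  note b = bilinear_scale_right[OF mA mH H.counit_hom]
  note lift = tensor_lift_hom[OF mA mH mA b]
  note tone = tens_hom_left[OF mA S one]
  have "tensor_map R A (self_module R) (\<lambda>x. x) \<epsilon> (\<delta> a) =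
      tens R A (self_module R) (tensor_lift R A (\<lambda>(x, h). \<epsilon> h \<odot>\<^bsub>A\<^esub> x) (\<delta> a)) \<one>\<^bsub>R\<^esub>"
  proof (rule tensor_hom_eqI[OF mA mH AS tensor_map_right_hom[OF mA mH S H.counit_hom]
        mod_hom_comp[OF lift tone] _ mod_hom_closed[OF coact_hom ac]])
    fix x h assume x: "x \<in> carrier A" and h: "h \<in> carrier H"
    have eh: "\<epsilon> h \<in> carrier R" using mod_hom_closed[OF H.counit_hom h] by (simp add: self_module_def)
    have "tens R A (self_module R) x (\<epsilon> h \<odot>\<^bsub>self_module R\<^esub> \<one>\<^bsub>R\<^esub>) =
        tens R A (self_module R) (\<epsilon> h \<odot>\<^bsub>A\<^esub> x) \<one>\<^bsub>R\<^esub>"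
      by (simp only: mod_hom_smult[OF tone eh x] mod_hom_smult[OF tens_hom_right[OF mA S x] eh one])
    then have "tens R A (self_module R) x (\<epsilon> h) = tens R A (self_module R) (\<epsilon> h \<odot>\<^bsub>A\<^esub> x) \<one>\<^bsub>R\<^esub>"
      using eh by (simp add: self_module_def)
    then show "tensor_map R A (self_module R) (\<lambda>x. x) \<epsilon> (tens R A H x h) =
        tens R A (self_module R) (tensor_lift R A (\<lambda>(x, h). \<epsilon> h \<odot>\<^bsub>A\<^esub> x) (tens R A H x h)) \<one>\<^bsub>R\<^esub>"
      by (simp add: tensor_map_tens[OF mA mH mA S mod_hom_id H.counit_hom x h] tensor_lift_tens[OF mA mH mA b x h])
  qed
  then show ?thesis
    by (simp add: coact_counit[OF ac] counit_one
        tensor_map_tens[OF mA mH mA S mod_hom_id H.counit_hom ac H.one_closed])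
qed

text \<open>The test for coinvariance modulo a kernel, by \<open>flat_kernel\<close> applied to \<open>\<delta> a - a \<otimes> 1\<close>.\<close>

lemma coinvariants_of_kernel:
  assumes "flat_module R A" "module R M" "f \<in> mod_hom R H M" "a \<in> carrier A"
    and "tensor_map R A M (\<lambda>x. x) f (\<delta> a) = tensor_map R A M (\<lambda>x. x) f (tens R A H a \<one>\<^bsub>H\<^esub>)"
    and "K = {h \<in> carrier H. f h = \<zero>\<^bsub>M\<^esub>}"
  shows "a \<in> quot_coinvariants R H A \<delta> (quot_module H K)"
proof -
  note mA = A_module and mH = H_module
  have K: "submodule K R H" unfolding assms(6) by (rule kernel_submodule[OF mH assms(2,3)])
  note AH = module_tensor[OF mA mH]
  note closed = mod_hom_closed[OF coact_hom assms(4)] tens_closed[OF mA mH assms(4) H.one_closed]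
  interpret AH: module R "tensor R A H" by (rule AH)
  have X: "\<delta> a \<ominus>\<^bsub>tensor R A H\<^esub> tens R A H a \<one>\<^bsub>H\<^esub> \<in> carrier (tensor R A H)"
    by (rule AH.M.minus_closed[OF closed])
  have "tensor_map R A M (\<lambda>x. x) f (\<delta> a \<ominus>\<^bsub>tensor R A H\<^esub> tens R A H a \<one>\<^bsub>H\<^esub>) = \<zero>\<^bsub>tensor R A M\<^esub>"
    using mod_hom_eq_iff_minus[OF AH module_tensor[OF mA assms(2)] tensor_map_right_hom[OF mA mH assms(2,3)] closed]
      assms(5) by simp
  from flat_kernel[OF assms(1) mA mH assms(2,3) X this assms(6)]
  show ?thesis
    using mod_hom_eq_iff_minus[OF AH module_tensor[OF mA module_quot_module[OF mH K]]
        tensor_map_right_hom[OF mA mH module_quot_module[OF mH K] coset_hom[OF mH K]] closed]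
      quot_coinvariants_iff[OF K assms(4)] by simp
qed

lemma coinvariants_of_Inter:
  assumes "flat_module R A" "mittag_leffler R A" "\<And>K. K \<in> \<K> \<Longrightarrow> submodule K R H" "a \<in> carrier A"
    and "\<And>K. K \<in> \<K> \<Longrightarrow> a \<in> quot_coinvariants R H A \<delta> (quot_module H K)"
    and "D = {h \<in> carrier H. \<forall>K\<in>\<K>. h \<in> K}" "submodule D R H"
  shows "a \<in> quot_coinvariants R H A \<delta> (quot_module H D)"
proof -
  note mA = A_module and mH = H_module
  note AH = module_tensor[OF mA mH]
  note closed = mod_hom_closed[OF coact_hom assms(4)] tens_closed[OF mA mH assms(4) H.one_closed]
  interpret AH: module R "tensor R A H" by (rule AH)
  let ?X = "\<delta> a \<ominus>\<^bsub>tensor R A H\<^esub> tens R A H a \<one>\<^bsub>H\<^esub>"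
  have X: "?X \<in> carrier (tensor R A H)" by (rule AH.M.minus_closed[OF closed])
  have iff: "a \<in> quot_coinvariants R H A \<delta> (quot_module H K) \<longleftrightarrow>
      tensor_map R A (quot_module H K) (\<lambda>x. x) (\<lambda>h. K +>\<^bsub>H\<^esub> h) ?X = \<zero>\<^bsub>tensor R A (quot_module H K)\<^esub>"
    if K: "submodule K R H" for K
    using mod_hom_eq_iff_minus[OF AH module_tensor[OF mA module_quot_module[OF mH K]]
        tensor_map_right_hom[OF mA mH module_quot_module[OF mH K] coset_hom[OF mH K]] closed]
      quot_coinvariants_iff[OF K assms(4)] by simp
  show ?thesis
    unfolding iff[OF assms(7)]
    using assms(5) iff[OF assms(3)]
    by (intro flat_mittag_leffler_Inter[OF assms(1,2) mA mH assms(3) X _ assms(6)]) blast+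
qed

text \<open>The core of the argument. Let \<open>D\<close> be the smallest right ideal such that \<open>S\<close> is coinvariant modulo it;
it is the intersection of all of them, as \<open>A\<close> is flat and Mittag-Leffler. The kernel of \<open>\<epsilon>\<close> and
the set of \<open>h\<close> with \<open>(p \<otimes> p)(\<Delta> h) = 0\<close>, for the projection \<open>p : H \<rightarrow> H/D\<close>, are again right ideals
modulo which \<open>S\<close> is coinvariant. By minimality both contain \<open>D\<close>, and this says that \<open>D\<close> is a
coideal.\<close>

lemma largest_generalised_quotient:
  assumes "flat_module R A" "mittag_leffler R A" "S \<subseteq> carrier A"
  obtains D where "right_ideal_coideal R H \<Delta> \<epsilon> D" "S \<subseteq> quot_coinvariants R H A \<delta> (quot_module H D)"
    "\<And>I. \<lbrakk>right_ideal R H I; S \<subseteq> quot_coinvariants R H A \<delta> (quot_module H I)\<rbrakk> \<Longrightarrow> D \<subseteq> I"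
proof -
  note mA = A_module and mH = H_module
  define \<K> where "\<K> = {K. right_ideal R H K \<and> S \<subseteq> quot_coinvariants R H A \<delta> (quot_module H K)}"
  define D where "D = {h \<in> carrier H. \<forall>K\<in>\<K>. h \<in> K}"
  have sub: "submodule K R H" if "K \<in> \<K>" for K using that by (simp add: \<K>_def right_ideal_def)
  have D: "submodule D R H"
    using submodule_zero[OF mH sub] module.submoduleE(4,5)[OF mH sub]
    by (intro submoduleI'[OF mH]) (auto simp: D_def)
  have D_ideal: "right_ideal R H D"
    using D by (auto simp: right_ideal_def D_def \<K>_def)
  \<comment> \<open>The defining property of \<open>\<K>\<close> passes to the intersection, so \<open>D\<close> belongs to \<open>\<K>\<close>.\<close>
  have D_coinv: "S \<subseteq> quot_coinvariants R H A \<delta> (quot_module H D)"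
    using coinvariants_of_Inter[OF assms(1,2) sub _ _ D_def D] assms(3) by (auto simp: \<K>_def)
  have D_least: "D \<subseteq> K" if "K \<in> \<K>" for K using that by (auto simp: D_def)
  have DE: "i \<otimes>\<^bsub>H\<^esub> h \<in> D" if "i \<in> D" "h \<in> carrier H" for i h
    using D_ideal that by (simp add: right_ideal_def)
  let ?Q = "quot_module H D"
  let ?p = "\<lambda>h. D +>\<^bsub>H\<^esub> h"
  note Q = module_quot_module[OF mH D] and p = coset_hom[OF mH D]
  note QQ = module_tensor[OF Q Q] and pp = tensor_map_hom[OF mH mH Q Q p p]
  note S = module_self_module[OF module_cring[OF mA]]
  note HH = module_tensor[OF mH mH]
  note ppD = mod_hom_comp[OF H.comult_hom pp]
  let ?E = "{h \<in> carrier H. \<epsilon> h = \<zero>\<^bsub>self_module R\<^esub>}"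
  have "right_ideal R H ?E"
    unfolding right_ideal_def
  proof (intro conjI ballI)
    show "submodule ?E R H" by (rule kernel_submodule[OF mH S H.counit_hom])
    fix i h assume "i \<in> ?E" "h \<in> carrier H"
    then show "i \<otimes>\<^bsub>H\<^esub> h \<in> ?E"
      using mod_hom_closed[OF H.counit_hom, of h] by (simp add: counit_mult self_module_def)
  qed
  moreover have "S \<subseteq> quot_coinvariants R H A \<delta> (quot_module H ?E)"
    using coinvariants_of_kernel[OF assms(1) S H.counit_hom _ coact_counit_tens refl] assms(3) by auto
  ultimately have DE1: "D \<subseteq> ?E" by (intro D_least) (simp add: \<K>_def)
  let ?G = "{h \<in> carrier H. tensor_map R ?Q ?Q ?p ?p (\<Delta> h) = \<zero>\<^bsub>tensor R ?Q ?Q\<^esub>}"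
  have "right_ideal R H ?G"
    unfolding right_ideal_def
  proof (intro conjI ballI)
    show "submodule ?G R H" by (rule kernel_submodule[OF mH QQ ppD])
    fix i h assume i: "i \<in> ?G" and h: "h \<in> carrier H"
    interpret HH: module R "tensor R H H" by (rule HH)
    have ic: "i \<in> carrier H" using i by simp
    note Di = mod_hom_closed[OF H.comult_hom ic] and Dh = mod_hom_closed[OF H.comult_hom h]
    note mult_hom = tensor_alg_mult_hom_left[OF H_algebra H_algebra Dh]
    have "tensor_map R ?Q ?Q ?p ?p (\<Delta> i) = tensor_map R ?Q ?Q ?p ?p \<zero>\<^bsub>tensor R H H\<^esub>"
      using i mod_hom_zero[OF HH QQ pp] by simp
    then have "tensor_map R ?Q ?Q ?p ?p (\<Delta> i \<otimes>\<^bsub>tensor_alg R H H\<^esub> \<Delta> h) =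
        tensor_map R ?Q ?Q ?p ?p (\<zero>\<^bsub>tensor R H H\<^esub> \<otimes>\<^bsub>tensor_alg R H H\<^esub> \<Delta> h)"
      by (intro tensor_map_mult_cong[OF H_algebra H_algebra Q Q p p
            right_ideal_quotient_mult[OF H_algebra D DE] right_ideal_quotient_mult[OF H_algebra D DE]
            Di HH.M.zero_closed Dh])
    also have "\<dots> = \<zero>\<^bsub>tensor R ?Q ?Q\<^esub>"
      using mod_hom_zero[OF HH HH mult_hom] mod_hom_zero[OF HH QQ pp] by simp
    finally show "i \<otimes>\<^bsub>H\<^esub> h \<in> ?G" using ic h by (simp add: comult_mult)
  qed
  moreover have "S \<subseteq> quot_coinvariants R H A \<delta> (quot_module H ?G)"
    using coinvariants_of_kernel[OF assms(1) QQ ppD _ coinvariant_comult[OF D _ refl refl] refl] D_coinv assms(3)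
    by blast
  ultimately have DG: "D \<subseteq> ?G" by (intro D_least) (simp add: \<K>_def)
  have "coideal R H \<Delta> \<epsilon> D"
    by (rule coideal_criterion[OF H.coalgebra_axioms D]) (use DE1 DG in \<open>auto simp: self_module_def\<close>)
  then have "right_ideal_coideal R H \<Delta> \<epsilon> D"
    using DE by (simp add: right_ideal_coideal_def)
  then show thesis
    by (rule that[OF _ D_coinv D_least]) (simp add: \<K>_def)
qed

end

section \<open>The Galois connection\<close>

lemma quot_module_inject: "quot_module M I = quot_module M J \<longleftrightarrow> I = J"
  by (auto simp: quot_module_def)

lemma right_ideal_coidealD:
  "right_ideal_coideal R H \<Delta> \<epsilon> I \<Longrightarrow> right_ideal R H I"
  by (simp add: right_ideal_coideal_def coideal_def right_ideal_def)

lemma Quot_gen_le_iff: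
  assumes "right_ideal_coideal R H \<Delta> \<epsilon> I" "right_ideal_coideal R H \<Delta> \<epsilon> J"
  shows "quot_module H J \<sqsubseteq>\<^bsub>Quot_gen R H \<Delta> \<epsilon>\<^esub> quot_module H I \<longleftrightarrow> I \<subseteq> J"
  using assms by (auto simp: Quot_gen_def quot_module_inject)

lemma carrier_Quot_gen:
  "carrier (Quot_gen R H \<Delta> \<epsilon>) = {quot_module H I | I. right_ideal_coideal R H \<Delta> \<epsilon> I}"
  by (simp add: Quot_gen_def)

lemma partial_order_Quot_gen: "partial_order (Quot_gen R H \<Delta> \<epsilon>)"
  by unfold_locales (auto simp: Quot_gen_def quot_module_inject)

lemma partial_order_Sub_Alg: "partial_order (Sub_Alg R A B)"
  by unfold_locales (auto simp: Sub_Alg_def)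

text \<open>The supremum is a Hilbert choice, so its existence must be known: here it is attained.\<close>

lemma sup_eq_greatest:
  assumes "partial_order L" "X \<subseteq> carrier L" "x \<in> X" "\<And>y. y \<in> X \<Longrightarrow> y \<sqsubseteq>\<^bsub>L\<^esub> x"
  shows "\<Squnion>\<^bsub>L\<^esub> X = x"
proof -
  interpret partial_order L by fact
  have least: "least L x (Upper L X)"
    using assms(2-4) by (intro least_UpperI) (auto simp: Upper_def)
  show ?thesis
    unfolding sup_def using least least_unique by (intro some_equality) blast+
qed

theorem theorem4p2p2:
  fixes R :: "('r, 'z) ring_scheme"
    and H :: "('r, 'h, 'x) module_scheme"
    and A :: "('r, 'a, 'y) module_scheme"
    and \<Delta> :: "'h \<Rightarrow> ('h \<times> 'h \<Rightarrow> 'r) set"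
    and \<epsilon> :: "'h \<Rightarrow> 'r"
    and \<delta> :: "'a \<Rightarrow> ('a \<times> 'h \<Rightarrow> 'r) set"
  assumes "cring R"
    and "bialgebra R H \<Delta> \<epsilon>"
    and "comodule_algebra R H \<Delta> \<epsilon> A \<delta>"
    and "flat_module R A" and "mittag_leffler R A"
    and "flat_module R H" and "mittag_leffler R H"
  shows "antitone_galois_connection
    (Sub_Alg R A (coinvariants R H A \<delta>))
    (Quot_gen R H \<Delta> \<epsilon>)
    (\<lambda>S. \<Squnion>\<^bsub>Quot_gen R H \<Delta> \<epsilon>\<^esub>
           {Q \<in> carrier (Quot_gen R H \<Delta> \<epsilon>). S \<subseteq> quot_coinvariants R H A \<delta> Q})
    (\<lambda>Q. quot_coinvariants R H A \<delta> Q)"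
proof -
  interpret comodule_algebra R H \<Delta> \<epsilon> A \<delta> by fact
  let ?P = "Sub_Alg R A (coinvariants R H A \<delta>)"
  let ?Q = "Quot_gen R H \<Delta> \<epsilon>"
  let ?\<phi> = "quot_coinvariants R H A \<delta>"
  let ?X = "\<lambda>S. {Q \<in> carrier ?Q. S \<subseteq> ?\<phi> Q}"
  let ?\<psi> = "\<lambda>S. \<Squnion>\<^bsub>?Q\<^esub> ?X S"
  have P_simps: "S \<in> carrier ?P \<Longrightarrow> S \<subseteq> carrier A" "(S \<sqsubseteq>\<^bsub>?P\<^esub> T) = (S \<subseteq> T)" for S T
    using subringE(1)[of S A] by (auto simp: Sub_Alg_def)
  have greatest: "?\<psi> S \<in> ?X S \<and> (\<forall>Q\<in>?X S. Q \<sqsubseteq>\<^bsub>?Q\<^esub> ?\<psi> S)" if S: "S \<subseteq> carrier A" for S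
  proof -
    obtain D where D: "right_ideal_coideal R H \<Delta> \<epsilon> D" "S \<subseteq> ?\<phi> (quot_module H D)"
      "\<And>I. \<lbrakk>right_ideal R H I; S \<subseteq> ?\<phi> (quot_module H I)\<rbrakk> \<Longrightarrow> D \<subseteq> I"
      using largest_generalised_quotient[OF assms(4,5) S] by blast
    have mem: "quot_module H D \<in> ?X S" using D(1,2) by (auto simp: carrier_Quot_gen)
    have max: "Q \<sqsubseteq>\<^bsub>?Q\<^esub> quot_module H D" if "Q \<in> ?X S" for Q
      using that D(3)[OF right_ideal_coidealD] by (auto simp: carrier_Quot_gen Quot_gen_le_iff[OF D(1)])
    have "?\<psi> S = quot_module H D"
      by (rule sup_eq_greatest[OF partial_order_Quot_gen _ mem max]) auto
    then show ?thesis using mem max by simp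
  qed
  show ?thesis
    unfolding antitone_galois_connection_def
  proof (intro conjI ballI impI)
    show "?\<psi> \<in> carrier ?P \<rightarrow> carrier ?Q"
      using greatest P_simps(1) by blast
    show "?\<phi> \<in> carrier ?Q \<rightarrow> carrier ?P"
      using quot_coinvariants_subalgebra[OF right_ideal_coidealD] by (auto simp: carrier_Quot_gen)
    fix S T assume S: "S \<in> carrier ?P" and T: "T \<in> carrier ?P" and "S \<sqsubseteq>\<^bsub>?P\<^esub> T"
    then have "?X T \<subseteq> ?X S" using P_simps(2) by auto
    then show "?\<psi> T \<sqsubseteq>\<^bsub>?Q\<^esub> ?\<psi> S"
      using greatest[OF P_simps(1)[OF S]] greatest[OF P_simps(1)[OF T]] by blast
  next
    fix Q' Q assume "Q' \<in> carrier ?Q" "Q \<in> carrier ?Q" and le: "Q' \<sqsubseteq>\<^bsub>?Q\<^esub> Q"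
    obtain I J where IJ: "right_ideal_coideal R H \<Delta> \<epsilon> I" "right_ideal_coideal R H \<Delta> \<epsilon> J"
      "Q = quot_module H I" "Q' = quot_module H J" "I \<subseteq> J"
      using le by (auto simp: Quot_gen_def)
    show "?\<phi> Q \<sqsubseteq>\<^bsub>?P\<^esub> ?\<phi> Q'"
      using quot_coinvariants_mono[of I J] IJ right_ideal_coidealD[OF IJ(1)] right_ideal_coidealD[OF IJ(2)]
      by (simp add: P_simps(2) right_ideal_def)
  next
    fix S assume "S \<in> carrier ?P"
    then show "S \<sqsubseteq>\<^bsub>?P\<^esub> ?\<phi> (?\<psi> S)"
      using greatest[OF P_simps(1)] by (auto simp: P_simps(2))
  next
    fix Q assume Q: "Q \<in> carrier ?Q"
    have "?\<phi> Q \<subseteq> carrier A" by (auto simp: quot_coinvariants_def)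
    then show "Q \<sqsubseteq>\<^bsub>?Q\<^esub> ?\<psi> (?\<phi> Q)" using greatest Q by blast
  qed (rule partial_order_Sub_Alg partial_order_Quot_gen)+
qed

end
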